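(* Let $\Bbbk$ be a unital commutative ring and let $\mathsf{X}=\Bbbk\mathsf{X}_0$ be a linearized $\mathsf{E}$-bicomodule with diagonal $\Delta:\mathsf{X}\to\mathsf{X}\cdot\mathsf{X}$, $\Delta(z)=\sum_{(S,T)}z\backslash\!\backslash S\otimes z/\!/T$. The cup product $$-\smile-:K^p(\mathsf{X})\otimes K^q(\mathsf{X})\longrightarrow K^{p+q}(\mathsf{X})$$ induced by the diagonal is such that for equivariant maps $f:\mathsf{X}[p]\to\operatorname{sgn}_p$ and $g:\mathsf{X}[q]\to\operatorname{sgn}_q$, and $z\in\mathsf{X}[p+q]$, $$(f\smile g)(z)=\sum_{(S,T)}(-1)^{\operatorname{sch}(S,T)}f(\lambda_S(z\backslash\!\backslash S))\,g(\lambda_T(z/\!/T)),$$ where the sum runs through decompositions $(S,T)$ of $[p+q]$ with $\#S=p$ and $\#T=q$.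
   Context: A (linear) species is a functor from finite sets and bijections to $\Bbbk$-modules; $\mathsf{X}[n]$ is its value on $[n]=\{1,\ldots,n\}$. A decomposition $(S,T)$ of $I$ is an ordered pair of disjoint, possibly empty, subsets with union $I$. The Cauchy product is $(\mathsf{X}\cdot\mathsf{Y})[I]=\bigoplus_{(S,T)}\mathsf{X}[S]\otimes\mathsf{Y}[T]$ over decompositions of $I$. The exponential species $\mathsf{E}$, $\mathsf{E}[I]=\Bbbk e_I$, is a coalgebra with coproduct $e_I\mapsto e_S\otimes e_T$. An $\mathsf{E}$-bicomodule has compatible coactions $\lambda:\mathsf{X}\to\mathsf{E}\cdot\mathsf{X}$, $\rho:\mathsf{X}\to\mathsf{X}\cdot\mathsf{E}$, written $\lambda(z)=\sum e_S\otimes z/\!/T$, $\rho(z)=\sum z\backslash\!\backslash S\otimes e_T$. "Linearized" means that $\mathsf{X}[I]$ is free on $\mathsf{X}_0[I]$ for a set-valued species $\mathsf{X}_0$ and the restriction maps $z\mapsto z/\!/T$, $z\mapsto z\backslash\!\backslash S$ come from maps of sets; $\Delta$ is given by the displayed formula on $z\in\mathsf{X}_0[I]$ and extended linearly; correspondingly the right hand side of the formula for $(f\smile g)(z)$ is understood for $z\in\mathsf{X}_0[p+q]$ and extended linearly. $\mathsf{E}^!$ is the Koszul dual algebra of $\mathsf{E}$: $\mathsf{E}^![I]$ is the quotient of the free $\Bbbk$-module on linear orders of $I$ by the relations $\ell+\ell'=0$ whenever $\ell'$ is obtained from $\ell$ by swapping two adjacent elements, with product $\mu$ induced by concatenation.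 $K^p(\mathsf{X})$ is the module of morphisms of species $\mathsf{X}\to\mathsf{E}^!$ vanishing on sets of cardinality $\ne p$, identified with $\operatorname{Hom}_{S_p}(\mathsf{X}[p],\operatorname{sgn}_p)$ by letting $f$ correspond to $\varphi$ with $\varphi(z)=(-1)^pf(z)\epsilon_p$ for $z\in\mathsf X[p]$, $\epsilon_p$ being the class of $1<\cdots<p$ (the factor $(-1)^p$ is multiplicative and does not affect the formula). The cup product on $C^*(\mathsf{X})=\operatorname{Hom}(\mathsf{X},\mathsf{E}^{\cdot *})$ is $(\alpha\smile\beta)(F_1,\ldots,F_{p+q})(z)=\alpha(F_1,\ldots,F_p)(z\backslash\!\backslash(F_1\cup\cdots\cup F_p))\cdot\beta(F_{p+1},\ldots,F_{p+q})(z/\!/(F_{p+1}\cup\cdots\cup F_{p+q}))$ on $z\in\mathsf{X}_0[I]$; the induced cup product on the Koszul complex is $\varphi\smile\psi=\mu\circ(\varphi\otimes\psi)\circ\Delta$. $\lambda_S:S\to[\#S]$ is the order-preserving bijection, acting on $\mathsf{X}$ by functoriality, and $\operatorname{sch}(S,T)$ is the number of pairs $(s,t)\in S\times T$ with $s>t$. *)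

theory Defs
  imports "HOL-Combinatorics.Permutations" "HOL-Combinatorics.Multiset_Permutations"
    "HOL-Algebra.QuotRing" "HOL-Algebra.Module"
begin

section \<open>Modules: linear maps, free modules, quotients, tensor products\<close>

definition lin_maps ::
    "('r, 'm) ring_scheme \<Rightarrow> ('r, 'x) module \<Rightarrow> ('r, 'y) module \<Rightarrow> ('x \<Rightarrow> 'y) set" where
  "lin_maps R M N = {h \<in> carrier M \<rightarrow> carrier N.
     (\<forall>x\<in>carrier M. \<forall>y\<in>carrier M. h (x \<oplus>\<^bsub>M\<^esub> y) = h x \<oplus>\<^bsub>N\<^esub> h y) \<and>
     (\<forall>r\<in>carrier R. \<forall>x\<in>carrier M. h (r \<odot>\<^bsub>M\<^esub> x) = r \<odot>\<^bsub>N\<^esub> h x)}"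

definition self_module :: "('r, 'm) ring_scheme \<Rightarrow> ('r, 'r) module" where
  "self_module R = \<lparr>carrier = carrier R, mult = (\<otimes>\<^bsub>R\<^esub>), one = \<one>\<^bsub>R\<^esub>,
     zero = \<zero>\<^bsub>R\<^esub>, add = (\<oplus>\<^bsub>R\<^esub>), smult = (\<otimes>\<^bsub>R\<^esub>)\<rparr>"

text \<open>The locale \<^locale>\<open>module\<close> does not constrain the fields for multiplication and unit of
  a module record; they are left undefined below.\<close>

definition span_of :: "('r, 'm) ring_scheme \<Rightarrow> ('r, 'x) module \<Rightarrow> 'x set \<Rightarrow> 'x set" where
  "span_of R M A = \<Inter>{H. submodule H R M \<and> A \<subseteq> H}"

definition free_module :: "('r, 'm) ring_scheme \<Rightarrow> 'a set \<Rightarrow> ('r, 'a \<Rightarrow> 'r) module" where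
  "free_module R A =
     \<lparr>carrier = {x. range x \<subseteq> carrier R \<and> finite {a. x a \<noteq> \<zero>\<^bsub>R\<^esub>} \<and> {a. x a \<noteq> \<zero>\<^bsub>R\<^esub>} \<subseteq> A},
      mult = undefined, one = undefined,
      zero = (\<lambda>a. \<zero>\<^bsub>R\<^esub>), add = (\<lambda>x y a. x a \<oplus>\<^bsub>R\<^esub> y a), smult = (\<lambda>r x a. r \<otimes>\<^bsub>R\<^esub> x a)\<rparr>"

definition gen :: "('r, 'm) ring_scheme \<Rightarrow> 'a \<Rightarrow> 'a \<Rightarrow> 'r" where
  "gen R a = (\<lambda>b. if b = a then \<one>\<^bsub>R\<^esub> else \<zero>\<^bsub>R\<^esub>)"

definition lin_ext ::
    "('r, 'm) ring_scheme \<Rightarrow> ('r, 'y) module \<Rightarrow> ('a \<Rightarrow> 'y) \<Rightarrow> ('a \<Rightarrow> 'r) \<Rightarrow> 'y" where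
  "lin_ext R N b x = (\<Oplus>\<^bsub>N\<^esub>a\<in>{a. x a \<noteq> \<zero>\<^bsub>R\<^esub>}. x a \<odot>\<^bsub>N\<^esub> b a)"

definition quot_module :: "('r, 'x) module \<Rightarrow> 'x set \<Rightarrow> ('r, 'x set) module" where
  "quot_module M H =
     \<lparr>carrier = a_rcosets\<^bsub>M\<^esub> H, mult = undefined, one = undefined,
      zero = H, add = set_add M, smult = (\<lambda>r C. \<Union>x\<in>C. H +>\<^bsub>M\<^esub> (r \<odot>\<^bsub>M\<^esub> x))\<rparr>"

text \<open>The module generated by \<open>A\<close> subject to the relations \<open>Q = 0\<close>, where \<open>Q\<close> is a subset of
  the free module on \<open>A\<close>; \<open>pres_gen\<close> is the class of a generator, and \<open>pres_lift\<close> the linear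
  map out of it that extends \<open>b\<close>, for \<open>b\<close> compatible with the relations (the linear extension
  of \<open>b\<close> is then constant on cosets).\<close>

definition pres_module ::
    "('r, 'm) ring_scheme \<Rightarrow> 'a set \<Rightarrow> ('a \<Rightarrow> 'r) set \<Rightarrow> ('r, ('a \<Rightarrow> 'r) set) module" where
  "pres_module R A Q = quot_module (free_module R A) (span_of R (free_module R A) Q)"

definition pres_gen ::
    "('r, 'm) ring_scheme \<Rightarrow> 'a set \<Rightarrow> ('a \<Rightarrow> 'r) set \<Rightarrow> 'a \<Rightarrow> ('a \<Rightarrow> 'r) set" where
  "pres_gen R A Q a = span_of R (free_module R A) Q +>\<^bsub>free_module R A\<^esub> gen R a"

definition pres_lift ::
    "('r, 'm) ring_scheme \<Rightarrow> ('r, 'y) module \<Rightarrow> ('a \<Rightarrow> 'y) \<Rightarrow> ('a \<Rightarrow> 'r) set \<Rightarrow> 'y" where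
  "pres_lift R N b C = the_elem (lin_ext R N b ` C)"

definition tensor_rels ::
    "('r, 'm) ring_scheme \<Rightarrow> ('r, 'x) module \<Rightarrow> ('r, 'y) module \<Rightarrow> (('x \<times> 'y) \<Rightarrow> 'r) set" where
  "tensor_rels R M N = (let F = free_module R (carrier M \<times> carrier N) in
     {gen R (x \<oplus>\<^bsub>M\<^esub> x', y) \<ominus>\<^bsub>F\<^esub> (gen R (x, y) \<oplus>\<^bsub>F\<^esub> gen R (x', y)) | x x' y.
        x \<in> carrier M \<and> x' \<in> carrier M \<and> y \<in> carrier N} \<union>
     {gen R (x, y \<oplus>\<^bsub>N\<^esub> y') \<ominus>\<^bsub>F\<^esub> (gen R (x, y) \<oplus>\<^bsub>F\<^esub> gen R (x, y')) | x y y'.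
        x \<in> carrier M \<and> y \<in> carrier N \<and> y' \<in> carrier N} \<union>
     {gen R (r \<odot>\<^bsub>M\<^esub> x, y) \<ominus>\<^bsub>F\<^esub> r \<odot>\<^bsub>F\<^esub> gen R (x, y) | r x y.
        r \<in> carrier R \<and> x \<in> carrier M \<and> y \<in> carrier N} \<union>
     {gen R (x, r \<odot>\<^bsub>N\<^esub> y) \<ominus>\<^bsub>F\<^esub> r \<odot>\<^bsub>F\<^esub> gen R (x, y) | r x y.
        r \<in> carrier R \<and> x \<in> carrier M \<and> y \<in> carrier N})"

definition tensor ::
    "('r, 'm) ring_scheme \<Rightarrow> ('r, 'x) module \<Rightarrow> ('r, 'y) module
      \<Rightarrow> ('r, (('x \<times> 'y) \<Rightarrow> 'r) set) module" where
  "tensor R M N = pres_module R (carrier M \<times> carrier N) (tensor_rels R M N)"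

definition pure_tensor ::
    "('r, 'm) ring_scheme \<Rightarrow> ('r, 'x) module \<Rightarrow> ('r, 'y) module
      \<Rightarrow> 'x \<Rightarrow> 'y \<Rightarrow> (('x \<times> 'y) \<Rightarrow> 'r) set" where
  "pure_tensor R M N x y = pres_gen R (carrier M \<times> carrier N) (tensor_rels R M N) (x, y)"

definition tensor_lift ::
    "('r, 'm) ring_scheme \<Rightarrow> ('r, 'z) module \<Rightarrow> ('x \<Rightarrow> 'y \<Rightarrow> 'z)
      \<Rightarrow> (('x \<times> 'y) \<Rightarrow> 'r) set \<Rightarrow> 'z" where
  "tensor_lift R N b = pres_lift R N (case_prod b)"

text \<open>\<open>h \<otimes> k\<close> for linear maps with targets \<open>M\<close> and \<open>N\<close>.\<close>

definition tensor_map ::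
    "('r, 'm) ring_scheme \<Rightarrow> ('r, 'x) module \<Rightarrow> ('r, 'y) module \<Rightarrow> ('u \<Rightarrow> 'x) \<Rightarrow> ('v \<Rightarrow> 'y)
      \<Rightarrow> (('u \<times> 'v) \<Rightarrow> 'r) set \<Rightarrow> (('x \<times> 'y) \<Rightarrow> 'r) set" where
  "tensor_map R M N h k = tensor_lift R (tensor R M N) (\<lambda>u v. pure_tensor R M N (h u) (k v))"

text \<open>The associativity isomorphism \<open>(L \<otimes> M) \<otimes> N \<rightarrow> L \<otimes> (M \<otimes> N)\<close>.\<close>

definition tensor_assoc ::
    "('r, 'm) ring_scheme \<Rightarrow> ('r, 'x) module \<Rightarrow> ('r, 'y) module \<Rightarrow> ('r, 'z) module
      \<Rightarrow> (((('x \<times> 'y) \<Rightarrow> 'r) set \<times> 'z) \<Rightarrow> 'r) set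
      \<Rightarrow> (('x \<times> (('y \<times> 'z) \<Rightarrow> 'r) set) \<Rightarrow> 'r) set" where
  "tensor_assoc R L M N =
     tensor_lift R (tensor R L (tensor R M N))
       (\<lambda>t z. tensor_lift R (tensor R L (tensor R M N))
          (\<lambda>x y. pure_tensor R L (tensor R M N) x (pure_tensor R M N y z)) t)"

text \<open>Direct sum of a family of modules over a finite index set.\<close>

definition direct_sum :: "'i set \<Rightarrow> ('i \<Rightarrow> ('r, 'x) module) \<Rightarrow> ('r, 'i \<Rightarrow> 'x) module" where
  "direct_sum A M =
     \<lparr>carrier = (\<Pi>\<^sub>E i\<in>A. carrier (M i)), mult = undefined, one = undefined,
      zero = (\<lambda>i\<in>A. \<zero>\<^bsub>M i\<^esub>), add = (\<lambda>x y. \<lambda>i\<in>A. x i \<oplus>\<^bsub>M i\<^esub> y i),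
      smult = (\<lambda>r x. \<lambda>i\<in>A. r \<odot>\<^bsub>M i\<^esub> x i)\<rparr>"

section \<open>Species\<close>

text \<open>Finite sets are taken to be finite sets of natural numbers; these form a full subcategory
  equivalent to the category of all finite sets. A bijection \<open>I \<rightarrow> J\<close> is given by a function
  \<open>\<sigma>\<close> that is injective on \<open>I\<close>, with \<open>J = \<sigma> ` I\<close>; the value of a functor on it may only
  depend on the restriction of \<open>\<sigma>\<close> to \<open>I\<close>.\<close>

record 'a set_species =
  elts :: "nat set \<Rightarrow> 'a set"
  relabel :: "nat set \<Rightarrow> (nat \<Rightarrow> nat) \<Rightarrow> 'a \<Rightarrow> 'a"

record ('r, 'x) species =
  obj :: "nat set \<Rightarrow> ('r, 'x) module"
  act :: "nat set \<Rightarrow> (nat \<Rightarrow> nat) \<Rightarrow> 'x \<Rightarrow> 'x"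

definition is_set_species :: "'a set_species \<Rightarrow> bool" where
  "is_set_species P \<longleftrightarrow>
     (\<forall>I \<sigma>. finite I \<and> inj_on \<sigma> I \<longrightarrow> relabel P I \<sigma> \<in> elts P I \<rightarrow> elts P (\<sigma> ` I)) \<and>
     (\<forall>I x. finite I \<and> x \<in> elts P I \<longrightarrow> relabel P I id x = x) \<and>
     (\<forall>I \<sigma> \<tau> x. finite I \<and> inj_on \<sigma> I \<and> inj_on \<tau> (\<sigma> ` I) \<and> x \<in> elts P I \<longrightarrow>
        relabel P I (\<tau> \<circ> \<sigma>) x = relabel P (\<sigma> ` I) \<tau> (relabel P I \<sigma> x)) \<and>
     (\<forall>I \<sigma> \<tau> x. finite I \<and> inj_on \<sigma> I \<and> (\<forall>i\<in>I. \<sigma> i = \<tau> i) \<and> x \<in> elts P I \<longrightarrow>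
        relabel P I \<sigma> x = relabel P I \<tau> x)"

definition is_species :: "('r, 'm) ring_scheme \<Rightarrow> ('r, 'x) species \<Rightarrow> bool" where
  "is_species R X \<longleftrightarrow>
     (\<forall>I. finite I \<longrightarrow> module R (obj X I)) \<and>
     (\<forall>I \<sigma>. finite I \<and> inj_on \<sigma> I \<longrightarrow> act X I \<sigma> \<in> lin_maps R (obj X I) (obj X (\<sigma> ` I))) \<and>
     (\<forall>I x. finite I \<and> x \<in> carrier (obj X I) \<longrightarrow> act X I id x = x) \<and>
     (\<forall>I \<sigma> \<tau> x. finite I \<and> inj_on \<sigma> I \<and> inj_on \<tau> (\<sigma> ` I) \<and> x \<in> carrier (obj X I) \<longrightarrow>
        act X I (\<tau> \<circ> \<sigma>) x = act X (\<sigma> ` I) \<tau> (act X I \<sigma> x)) \<and>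
     (\<forall>I \<sigma> \<tau> x. finite I \<and> inj_on \<sigma> I \<and> (\<forall>i\<in>I. \<sigma> i = \<tau> i) \<and> x \<in> carrier (obj X I) \<longrightarrow>
        act X I \<sigma> x = act X I \<tau> x)"

definition is_species_morphism ::
    "('r, 'm) ring_scheme \<Rightarrow> ('r, 'x) species \<Rightarrow> ('r, 'y) species
      \<Rightarrow> (nat set \<Rightarrow> 'x \<Rightarrow> 'y) \<Rightarrow> bool" where
  "is_species_morphism R X Y \<phi> \<longleftrightarrow>
     (\<forall>I. finite I \<longrightarrow> \<phi> I \<in> lin_maps R (obj X I) (obj Y I)) \<and>
     (\<forall>I \<sigma> x. finite I \<and> inj_on \<sigma> I \<and> x \<in> carrier (obj X I) \<longrightarrow>
        \<phi> (\<sigma> ` I) (act X I \<sigma> x) = act Y I \<sigma> (\<phi> I x))"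

definition lin_species ::
    "('r, 'm) ring_scheme \<Rightarrow> 'a set_species \<Rightarrow> ('r, 'a \<Rightarrow> 'r) species" where
  "lin_species R P =
     \<lparr>obj = (\<lambda>I. free_module R (elts P I)),
      act = (\<lambda>I \<sigma>. lin_ext R (free_module R (elts P (\<sigma> ` I))) (\<lambda>x. gen R (relabel P I \<sigma> x)))\<rparr>"

definition decomps :: "nat set \<Rightarrow> (nat set \<times> nat set) set" where
  "decomps I = {(S, T). S \<inter> T = {} \<and> S \<union> T = I}"

definition cauchy ::
    "('r, 'm) ring_scheme \<Rightarrow> ('r, 'x) species \<Rightarrow> ('r, 'y) species
      \<Rightarrow> ('r, (nat set \<times> nat set) \<Rightarrow> (('x \<times> 'y) \<Rightarrow> 'r) set) species" where
  "cauchy R X Y =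
     \<lparr>obj = (\<lambda>I. direct_sum (decomps I) (\<lambda>(S, T). tensor R (obj X S) (obj Y T))),
      act = (\<lambda>I \<sigma> c. \<lambda>(S', T')\<in>decomps (\<sigma> ` I).
        (let S = {i\<in>I. \<sigma> i \<in> S'}; T = {i\<in>I. \<sigma> i \<in> T'}
         in tensor_map R (obj X S') (obj Y T') (act X S \<sigma>) (act Y T \<sigma>) (c (S, T))))\<rparr>"

text \<open>\<open>\<phi> \<otimes> \<psi>\<close> on Cauchy products, for morphisms with targets \<open>X\<close> and \<open>Y\<close>.\<close>

definition cauchy_map ::
    "('r, 'm) ring_scheme \<Rightarrow> ('r, 'x) species \<Rightarrow> ('r, 'y) species
      \<Rightarrow> (nat set \<Rightarrow> 'u \<Rightarrow> 'x) \<Rightarrow> (nat set \<Rightarrow> 'v \<Rightarrow> 'y) \<Rightarrow> nat set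
      \<Rightarrow> ((nat set \<times> nat set) \<Rightarrow> (('u \<times> 'v) \<Rightarrow> 'r) set)
      \<Rightarrow> (nat set \<times> nat set) \<Rightarrow> (('x \<times> 'y) \<Rightarrow> 'r) set" where
  "cauchy_map R X Y \<phi> \<psi> I c =
     (\<lambda>(S, T)\<in>decomps I. tensor_map R (obj X S) (obj Y T) (\<phi> S) (\<psi> T) (c (S, T)))"

section \<open>The exponential species and its bicomodules\<close>

text \<open>The basis element \<open>e\<^sub>I\<close> is \<open>gen R I\<close>.\<close>

definition exp_set_species :: "nat set set_species" where
  "exp_set_species = \<lparr>elts = (\<lambda>I. {I}), relabel = (\<lambda>I \<sigma> x. \<sigma> ` x)\<rparr>"

definition exp_species :: "('r, 'm) ring_scheme \<Rightarrow> ('r, nat set \<Rightarrow> 'r) species" where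
  "exp_species R = lin_species R exp_set_species"

definition exp_coprod ::
    "('r, 'm) ring_scheme \<Rightarrow> nat set \<Rightarrow> nat set \<Rightarrow> (nat set \<Rightarrow> 'r)
      \<Rightarrow> (((nat set \<Rightarrow> 'r) \<times> (nat set \<Rightarrow> 'r)) \<Rightarrow> 'r) set" where
  "exp_coprod R S T =
     lin_ext R (tensor R (obj (exp_species R) S) (obj (exp_species R) T))
       (\<lambda>_. pure_tensor R (obj (exp_species R) S) (obj (exp_species R) T) (gen R S) (gen R T))"

text \<open>A coaction is a morphism \<open>lam : X \<rightarrow> E \<cdot> X\<close>, respectively \<open>rho : X \<rightarrow> X \<cdot> E\<close>. The
  coassociativity and compatibility axioms are equations between maps into threefold Cauchy
  products; they are stated on the component of each decomposition \<open>(S, T, U)\<close>. The counit of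
  \<open>E\<close> is the coefficient of \<open>e\<^sub>I\<close> for \<open>I = {}\<close>.\<close>

locale exp_bicomodule = cring R
  for R (structure) +
  fixes X :: "('r, 'x) species"
    and lam :: "nat set \<Rightarrow> 'x \<Rightarrow> (nat set \<times> nat set) \<Rightarrow> (((nat set \<Rightarrow> 'r) \<times> 'x) \<Rightarrow> 'r) set"
    and rho :: "nat set \<Rightarrow> 'x \<Rightarrow> (nat set \<times> nat set) \<Rightarrow> (('x \<times> (nat set \<Rightarrow> 'r)) \<Rightarrow> 'r) set"
  assumes species: "is_species R X"
    and lam_morphism: "is_species_morphism R X (cauchy R (exp_species R) X) lam"
    and rho_morphism: "is_species_morphism R X (cauchy R X (exp_species R)) rho"
    and lam_coassoc:
      "\<lbrakk>finite S; finite T; finite U; S \<inter> T = {}; S \<inter> U = {}; T \<inter> U = {};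
        z \<in> carrier (obj X (S \<union> T \<union> U))\<rbrakk> \<Longrightarrow>
       tensor_assoc R (obj (exp_species R) S) (obj (exp_species R) T) (obj X U)
         (tensor_map R (tensor R (obj (exp_species R) S) (obj (exp_species R) T)) (obj X U)
            (exp_coprod R S T) id (lam (S \<union> T \<union> U) z (S \<union> T, U)))
       = tensor_map R (obj (exp_species R) S) (tensor R (obj (exp_species R) T) (obj X U))
           id (\<lambda>x. lam (T \<union> U) x (T, U)) (lam (S \<union> T \<union> U) z (S, T \<union> U))"
    and rho_coassoc:
      "\<lbrakk>finite S; finite T; finite U; S \<inter> T = {}; S \<inter> U = {}; T \<inter> U = {};
        z \<in> carrier (obj X (S \<union> T \<union> U))\<rbrakk> \<Longrightarrow>
       tensor_assoc R (obj X S) (obj (exp_species R) T) (obj (exp_species R) U)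
         (tensor_map R (tensor R (obj X S) (obj (exp_species R) T)) (obj (exp_species R) U)
            (\<lambda>x. rho (S \<union> T) x (S, T)) id (rho (S \<union> T \<union> U) z (S \<union> T, U)))
       = tensor_map R (obj X S) (tensor R (obj (exp_species R) T) (obj (exp_species R) U))
           id (exp_coprod R T U) (rho (S \<union> T \<union> U) z (S, T \<union> U))"
    and compat:
      "\<lbrakk>finite S; finite T; finite U; S \<inter> T = {}; S \<inter> U = {}; T \<inter> U = {};
        z \<in> carrier (obj X (S \<union> T \<union> U))\<rbrakk> \<Longrightarrow>
       tensor_assoc R (obj (exp_species R) S) (obj X T) (obj (exp_species R) U)
         (tensor_map R (tensor R (obj (exp_species R) S) (obj X T)) (obj (exp_species R) U)
            (\<lambda>x. lam (S \<union> T) x (S, T)) id (rho (S \<union> T \<union> U) z (S \<union> T, U)))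
       = tensor_map R (obj (exp_species R) S) (tensor R (obj X T) (obj (exp_species R) U))
           id (\<lambda>x. rho (T \<union> U) x (T, U)) (lam (S \<union> T \<union> U) z (S, T \<union> U))"
    and lam_counit:
      "\<lbrakk>finite I; z \<in> carrier (obj X I)\<rbrakk> \<Longrightarrow>
       tensor_lift R (obj X I) (\<lambda>e x. e {} \<odot>\<^bsub>obj X I\<^esub> x) (lam I z ({}, I)) = z"
    and rho_counit:
      "\<lbrakk>finite I; z \<in> carrier (obj X I)\<rbrakk> \<Longrightarrow>
       tensor_lift R (obj X I) (\<lambda>x e. e {} \<odot>\<^bsub>obj X I\<^esub> x) (rho I z (I, {})) = z"

text \<open>For a structure \<open>z\<close> on \<open>I = S \<squnion> T\<close>, \<open>lres I T z\<close> is the restriction \<open>z//T\<close> coming from the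
  left coaction, and \<open>rres I S z\<close> the restriction to \<open>S\<close> coming from the right coaction.\<close>

locale linearized_exp_bicomodule =
  exp_bicomodule R "lin_species R P" lam rho
  for R :: "('r, 'm) ring_scheme" (structure)
    and P :: "'a set_species" and lam rho +
  fixes lres rres :: "nat set \<Rightarrow> nat set \<Rightarrow> 'a \<Rightarrow> 'a"
  assumes set_species: "is_set_species P"
    and lres_closed:
      "\<lbrakk>finite I; (S, T) \<in> decomps I; z \<in> elts P I\<rbrakk> \<Longrightarrow> lres I T z \<in> elts P T"
    and rres_closed:
      "\<lbrakk>finite I; (S, T) \<in> decomps I; z \<in> elts P I\<rbrakk> \<Longrightarrow> rres I S z \<in> elts P S"
    and lam_gen:
      "\<lbrakk>finite I; (S, T) \<in> decomps I; z \<in> elts P I\<rbrakk> \<Longrightarrow>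
       lam I (gen R z) (S, T) =
         pure_tensor R (obj (exp_species R) S) (obj (lin_species R P) T)
           (gen R S) (gen R (lres I T z))"
    and rho_gen:
      "\<lbrakk>finite I; (S, T) \<in> decomps I; z \<in> elts P I\<rbrakk> \<Longrightarrow>
       rho I (gen R z) (S, T) =
         pure_tensor R (obj (lin_species R P) S) (obj (exp_species R) T)
           (gen R (rres I S z)) (gen R T)"

definition diagonal ::
    "('r, 'm) ring_scheme \<Rightarrow> 'a set_species \<Rightarrow> (nat set \<Rightarrow> nat set \<Rightarrow> 'a \<Rightarrow> 'a)
      \<Rightarrow> (nat set \<Rightarrow> nat set \<Rightarrow> 'a \<Rightarrow> 'a) \<Rightarrow> nat set \<Rightarrow> ('a \<Rightarrow> 'r)
      \<Rightarrow> (nat set \<times> nat set) \<Rightarrow> ((('a \<Rightarrow> 'r) \<times> ('a \<Rightarrow> 'r)) \<Rightarrow> 'r) set" where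
  "diagonal R P lres rres I =
     lin_ext R (obj (cauchy R (lin_species R P) (lin_species R P)) I)
       (\<lambda>z. \<lambda>(S, T)\<in>decomps I.
          pure_tensor R (obj (lin_species R P) S) (obj (lin_species R P) T)
            (gen R (rres I S z)) (gen R (lres I T z)))"

section \<open>The Koszul dual algebra and the Koszul complex\<close>

text \<open>A linear order on a finite set is the list of its elements in increasing order.\<close>

definition swap_rels :: "('r, 'm) ring_scheme \<Rightarrow> nat set \<Rightarrow> (nat list \<Rightarrow> 'r) set" where
  "swap_rels R I =
     {gen R (us @ [a, b] @ vs) \<oplus>\<^bsub>free_module R (permutations_of_set I)\<^esub> gen R (us @ [b, a] @ vs)
       | us a b vs. us @ [a, b] @ vs \<in> permutations_of_set I}"

definition order_class ::
    "('r, 'm) ring_scheme \<Rightarrow> nat set \<Rightarrow> nat list \<Rightarrow> (nat list \<Rightarrow> 'r) set" where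
  "order_class R I = pres_gen R (permutations_of_set I) (swap_rels R I)"

definition koszul_dual :: "('r, 'm) ring_scheme \<Rightarrow> ('r, (nat list \<Rightarrow> 'r) set) species" where
  "koszul_dual R =
     \<lparr>obj = (\<lambda>I. pres_module R (permutations_of_set I) (swap_rels R I)),
      act = (\<lambda>I \<sigma>. pres_lift R
        (pres_module R (permutations_of_set (\<sigma> ` I)) (swap_rels R (\<sigma> ` I)))
        (\<lambda>l. order_class R (\<sigma> ` I) (map \<sigma> l)))\<rparr>"

definition koszul_concat ::
    "('r, 'm) ring_scheme \<Rightarrow> nat set \<Rightarrow> (nat list \<Rightarrow> 'r) set \<Rightarrow> (nat list \<Rightarrow> 'r) set
      \<Rightarrow> (nat list \<Rightarrow> 'r) set" where
  "koszul_concat R I x y =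
     pres_lift R (obj (koszul_dual R) I)
       (\<lambda>l. pres_lift R (obj (koszul_dual R) I) (\<lambda>l'. order_class R I (l @ l')) y) x"

definition koszul_mult ::
    "('r, 'm) ring_scheme \<Rightarrow> nat set
      \<Rightarrow> ((nat set \<times> nat set) \<Rightarrow> (((nat list \<Rightarrow> 'r) set \<times> (nat list \<Rightarrow> 'r) set) \<Rightarrow> 'r) set)
      \<Rightarrow> (nat list \<Rightarrow> 'r) set" where
  "koszul_mult R I c =
     (\<Oplus>\<^bsub>obj (koszul_dual R) I\<^esub>d\<in>decomps I.
        tensor_lift R (obj (koszul_dual R) I) (koszul_concat R I) (c d))"

text \<open>Cochains are made extensional, so that they are equal as soon as they agree on the
  modules \<open>X[I]\<close> for finite \<open>I\<close>.\<close>

definition koszul_cochains ::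
    "('r, 'm) ring_scheme \<Rightarrow> ('r, 'x) species \<Rightarrow> nat
      \<Rightarrow> ('r, nat set \<Rightarrow> 'x \<Rightarrow> (nat list \<Rightarrow> 'r) set) module" where
  "koszul_cochains R X p =
     \<lparr>carrier = {\<phi> \<in> (\<Pi>\<^sub>E I\<in>{I. finite I}. extensional (carrier (obj X I))).
        is_species_morphism R X (koszul_dual R) \<phi> \<and>
        (\<forall>I. finite I \<and> card I \<noteq> p \<longrightarrow>
           (\<forall>z\<in>carrier (obj X I). \<phi> I z = \<zero>\<^bsub>obj (koszul_dual R) I\<^esub>))},
      mult = undefined, one = undefined,
      zero = (\<lambda>I\<in>{I. finite I}. \<lambda>z\<in>carrier (obj X I). \<zero>\<^bsub>obj (koszul_dual R) I\<^esub>),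
      add = (\<lambda>\<phi> \<psi>. \<lambda>I\<in>{I. finite I}. \<lambda>z\<in>carrier (obj X I).
        \<phi> I z \<oplus>\<^bsub>obj (koszul_dual R) I\<^esub> \<psi> I z),
      smult = (\<lambda>r \<phi>. \<lambda>I\<in>{I. finite I}. \<lambda>z\<in>carrier (obj X I).
        r \<odot>\<^bsub>obj (koszul_dual R) I\<^esub> \<phi> I z)\<rparr>"

text \<open>\<open>\<phi> \<smile> \<psi> = \<mu> \<circ> (\<phi> \<otimes> \<psi>) \<circ> \<Delta>\<close>\<close>

definition koszul_cup ::
    "('r, 'm) ring_scheme \<Rightarrow> 'a set_species \<Rightarrow> (nat set \<Rightarrow> nat set \<Rightarrow> 'a \<Rightarrow> 'a)
      \<Rightarrow> (nat set \<Rightarrow> nat set \<Rightarrow> 'a \<Rightarrow> 'a)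
      \<Rightarrow> (nat set \<Rightarrow> ('a \<Rightarrow> 'r) \<Rightarrow> (nat list \<Rightarrow> 'r) set)
      \<Rightarrow> (nat set \<Rightarrow> ('a \<Rightarrow> 'r) \<Rightarrow> (nat list \<Rightarrow> 'r) set)
      \<Rightarrow> nat set \<Rightarrow> ('a \<Rightarrow> 'r) \<Rightarrow> (nat list \<Rightarrow> 'r) set" where
  "koszul_cup R P lres rres \<phi> \<psi> =
     (\<lambda>I\<in>{I. finite I}. \<lambda>z\<in>carrier (obj (lin_species R P) I).
        koszul_mult R I
          (cauchy_map R (koszul_dual R) (koszul_dual R) \<phi> \<psi> I (diagonal R P lres rres I z)))"

text \<open>\<open>Hom\<^bsub>S\<^sub>p\<^esub>(X[p], sgn\<^sub>p)\<close>\<close>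

definition sgn_homs ::
    "('r, 'm) ring_scheme \<Rightarrow> ('r, 'x) species \<Rightarrow> nat \<Rightarrow> ('x \<Rightarrow> 'r) set" where
  "sgn_homs R X p =
     {f \<in> extensional (carrier (obj X {1..p})).
        f \<in> lin_maps R (obj X {1..p}) (self_module R) \<and>
        (\<forall>\<sigma> z. \<sigma> permutes {1..p} \<and> z \<in> carrier (obj X {1..p}) \<longrightarrow>
           f (act X {1..p} \<sigma> z) = [sign \<sigma>] \<cdot>\<^bsub>R\<^esub> f z)}"

text \<open>The identification of \<open>Hom\<^bsub>S\<^sub>p\<^esub>(X[p], sgn\<^sub>p)\<close> with the Koszul cochains of degree \<open>p\<close>:
  \<open>f\<close> corresponds to the \<open>\<phi>\<close> with \<open>\<phi>(z) = (-1)\<^sup>p f(z) \<epsilon>\<^sub>p\<close> on \<open>X[p]\<close>.\<close>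

definition koszul_of_hom ::
    "('r, 'm) ring_scheme \<Rightarrow> ('r, 'x) species \<Rightarrow> nat \<Rightarrow> ('x \<Rightarrow> 'r)
      \<Rightarrow> nat set \<Rightarrow> 'x \<Rightarrow> (nat list \<Rightarrow> 'r) set" where
  "koszul_of_hom R X p f =
     (THE \<phi>. \<phi> \<in> carrier (koszul_cochains R X p) \<and>
        (\<forall>z\<in>carrier (obj X {1..p}).
           \<phi> {1..p} z = ((\<ominus>\<^bsub>R\<^esub> \<one>\<^bsub>R\<^esub>) [^]\<^bsub>R\<^esub> p \<otimes>\<^bsub>R\<^esub> f z)
             \<odot>\<^bsub>obj (koszul_dual R) {1..p}\<^esub> order_class R {1..p} [1..<Suc p]))"

text \<open>The cup product transported along this identification.\<close>

definition hom_cup ::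
    "('r, 'm) ring_scheme \<Rightarrow> 'a set_species \<Rightarrow> (nat set \<Rightarrow> nat set \<Rightarrow> 'a \<Rightarrow> 'a)
      \<Rightarrow> (nat set \<Rightarrow> nat set \<Rightarrow> 'a \<Rightarrow> 'a) \<Rightarrow> nat \<Rightarrow> nat
      \<Rightarrow> (('a \<Rightarrow> 'r) \<Rightarrow> 'r) \<Rightarrow> (('a \<Rightarrow> 'r) \<Rightarrow> 'r) \<Rightarrow> ('a \<Rightarrow> 'r) \<Rightarrow> 'r" where
  "hom_cup R P lres rres p q f g =
     inv_into (sgn_homs R (lin_species R P) (p + q))
       (koszul_of_hom R (lin_species R P) (p + q))
       (koszul_cup R P lres rres
          (koszul_of_hom R (lin_species R P) p f) (koszul_of_hom R (lin_species R P) q g))"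

section \<open>Standardization and Schubert statistic\<close>

definition std :: "nat set \<Rightarrow> nat \<Rightarrow> nat" where
  "std S = (THE h. h \<in> extensional S \<and> bij_betw h S {1..card S} \<and> strict_mono_on S h)"

definition sch :: "nat set \<Rightarrow> nat set \<Rightarrow> nat" where
  "sch S T = card {(s, t). s \<in> S \<and> t \<in> T \<and> s > t}"

end

theory Submission
  imports Defs
begin

text \<open>The relations of \<open>E!\<close> say that exchanging two neighbours in a linear order changes the sign of
  its class. Hence the class of any order on \<open>I\<close> is \<open>(-1)\<close> to the number of its inversions times
  the class of the increasing order, and since this sign is compatible with the relations, \<open>E![I]\<close>
  is free of rank one on the class of the increasing order, over every commutative ring
  (lemmas \<open>order_class_eq\<close>, \<open>koszul_coef_lift\<close>, \<open>Edual_rank_one\<close>). Everything is computed in this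
  coordinate \<open>koszul_coef\<close>.

  A relabelling \<open>\<sigma>\<close> of \<open>I\<close> multiplies the coordinate by the sign of the list of values of \<open>\<sigma>\<close> on
  the increasing list of \<open>I\<close> (\<open>koszul_coef_act\<close>); for a permutation of \<open>{1..p}\<close> this is the sign of
  the permutation (\<open>sign_eq_inversions\<close>), and for an order preserving map it is one. So a cochain of
  degree \<open>p\<close> is determined by its component at \<open>{1..p}\<close>, through standardization, and that
  component may be any map equivariant for the sign representation: this is the bijection
  \<open>koszul_of_hom_bij\<close>. The product of \<open>E!\<close> multiplies coordinates and inserts the sign of the
  concatenation of the increasing lists of \<open>S\<close> and \<open>T\<close>, whose inversions are exactly the pairs
  counted by \<open>sch S T\<close> (\<open>koszul_concat_eq\<close>).

  Unfolding \<open>\<mu> \<circ> (\<phi> \<otimes> \<psi>) \<circ> \<Delta>\<close> on a basis element therefore gives a sum over all decompositions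
  \<open>(S, T)\<close> of \<open>(-1)^sch S T\<close> times the product of the coordinates of \<open>\<phi>\<close> and \<open>\<psi>\<close> at the two
  restrictions (\<open>cup_map_expand\<close>). For cochains of degrees \<open>p\<close> and \<open>q\<close> only the decompositions with
  blocks of these sizes contribute, standardization turns the coordinates into values of \<open>f\<close> and
  \<open>g\<close>, and the normalizing signs \<open>(-1)^p\<close> and \<open>(-1)^q\<close> cancel against \<open>(-1)^(p + q)\<close>
  (\<open>hom_cup_formula\<close>).

  For this to define a product on the complex, the cup product of two cochains has to be natural.
  The restriction maps commute with relabelling because the coactions are morphisms of species
  (\<open>lres_natural\<close>, \<open>rres_natural\<close>), and the signs agree because a concatenation may be sorted
  before or after it is relabelled (\<open>sgn_pow_relabel_shuffle\<close>). The sum over decompositions is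
  visibly bilinear in the two cochains, so the product factors through the tensor product. The first
  part of the development provides the universal properties of free modules, of modules given by
  generators and relations, and of tensor products that make these computations on generators
  legitimate.\<close>

section \<open>Modules and linear maps\<close>

lemma lin_mapsI:
  assumes "\<And>x. x \<in> carrier M \<Longrightarrow> h x \<in> carrier N"
    and "\<And>x y. \<lbrakk>x \<in> carrier M; y \<in> carrier M\<rbrakk> \<Longrightarrow> h (x \<oplus>\<^bsub>M\<^esub> y) = h x \<oplus>\<^bsub>N\<^esub> h y"
    and "\<And>r x. \<lbrakk>r \<in> carrier R; x \<in> carrier M\<rbrakk> \<Longrightarrow> h (r \<odot>\<^bsub>M\<^esub> x) = r \<odot>\<^bsub>N\<^esub> h x"
  shows "h \<in> lin_maps R M N"
  using assms by (simp add: lin_maps_def)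

lemma lin_mapsD:
  assumes "h \<in> lin_maps R M N"
  shows lin_maps_closed: "x \<in> carrier M \<Longrightarrow> h x \<in> carrier N"
    and lin_maps_add: "\<lbrakk>x \<in> carrier M; y \<in> carrier M\<rbrakk> \<Longrightarrow> h (x \<oplus>\<^bsub>M\<^esub> y) = h x \<oplus>\<^bsub>N\<^esub> h y"
    and lin_maps_smult: "\<lbrakk>r \<in> carrier R; x \<in> carrier M\<rbrakk> \<Longrightarrow> h (r \<odot>\<^bsub>M\<^esub> x) = r \<odot>\<^bsub>N\<^esub> h x"
  using assms by (auto simp: lin_maps_def)

lemma lin_maps_comp:
  "\<lbrakk>h \<in> lin_maps R L M; k \<in> lin_maps R M N\<rbrakk> \<Longrightarrow> (\<lambda>x. k (h x)) \<in> lin_maps R L N"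
  by (auto simp: lin_maps_def Pi_def)

lemma lin_maps_id: "(\<lambda>x. x) \<in> lin_maps R M M"
  by (auto simp: lin_maps_def)

lemma lin_maps_cong:
  assumes "module R M" and "h \<in> lin_maps R M N" and "\<And>x. x \<in> carrier M \<Longrightarrow> k x = h x"
  shows "k \<in> lin_maps R M N"
proof -
  interpret M: module R M by fact
  show ?thesis using assms(2,3) by (auto simp: lin_maps_def Pi_def)
qed

lemma lin_maps_zero:
  assumes "module R M" "module R N" and h: "h \<in> lin_maps R M N"
  shows "h \<zero>\<^bsub>M\<^esub> = \<zero>\<^bsub>N\<^esub>"
proof -
  interpret M: module R M by fact
  interpret N: module R N by fact
  have "h \<zero>\<^bsub>M\<^esub> = h (\<zero>\<^bsub>R\<^esub> \<odot>\<^bsub>M\<^esub> \<zero>\<^bsub>M\<^esub>)" by simp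
  also have "\<dots> = \<zero>\<^bsub>N\<^esub>" using lin_mapsD[OF h] by (metis M.R.zero_closed M.zero_closed N.smult_l_null)
  finally show ?thesis .
qed

lemma lin_maps_finsum_pointwise:
  assumes "module R M" "module R N" and "finite A" and "\<And>a. a \<in> A \<Longrightarrow> h a \<in> lin_maps R M N"
  shows "(\<lambda>x. \<Oplus>\<^bsub>N\<^esub>a\<in>A. h a x) \<in> lin_maps R M N"
proof -
  interpret M: module R M by fact
  interpret N: module R N by fact
  have cl: "(\<lambda>a. h a x) \<in> A \<rightarrow> carrier N" if "x \<in> carrier M" for x
    using assms(4) that by (auto intro: lin_maps_closed)
  show ?thesis
  proof (rule lin_mapsI)
    show "(\<Oplus>\<^bsub>N\<^esub>a\<in>A. h a x) \<in> carrier N" if "x \<in> carrier M" for x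
      using cl[OF that] by (rule N.finsum_closed)
    fix x y assume xy: "x \<in> carrier M" "y \<in> carrier M"
    have "(\<Oplus>\<^bsub>N\<^esub>a\<in>A. h a (x \<oplus>\<^bsub>M\<^esub> y)) = (\<Oplus>\<^bsub>N\<^esub>a\<in>A. h a x \<oplus>\<^bsub>N\<^esub> h a y)"
      using xy assms(4) by (intro N.finsum_cong')
        (auto simp: lin_maps_add[where M = M and N = N and R = R] dest: lin_maps_closed)
    then show "(\<Oplus>\<^bsub>N\<^esub>a\<in>A. h a (x \<oplus>\<^bsub>M\<^esub> y)) = (\<Oplus>\<^bsub>N\<^esub>a\<in>A. h a x) \<oplus>\<^bsub>N\<^esub> (\<Oplus>\<^bsub>N\<^esub>a\<in>A. h a y)"
      using cl xy by (simp add: N.finsum_addf)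
  next
    fix r x assume rx: "r \<in> carrier R" "x \<in> carrier M"
    have "(\<Oplus>\<^bsub>N\<^esub>a\<in>A. h a (r \<odot>\<^bsub>M\<^esub> x)) = (\<Oplus>\<^bsub>N\<^esub>a\<in>A. r \<odot>\<^bsub>N\<^esub> h a x)"
      using rx assms(4) by (intro N.finsum_cong')
        (auto simp: lin_maps_smult[where M = M and N = N and R = R] dest: lin_maps_closed)
    then show "(\<Oplus>\<^bsub>N\<^esub>a\<in>A. h a (r \<odot>\<^bsub>M\<^esub> x)) = r \<odot>\<^bsub>N\<^esub> (\<Oplus>\<^bsub>N\<^esub>a\<in>A. h a x)"
      using cl rx assms(3) by (simp add: N.finsum_smult_ldistr)
  qed
qed

lemma lin_maps_kernel:
  assumes "module R M" "module R N" and h: "h \<in> lin_maps R M N"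
  shows "submodule {x \<in> carrier M. h x = \<zero>\<^bsub>N\<^esub>} R M"
proof -
  interpret M: module R M by fact
  interpret N: module R N by fact
  have neg: "\<ominus>\<^bsub>M\<^esub> x = (\<ominus>\<^bsub>R\<^esub> \<one>\<^bsub>R\<^esub>) \<odot>\<^bsub>M\<^esub> x" if "x \<in> carrier M" for x
    using that by (simp add: M.smult_l_minus)
  show ?thesis
    using lin_mapsD[OF h] lin_maps_zero[OF assms] by (intro M.submoduleI) (auto simp: neg)
qed

text \<open>The additive inverse in a module is forced by \<open>0 x = 0\<close> (as \<open>(-1) x\<close>), so that no inverse
  has to be exhibited when a module is constructed.\<close>

lemma module_of_smult_zero:
  fixes R (structure) and M (structure)
  assumes "cring R"
    and zero: "\<zero>\<^bsub>M\<^esub> \<in> carrier M"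
    and add: "\<And>x y. \<lbrakk>x \<in> carrier M; y \<in> carrier M\<rbrakk> \<Longrightarrow> x \<oplus>\<^bsub>M\<^esub> y \<in> carrier M"
    and smult: "\<And>r x. \<lbrakk>r \<in> carrier R; x \<in> carrier M\<rbrakk> \<Longrightarrow> r \<odot>\<^bsub>M\<^esub> x \<in> carrier M"
    and "\<And>x y z. \<lbrakk>x \<in> carrier M; y \<in> carrier M; z \<in> carrier M\<rbrakk> \<Longrightarrow>
      (x \<oplus>\<^bsub>M\<^esub> y) \<oplus>\<^bsub>M\<^esub> z = x \<oplus>\<^bsub>M\<^esub> (y \<oplus>\<^bsub>M\<^esub> z)"
    and comm: "\<And>x y. \<lbrakk>x \<in> carrier M; y \<in> carrier M\<rbrakk> \<Longrightarrow> x \<oplus>\<^bsub>M\<^esub> y = y \<oplus>\<^bsub>M\<^esub> x"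
    and "\<And>x. x \<in> carrier M \<Longrightarrow> \<zero>\<^bsub>M\<^esub> \<oplus>\<^bsub>M\<^esub> x = x"
    and l_distr: "\<And>r s x. \<lbrakk>r \<in> carrier R; s \<in> carrier R; x \<in> carrier M\<rbrakk> \<Longrightarrow>
      (r \<oplus> s) \<odot>\<^bsub>M\<^esub> x = r \<odot>\<^bsub>M\<^esub> x \<oplus>\<^bsub>M\<^esub> s \<odot>\<^bsub>M\<^esub> x"
    and "\<And>r x y. \<lbrakk>r \<in> carrier R; x \<in> carrier M; y \<in> carrier M\<rbrakk> \<Longrightarrow>
      r \<odot>\<^bsub>M\<^esub> (x \<oplus>\<^bsub>M\<^esub> y) = r \<odot>\<^bsub>M\<^esub> x \<oplus>\<^bsub>M\<^esub> r \<odot>\<^bsub>M\<^esub> y"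
    and "\<And>r s x. \<lbrakk>r \<in> carrier R; s \<in> carrier R; x \<in> carrier M\<rbrakk> \<Longrightarrow>
      (r \<otimes> s) \<odot>\<^bsub>M\<^esub> x = r \<odot>\<^bsub>M\<^esub> (s \<odot>\<^bsub>M\<^esub> x)"
    and one: "\<And>x. x \<in> carrier M \<Longrightarrow> \<one> \<odot>\<^bsub>M\<^esub> x = x"
    and null: "\<And>x. x \<in> carrier M \<Longrightarrow> \<zero> \<odot>\<^bsub>M\<^esub> x = \<zero>\<^bsub>M\<^esub>"
  shows "module R M"
proof -
  interpret R: cring R by fact
  have inv: "(\<ominus> \<one>) \<odot>\<^bsub>M\<^esub> x \<oplus>\<^bsub>M\<^esub> x = \<zero>\<^bsub>M\<^esub>" if "x \<in> carrier M" for x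
    using l_distr[of "\<ominus> \<one>" \<one> x] that by (simp add: one null R.l_neg)
  have "abelian_group M"
  proof (rule abelian_groupI)
    show "\<exists>y\<in>carrier M. y \<oplus>\<^bsub>M\<^esub> x = \<zero>\<^bsub>M\<^esub>" if "x \<in> carrier M" for x
      using inv[OF that] smult[OF _ that] by (intro bexI[of _ "(\<ominus> \<one>) \<odot>\<^bsub>M\<^esub> x"]) auto
  qed (use assms in auto)
  then show ?thesis using assms by (intro moduleI) auto
qed

text \<open>An image of a module under a map that respects the operations satisfies the module axioms.
  For quotients this replaces computations with cosets by computations with representatives.\<close>

lemma module_surjective_image:
  assumes "module R M" and surj: "\<pi> ` carrier M = carrier N"
    and add: "\<And>x y. \<lbrakk>x \<in> carrier M; y \<in> carrier M\<rbrakk> \<Longrightarrow> \<pi> x \<oplus>\<^bsub>N\<^esub> \<pi> y = \<pi> (x \<oplus>\<^bsub>M\<^esub> y)"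
    and smult: "\<And>r x. \<lbrakk>r \<in> carrier R; x \<in> carrier M\<rbrakk> \<Longrightarrow> r \<odot>\<^bsub>N\<^esub> \<pi> x = \<pi> (r \<odot>\<^bsub>M\<^esub> x)"
    and zero: "\<zero>\<^bsub>N\<^esub> = \<pi> \<zero>\<^bsub>M\<^esub>"
  shows "module R N"
proof -
  interpret M: module R M by fact
  note sim = add smult zero surj[symmetric]
  show ?thesis
    by (rule module_of_smult_zero)
      (auto simp: sim M.R.is_cring M.add.m_assoc M.smult_l_distr M.smult_r_distr M.smult_assoc1
        intro!: imageI arg_cong[of _ _ \<pi>] M.add.m_comm)
qed

lemma self_module_simps [simp]:
  "carrier (self_module R) = carrier R" "x \<oplus>\<^bsub>self_module R\<^esub> y = x \<oplus>\<^bsub>R\<^esub> y"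
  "\<zero>\<^bsub>self_module R\<^esub> = \<zero>\<^bsub>R\<^esub>" "r \<odot>\<^bsub>self_module R\<^esub> x = r \<otimes>\<^bsub>R\<^esub> x"
  by (simp_all add: self_module_def)

lemma (in cring) self_module: "module R (self_module R)"
  by (rule module_of_smult_zero)
    (auto simp: is_cring a_ac m_assoc l_distr r_distr)

section \<open>Free modules\<close>

lemma free_module_simps [simp]:
  "x \<in> carrier (free_module R A) \<longleftrightarrow>
     (\<forall>a. x a \<in> carrier R) \<and> finite {a. x a \<noteq> \<zero>\<^bsub>R\<^esub>} \<and> {a. x a \<noteq> \<zero>\<^bsub>R\<^esub>} \<subseteq> A"
  "\<zero>\<^bsub>free_module R A\<^esub> = (\<lambda>a. \<zero>\<^bsub>R\<^esub>)"
  "x \<oplus>\<^bsub>free_module R A\<^esub> y = (\<lambda>a. x a \<oplus>\<^bsub>R\<^esub> y a)"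
  "r \<odot>\<^bsub>free_module R A\<^esub> x = (\<lambda>a. r \<otimes>\<^bsub>R\<^esub> x a)"
  by (auto simp: free_module_def)

context cring
begin

lemma free_module: "module R (free_module R A)"
proof (rule module_of_smult_zero)
  fix x y assume "x \<in> carrier (free_module R A)" "y \<in> carrier (free_module R A)"
  then have "finite ({a. x a \<noteq> \<zero>} \<union> {a. y a \<noteq> \<zero>})" "{a. x a \<noteq> \<zero>} \<union> {a. y a \<noteq> \<zero>} \<subseteq> A"
    "\<forall>a. x a \<in> carrier R" "\<forall>a. y a \<in> carrier R" by auto
  moreover have "{a. x a \<oplus> y a \<noteq> \<zero>} \<subseteq> {a. x a \<noteq> \<zero>} \<union> {a. y a \<noteq> \<zero>}" by auto
  ultimately have "finite {a. x a \<oplus> y a \<noteq> \<zero>}" "{a. x a \<oplus> y a \<noteq> \<zero>} \<subseteq> A"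
    by (blast intro: finite_subset, blast)
  then show "x \<oplus>\<^bsub>free_module R A\<^esub> y \<in> carrier (free_module R A)"
    using \<open>\<forall>a. x a \<in> carrier R\<close> \<open>\<forall>a. y a \<in> carrier R\<close> by simp
next
  fix r x assume r: "r \<in> carrier R" and x: "x \<in> carrier (free_module R A)"
  have "{a. r \<otimes> x a \<noteq> \<zero>} \<subseteq> {a. x a \<noteq> \<zero>}" using r by auto
  with r x show "r \<odot>\<^bsub>free_module R A\<^esub> x \<in> carrier (free_module R A)"
    by (auto elim!: finite_subset[rotated])
qed (auto simp: is_cring a_ac m_assoc l_distr r_distr fun_eq_iff)

lemma gen_closed [simp]: "a \<in> A \<Longrightarrow> gen R a \<in> carrier (free_module R A)"
  by (auto simp: gen_def)

text \<open>Summing over any finite set that contains the support makes the linear extensions of two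
  elements comparable term by term.\<close>

lemma lin_ext_finite_superset:
  assumes "module R N" and "finite B" and "{a. x a \<noteq> \<zero>} \<subseteq> B" and "\<And>a. x a \<in> carrier R"
    and "\<And>a. a \<in> B \<Longrightarrow> b a \<in> carrier N"
  shows "lin_ext R N b x = (\<Oplus>\<^bsub>N\<^esub>a\<in>B. x a \<odot>\<^bsub>N\<^esub> b a)"
proof -
  interpret N: module R N by fact
  show ?thesis unfolding lin_ext_def
    by (rule N.add.finprod_mono_neutral_cong_left) (use assms in auto)
qed

lemma lin_ext_linear:
  assumes "module R N" and b: "\<And>a. a \<in> A \<Longrightarrow> b a \<in> carrier N"
  shows "lin_ext R N b \<in> lin_maps R (free_module R A) N"
proof -
  interpret N: module R N by fact
  note le = lin_ext_finite_superset[OF assms(1)]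
  show ?thesis
  proof (rule lin_mapsI)
    fix x assume x: "x \<in> carrier (free_module R A)"
    then show "lin_ext R N b x \<in> carrier N"
      unfolding lin_ext_def using b by (intro N.finsum_closed) auto
    fix r assume r: "r \<in> carrier R"
    let ?B = "{a. x a \<noteq> \<zero>}"
    have bB: "b a \<in> carrier N" if "a \<in> ?B" for a using b x that by auto
    have "lin_ext R N b (r \<odot>\<^bsub>free_module R A\<^esub> x) = (\<Oplus>\<^bsub>N\<^esub>a\<in>?B. (r \<otimes> x a) \<odot>\<^bsub>N\<^esub> b a)"
      using x r bB by (subst le[of ?B]) auto
    also have "\<dots> = (\<Oplus>\<^bsub>N\<^esub>a\<in>?B. r \<odot>\<^bsub>N\<^esub> (x a \<odot>\<^bsub>N\<^esub> b a))"
      using x r bB by (intro N.finsum_cong') (auto simp: N.smult_assoc1)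
    also have "\<dots> = r \<odot>\<^bsub>N\<^esub> lin_ext R N b x"
      using x r bB by (simp add: lin_ext_def N.finsum_smult_ldistr)
    finally show "lin_ext R N b (r \<odot>\<^bsub>free_module R A\<^esub> x) = r \<odot>\<^bsub>N\<^esub> lin_ext R N b x" .
  next
    fix x y assume xy: "x \<in> carrier (free_module R A)" "y \<in> carrier (free_module R A)"
    let ?B = "{a. x a \<noteq> \<zero>} \<union> {a. y a \<noteq> \<zero>}"
    have B: "finite ?B" "?B \<subseteq> A" using xy by auto
    then have bB: "b a \<in> carrier N" if "a \<in> ?B" for a using b that by auto
    have "lin_ext R N b (x \<oplus>\<^bsub>free_module R A\<^esub> y) = (\<Oplus>\<^bsub>N\<^esub>a\<in>?B. (x a \<oplus> y a) \<odot>\<^bsub>N\<^esub> b a)"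
      using xy B bB by (subst le[of ?B]) auto
    also have "\<dots> = (\<Oplus>\<^bsub>N\<^esub>a\<in>?B. x a \<odot>\<^bsub>N\<^esub> b a \<oplus>\<^bsub>N\<^esub> y a \<odot>\<^bsub>N\<^esub> b a)"
      using xy bB by (intro N.finsum_cong') (auto simp: N.smult_l_distr)
    also have "\<dots> = (\<Oplus>\<^bsub>N\<^esub>a\<in>?B. x a \<odot>\<^bsub>N\<^esub> b a) \<oplus>\<^bsub>N\<^esub> (\<Oplus>\<^bsub>N\<^esub>a\<in>?B. y a \<odot>\<^bsub>N\<^esub> b a)"
      using xy bB by (intro N.finsum_addf) auto
    also have "\<dots> = lin_ext R N b x \<oplus>\<^bsub>N\<^esub> lin_ext R N b y"
      using xy B bB by (subst (1 2) le[of ?B]) auto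
    finally show "lin_ext R N b (x \<oplus>\<^bsub>free_module R A\<^esub> y) = lin_ext R N b x \<oplus>\<^bsub>N\<^esub> lin_ext R N b y" .
  qed
qed

lemma lin_ext_gen:
  assumes "module R N" and "b a \<in> carrier N"
  shows "lin_ext R N b (gen R a) = b a"
proof -
  interpret N: module R N by fact
  have "lin_ext R N b (gen R a) = (\<Oplus>\<^bsub>N\<^esub>i\<in>{a}. gen R a i \<odot>\<^bsub>N\<^esub> b i)"
    using assms(2) by (intro lin_ext_finite_superset[OF assms(1)]) (auto simp: gen_def)
  then show ?thesis using assms(2) by (simp add: gen_def)
qed

text \<open>Clearing one coordinate after the other removes a multiple of a basis vector each time.\<close>

lemma free_module_induct [consumes 1, case_names zero step]:
  assumes "x \<in> carrier (free_module R A)"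
    and "P (\<lambda>a. \<zero>)"
    and "\<And>x r a. \<lbrakk>x \<in> carrier (free_module R A); r \<in> carrier R; a \<in> A; P x\<rbrakk> \<Longrightarrow>
      P (x \<oplus>\<^bsub>free_module R A\<^esub> r \<odot>\<^bsub>free_module R A\<^esub> gen R a)"
  shows "P x"
proof -
  have "finite {a. x a \<noteq> \<zero>}" using assms(1) by simp
  then show ?thesis using assms(1)
  proof (induction "{a. x a \<noteq> \<zero>}" arbitrary: x rule: finite_induct)
    case empty
    then have "x = (\<lambda>a. \<zero>)" by auto
    then show ?case using assms(2) by simp
  next
    case (insert a B)
    let ?y = "x(a := \<zero>)"
    have supp: "{i. ?y i \<noteq> \<zero>} = B" using insert.hyps(2,4) by auto
    have y: "?y \<in> carrier (free_module R A)"
      using insert by (simp add: supp del: fun_upd_apply) (auto simp: insert.hyps(4)[symmetric])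
    have a: "a \<in> A" "x a \<in> carrier R" using insert by auto
    have "x = ?y \<oplus>\<^bsub>free_module R A\<^esub> x a \<odot>\<^bsub>free_module R A\<^esub> gen R a"
      using insert.prems by (auto simp: gen_def fun_eq_iff)
    then show ?case using assms(3)[OF y a(2,1)] insert.hyps(3)[OF supp[symmetric] y] by simp
  qed
qed

lemma free_module_linear_eqI:
  assumes "module R N" and h: "h \<in> lin_maps R (free_module R A) N"
    and k: "k \<in> lin_maps R (free_module R A) N"
    and gens: "\<And>a. a \<in> A \<Longrightarrow> h (gen R a) = k (gen R a)" and "x \<in> carrier (free_module R A)"
  shows "h x = k x"
  using assms(5)
proof (induction rule: free_module_induct)
  case zero
  then show ?case
    using lin_maps_zero[OF free_module assms(1) h] lin_maps_zero[OF free_module assms(1) k] by simp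
next
  case (step x r a)
  interpret F: module R "free_module R A" by (rule free_module)
  have "h (x \<oplus>\<^bsub>free_module R A\<^esub> r \<odot>\<^bsub>free_module R A\<^esub> gen R a) = h x \<oplus>\<^bsub>N\<^esub> r \<odot>\<^bsub>N\<^esub> h (gen R a)"
    using step lin_mapsD[OF h] F.smult_closed gen_closed by metis
  moreover have "k (x \<oplus>\<^bsub>free_module R A\<^esub> r \<odot>\<^bsub>free_module R A\<^esub> gen R a) = k x \<oplus>\<^bsub>N\<^esub> r \<odot>\<^bsub>N\<^esub> k (gen R a)"
    using step lin_mapsD[OF k] F.smult_closed gen_closed by metis
  ultimately show ?case using step gens by simp
qed

lemma free_module_linear_eq_lin_ext:
  assumes "module R N" and h: "h \<in> lin_maps R (free_module R A) N"
    and "x \<in> carrier (free_module R A)" and b: "\<And>a. a \<in> A \<Longrightarrow> h (gen R a) = b a"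
  shows "h x = lin_ext R N b x"
proof (rule free_module_linear_eqI[OF assms(1) h])
  have bN: "b a \<in> carrier N" if "a \<in> A" for a
    using lin_maps_closed[OF h gen_closed[OF that]] b[OF that] by simp
  then show "lin_ext R N b \<in> lin_maps R (free_module R A) N" by (rule lin_ext_linear[OF assms(1)])
  show "h (gen R a) = lin_ext R N b (gen R a)" if "a \<in> A" for a
    using lin_ext_gen[where b = b, OF assms(1) bN[OF that]] b[OF that] by simp
qed fact

end

section \<open>Quotients and modules given by generators and relations\<close>

lemma span_of_submodule:
  assumes "module R M" and "A \<subseteq> carrier M"
  shows "submodule (span_of R M A) R M"
proof -
  interpret M: module R M by fact
  have carr: "carrier M \<in> {H. submodule H R M \<and> A \<subseteq> H}"
    using assms(2) M.carrier_is_submodule by auto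
  show ?thesis unfolding span_of_def
    using carr by (intro M.submoduleI)
      (auto intro: M.submoduleE(3-5) subgroup.one_closed[OF submodule.axioms(1), simplified])
qed

lemma span_of_superset: "A \<subseteq> span_of R M A"
  by (auto simp: span_of_def)

lemma span_of_least: "\<lbrakk>submodule H R M; A \<subseteq> H\<rbrakk> \<Longrightarrow> span_of R M A \<subseteq> H"
  by (auto simp: span_of_def)

text \<open>All representatives of a coset have multiples in the same coset, as the submodule is closed
  under scalars; so the union in the definition of the scalar action is a union of equal sets.\<close>

lemma quot_module_smult_coset:
  assumes "module R M" and sub: "submodule H R M" and "r \<in> carrier R" and "x \<in> carrier M"
  shows "r \<odot>\<^bsub>quot_module M H\<^esub> (H +>\<^bsub>M\<^esub> x) = H +>\<^bsub>M\<^esub> (r \<odot>\<^bsub>M\<^esub> x)"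
proof -
  interpret M: module R M by fact
  interpret H: abelian_subgroup H M
    using sub M.abelian_group_axioms
    by (intro abelian_subgroupI3) (auto simp: additive_subgroup_def submodule_def)
  have "H +>\<^bsub>M\<^esub> (r \<odot>\<^bsub>M\<^esub> y) = H +>\<^bsub>M\<^esub> (r \<odot>\<^bsub>M\<^esub> x)" if y: "y \<in> H +>\<^bsub>M\<^esub> x" for y
  proof -
    obtain h where h: "h \<in> H" "y = h \<oplus>\<^bsub>M\<^esub> x" using y by (auto simp: a_r_coset_def')
    have "r \<odot>\<^bsub>M\<^esub> y = (r \<odot>\<^bsub>M\<^esub> h) \<oplus>\<^bsub>M\<^esub> (r \<odot>\<^bsub>M\<^esub> x)" "r \<odot>\<^bsub>M\<^esub> h \<in> H"
      using h assms M.submoduleE[OF sub] by (auto simp: M.smult_r_distr)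
    then have "r \<odot>\<^bsub>M\<^esub> y \<in> H +>\<^bsub>M\<^esub> (r \<odot>\<^bsub>M\<^esub> x)" by (auto simp: a_r_coset_def')
    then show ?thesis
      using M.smult_closed[OF assms(3,4)] by (rule H.a_repr_independence'[symmetric])
  qed
  moreover have "x \<in> H +>\<^bsub>M\<^esub> x" using assms(4) by (rule H.a_rcos_self)
  ultimately have "(\<Union>y\<in>H +>\<^bsub>M\<^esub> x. H +>\<^bsub>M\<^esub> (r \<odot>\<^bsub>M\<^esub> y)) = H +>\<^bsub>M\<^esub> (r \<odot>\<^bsub>M\<^esub> x)"
    by blast
  then show ?thesis by (simp add: quot_module_def)
qed

lemma quot_module:
  assumes "module R M" and sub: "submodule H R M"
  shows "module R (quot_module M H)"
    and "(\<lambda>x. H +>\<^bsub>M\<^esub> x) \<in> lin_maps R M (quot_module M H)"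
    and "carrier (quot_module M H) = (\<lambda>x. H +>\<^bsub>M\<^esub> x) ` carrier M"
proof -
  interpret M: module R M by fact
  interpret H: abelian_subgroup H M
    using sub M.abelian_group_axioms
    by (intro abelian_subgroupI3) (auto simp: additive_subgroup_def submodule_def)
  show carr: "carrier (quot_module M H) = (\<lambda>x. H +>\<^bsub>M\<^esub> x) ` carrier M"
    by (auto simp: quot_module_def A_RCOSETS_def')
  have add: "(H +>\<^bsub>M\<^esub> x) \<oplus>\<^bsub>quot_module M H\<^esub> (H +>\<^bsub>M\<^esub> y) = H +>\<^bsub>M\<^esub> (x \<oplus>\<^bsub>M\<^esub> y)"
    if "x \<in> carrier M" "y \<in> carrier M" for x y
    using that by (simp add: quot_module_def H.a_rcos_sum)
  have zero: "\<zero>\<^bsub>quot_module M H\<^esub> = H +>\<^bsub>M\<^esub> \<zero>\<^bsub>M\<^esub>"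
    using H.a_rcos_const[of "\<zero>\<^bsub>M\<^esub>"] by (simp add: quot_module_def)
  note smult = quot_module_smult_coset[OF assms]
  show "module R (quot_module M H)"
    by (rule module_surjective_image[OF assms(1), where \<pi> = "\<lambda>x. H +>\<^bsub>M\<^esub> x"])
      (use carr add smult zero in auto)
  show "(\<lambda>x. H +>\<^bsub>M\<^esub> x) \<in> lin_maps R M (quot_module M H)"
    by (rule lin_mapsI) (use carr add smult in auto)
qed

context cring
begin

context
  fixes A :: "'i set" and Q :: "('i \<Rightarrow> 'a) set"
  assumes Q: "Q \<subseteq> carrier (free_module R A)"
begin

lemma pres_module: "module R (pres_module R A Q)"
  unfolding pres_module_def by (intro quot_module span_of_submodule free_module Q)

lemma pres_gen_closed: "a \<in> A \<Longrightarrow> pres_gen R A Q a \<in> carrier (pres_module R A Q)"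
  unfolding pres_module_def pres_gen_def
  by (simp only: quot_module(3)[OF free_module span_of_submodule[OF free_module Q]])
    (intro imageI gen_closed)

lemma pres_module_linear_eqI:
  assumes N: "module R N" and h: "h \<in> lin_maps R (pres_module R A Q) N"
    and k: "k \<in> lin_maps R (pres_module R A Q) N"
    and gens: "\<And>a. a \<in> A \<Longrightarrow> h (pres_gen R A Q a) = k (pres_gen R A Q a)"
    and C: "C \<in> carrier (pres_module R A Q)"
  shows "h C = k C"
proof -
  let ?F = "free_module R A"
  let ?\<pi> = "\<lambda>x. span_of R ?F Q +>\<^bsub>?F\<^esub> x"
  note q = quot_module[OF free_module span_of_submodule[OF free_module Q], folded pres_module_def]
  obtain x where x: "x \<in> carrier ?F" "C = ?\<pi> x" using C q(3) by auto
  have "h (?\<pi> x) = k (?\<pi> x)"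
    by (rule free_module_linear_eqI[OF N lin_maps_comp[OF q(2) h] lin_maps_comp[OF q(2) k] _ x(1)])
      (use gens in \<open>simp add: pres_gen_def\<close>)
  then show ?thesis using x by simp
qed

text \<open>The linear extension of a map on the generators that respects the relations is constant on
  cosets of the span of the relations, so the image of a coset is a singleton and the element
  picked by \<open>pres_lift\<close> is its value on any representative.\<close>

lemma pres_lift_linear:
  assumes N: "module R N" and b: "\<And>a. a \<in> A \<Longrightarrow> b a \<in> carrier N"
    and rel: "\<And>x. x \<in> Q \<Longrightarrow> lin_ext R N b x = \<zero>\<^bsub>N\<^esub>"
  shows "pres_lift R N b \<in> lin_maps R (pres_module R A Q) N"
    and "a \<in> A \<Longrightarrow> pres_lift R N b (pres_gen R A Q a) = b a"
proof -
  let ?F = "free_module R A"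
  let ?H = "span_of R ?F Q"
  let ?L = "lin_ext R N b"
  interpret F: module R ?F by (rule free_module)
  interpret N: module R N by fact
  note sub = span_of_submodule[OF free_module Q]
  note q = quot_module[OF free_module sub, folded pres_module_def]
  have L: "?L \<in> lin_maps R ?F N" using N b by (rule lin_ext_linear)
  have ker: "?L h = \<zero>\<^bsub>N\<^esub>" if "h \<in> ?H" for h
    using span_of_least[OF lin_maps_kernel[OF free_module N L], of Q] rel Q that by blast
  have HF: "?H \<subseteq> carrier ?F" using F.submoduleE(1)[OF sub] .
  have val: "pres_lift R N b (?H +>\<^bsub>?F\<^esub> x) = ?L x" if x: "x \<in> carrier ?F" for x
  proof -
    have "?L y = ?L x" if y: "y \<in> ?H +>\<^bsub>?F\<^esub> x" for y
    proof -
      obtain h where h: "h \<in> ?H" "y = h \<oplus>\<^bsub>?F\<^esub> x" using y by (auto simp: a_r_coset_def')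
      then have "?L y = ?L h \<oplus>\<^bsub>N\<^esub> ?L x" using lin_maps_add[OF L] HF x by blast
      then show ?thesis using ker[OF h(1)] lin_maps_closed[OF L x] by simp
    qed
    moreover have "x \<in> ?H +>\<^bsub>?F\<^esub> x"
      using x sub F.abelian_group_axioms
      by (intro abelian_subgroup.a_rcos_self abelian_subgroupI3)
        (auto simp: additive_subgroup_def submodule_def)
    ultimately have "?L ` (?H +>\<^bsub>?F\<^esub> x) = {?L x}" by blast
    then show ?thesis by (simp add: pres_lift_def)
  qed
  show "pres_lift R N b \<in> lin_maps R (pres_module R A Q) N"
  proof (rule lin_mapsI)
    fix C assume "C \<in> carrier (pres_module R A Q)"
    then show "pres_lift R N b C \<in> carrier N" using q(3) val lin_maps_closed[OF L] by auto
  next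
    fix C D assume "C \<in> carrier (pres_module R A Q)" "D \<in> carrier (pres_module R A Q)"
    then obtain x y where xy: "x \<in> carrier ?F" "C = ?H +>\<^bsub>?F\<^esub> x" "y \<in> carrier ?F" "D = ?H +>\<^bsub>?F\<^esub> y"
      using q(3) by auto
    have "C \<oplus>\<^bsub>pres_module R A Q\<^esub> D = ?H +>\<^bsub>?F\<^esub> (x \<oplus>\<^bsub>?F\<^esub> y)"
      using lin_maps_add[OF q(2)] xy by metis
    then show "pres_lift R N b (C \<oplus>\<^bsub>pres_module R A Q\<^esub> D) = pres_lift R N b C \<oplus>\<^bsub>N\<^esub> pres_lift R N b D"
      using val xy lin_maps_add[OF L] F.a_closed by metis
  next
    fix r C assume r: "r \<in> carrier R" and "C \<in> carrier (pres_module R A Q)"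
    then obtain x where x: "x \<in> carrier ?F" "C = ?H +>\<^bsub>?F\<^esub> x" using q(3) by auto
    have "r \<odot>\<^bsub>pres_module R A Q\<^esub> C = ?H +>\<^bsub>?F\<^esub> (r \<odot>\<^bsub>?F\<^esub> x)"
      using lin_maps_smult[OF q(2) r x(1)] x(2) by metis
    then show "pres_lift R N b (r \<odot>\<^bsub>pres_module R A Q\<^esub> C) = r \<odot>\<^bsub>N\<^esub> pres_lift R N b C"
      using val x r lin_maps_smult[OF L] F.smult_closed by metis
  qed
  show "pres_lift R N b (pres_gen R A Q a) = b a" if "a \<in> A"
    using val[OF gen_closed[OF that]] lin_ext_gen[where b = b, OF N b[OF that]]
    by (simp add: pres_gen_def)
qed

text \<open>The span contains the relations, so each of them lies in the zero coset.\<close>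

lemma pres_gen_relation:
  assumes "x \<in> Q"
  shows "lin_ext R (pres_module R A Q) (pres_gen R A Q) x = \<zero>\<^bsub>pres_module R A Q\<^esub>"
proof -
  let ?F = "free_module R A"
  note sub = span_of_submodule[OF free_module Q]
  note q = quot_module[OF free_module sub, folded pres_module_def]
  have x: "x \<in> carrier ?F" using assms Q by blast
  interpret H: abelian_subgroup "span_of R ?F Q" ?F
    using sub module.axioms(2)[OF free_module]
    by (intro abelian_subgroupI3) (auto simp: additive_subgroup_def submodule_def)
  have "span_of R ?F Q +>\<^bsub>?F\<^esub> x = span_of R ?F Q"
    using subsetD[OF span_of_superset assms] by (rule H.a_rcos_const)
  moreover have "span_of R ?F Q +>\<^bsub>?F\<^esub> x = lin_ext R (pres_module R A Q) (pres_gen R A Q) x"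
    by (rule free_module_linear_eq_lin_ext[OF pres_module q(2) x]) (simp add: pres_gen_def)
  ultimately show ?thesis by (simp add: pres_module_def quot_module_def)
qed

end

end

section \<open>Tensor products and direct sums\<close>

definition bilin_maps ::
    "('r, 'm) ring_scheme \<Rightarrow> ('r, 'x) module \<Rightarrow> ('r, 'y) module \<Rightarrow> ('r, 'z) module
      \<Rightarrow> ('x \<Rightarrow> 'y \<Rightarrow> 'z) set" where
  "bilin_maps R M N L = {b. (\<forall>x\<in>carrier M. b x \<in> lin_maps R N L) \<and>
     (\<forall>y\<in>carrier N. (\<lambda>x. b x y) \<in> lin_maps R M L)}"

lemma bilin_mapsI:
  assumes "\<And>x y. \<lbrakk>x \<in> carrier M; y \<in> carrier N\<rbrakk> \<Longrightarrow> b x y \<in> carrier L"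
    and "\<And>x x' y. \<lbrakk>x \<in> carrier M; x' \<in> carrier M; y \<in> carrier N\<rbrakk> \<Longrightarrow>
      b (x \<oplus>\<^bsub>M\<^esub> x') y = b x y \<oplus>\<^bsub>L\<^esub> b x' y"
    and "\<And>x y y'. \<lbrakk>x \<in> carrier M; y \<in> carrier N; y' \<in> carrier N\<rbrakk> \<Longrightarrow>
      b x (y \<oplus>\<^bsub>N\<^esub> y') = b x y \<oplus>\<^bsub>L\<^esub> b x y'"
    and "\<And>r x y. \<lbrakk>r \<in> carrier R; x \<in> carrier M; y \<in> carrier N\<rbrakk> \<Longrightarrow>
      b (r \<odot>\<^bsub>M\<^esub> x) y = r \<odot>\<^bsub>L\<^esub> b x y"
    and "\<And>r x y. \<lbrakk>r \<in> carrier R; x \<in> carrier M; y \<in> carrier N\<rbrakk> \<Longrightarrow>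
      b x (r \<odot>\<^bsub>N\<^esub> y) = r \<odot>\<^bsub>L\<^esub> b x y"
  shows "b \<in> bilin_maps R M N L"
  using assms by (auto simp: bilin_maps_def lin_maps_def)

lemma bilin_mapsD:
  assumes "b \<in> bilin_maps R M N L"
  shows "\<lbrakk>x \<in> carrier M; y \<in> carrier N\<rbrakk> \<Longrightarrow> b x y \<in> carrier L"
    and "\<lbrakk>x \<in> carrier M; x' \<in> carrier M; y \<in> carrier N\<rbrakk> \<Longrightarrow>
      b (x \<oplus>\<^bsub>M\<^esub> x') y = b x y \<oplus>\<^bsub>L\<^esub> b x' y"
    and "\<lbrakk>x \<in> carrier M; y \<in> carrier N; y' \<in> carrier N\<rbrakk> \<Longrightarrow>
      b x (y \<oplus>\<^bsub>N\<^esub> y') = b x y \<oplus>\<^bsub>L\<^esub> b x y'"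
    and "\<lbrakk>r \<in> carrier R; x \<in> carrier M; y \<in> carrier N\<rbrakk> \<Longrightarrow> b (r \<odot>\<^bsub>M\<^esub> x) y = r \<odot>\<^bsub>L\<^esub> b x y"
    and "\<lbrakk>r \<in> carrier R; x \<in> carrier M; y \<in> carrier N\<rbrakk> \<Longrightarrow> b x (r \<odot>\<^bsub>N\<^esub> y) = r \<odot>\<^bsub>L\<^esub> b x y"
  using assms by (auto simp: bilin_maps_def lin_maps_def)

lemma bilin_maps_comp:
  assumes b: "b \<in> bilin_maps R M N L" and h: "h \<in> lin_maps R M' M" and k: "k \<in> lin_maps R N' N"
  shows "(\<lambda>x y. b (h x) (k y)) \<in> bilin_maps R M' N' L"
  using bilin_mapsD[OF b] lin_mapsD[OF h] lin_mapsD[OF k] by (intro bilin_mapsI) simp_all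

lemma lin_maps_minus:
  assumes "module R M" "module R N" and h: "h \<in> lin_maps R M N"
    and "x \<in> carrier M" "y \<in> carrier M"
  shows "h (x \<ominus>\<^bsub>M\<^esub> y) = h x \<ominus>\<^bsub>N\<^esub> h y"
proof -
  interpret M: module R M by fact
  interpret N: module R N by fact
  have neg: "\<ominus>\<^bsub>M\<^esub> y = (\<ominus>\<^bsub>R\<^esub> \<one>\<^bsub>R\<^esub>) \<odot>\<^bsub>M\<^esub> y" "\<ominus>\<^bsub>N\<^esub> h y = (\<ominus>\<^bsub>R\<^esub> \<one>\<^bsub>R\<^esub>) \<odot>\<^bsub>N\<^esub> h y"
    using assms lin_maps_closed[OF h] by (simp_all add: M.smult_l_minus N.smult_l_minus)
  have "h (\<ominus>\<^bsub>M\<^esub> y) = \<ominus>\<^bsub>N\<^esub> h y"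
    unfolding neg using assms by (intro lin_maps_smult[OF h]) simp_all
  then show ?thesis using assms lin_maps_add[OF h] by (simp add: a_minus_def)
qed

lemma (in abelian_group) minus_eq_zero_iff:
  "\<lbrakk>x \<in> carrier G; y \<in> carrier G\<rbrakk> \<Longrightarrow> x \<ominus> y = \<zero> \<longleftrightarrow> x = y"
  using add.inv_solve_right[of \<zero> x y] by (auto simp: a_minus_def r_neg)

context cring
begin

context
  fixes M :: "('a, 'x) module" and N :: "('a, 'y) module"
  assumes M: "module R M" and N: "module R N"
begin

interpretation M: module R M by (rule M)
interpretation N: module R N by (rule N)

lemma tensor_rels_closed: "tensor_rels R M N \<subseteq> carrier (free_module R (carrier M \<times> carrier N))"
proof -
  interpret F: module R "free_module R (carrier M \<times> carrier N)" by (rule free_module)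
  show ?thesis
    unfolding tensor_rels_def Let_def
    by (intro Un_least subsetI; elim CollectE exE conjE; hypsubst)
      (intro F.minus_closed F.a_closed F.smult_closed gen_closed SigmaI M.a_closed N.a_closed
        M.smult_closed N.smult_closed; assumption)+
qed

lemma tensor_module: "module R (tensor R M N)"
  unfolding tensor_def by (rule pres_module[OF tensor_rels_closed])

lemma pure_tensor_closed:
  "\<lbrakk>x \<in> carrier M; y \<in> carrier N\<rbrakk> \<Longrightarrow> pure_tensor R M N x y \<in> carrier (tensor R M N)"
  unfolding tensor_def pure_tensor_def by (rule pres_gen_closed[OF tensor_rels_closed]) simp

text \<open>On a relation of the tensor product, the linear extension of a map \<open>b\<close> of pairs is the
  difference of the two sides of one of the equations that express bilinearity.\<close>

lemma lin_ext_tensor_rels: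
  assumes L: "module R L" and b: "\<And>x y. \<lbrakk>x \<in> carrier M; y \<in> carrier N\<rbrakk> \<Longrightarrow> b x y \<in> carrier L"
  shows "(\<forall>t\<in>tensor_rels R M N. lin_ext R L (case_prod b) t = \<zero>\<^bsub>L\<^esub>) \<longleftrightarrow> b \<in> bilin_maps R M N L"
proof -
  let ?F = "free_module R (carrier M \<times> carrier N)"
  let ?h = "lin_ext R L (case_prod b)"
  interpret L: module R L by fact
  interpret F: module R ?F by (rule free_module)
  have h: "?h \<in> lin_maps R ?F L" using b by (intro lin_ext_linear[OF L]) auto
  have g: "?h (gen R (x, y)) = b x y" "gen R (x, y) \<in> carrier ?F"
    if "x \<in> carrier M" "y \<in> carrier N" for x y
    using lin_ext_gen[OF L, of "case_prod b" "(x, y)"] b that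
    by (simp_all del: free_module_simps add: gen_closed)
  have add: "?h (u \<ominus>\<^bsub>?F\<^esub> (v \<oplus>\<^bsub>?F\<^esub> w)) = \<zero>\<^bsub>L\<^esub> \<longleftrightarrow> ?h u = ?h v \<oplus>\<^bsub>L\<^esub> ?h w"
    if "u \<in> carrier ?F" "v \<in> carrier ?F" "w \<in> carrier ?F" for u v w
    using that lin_maps_closed[OF h] lin_maps_minus[OF free_module L h that(1) F.a_closed[OF that(2,3)]]
      lin_maps_add[OF h that(2,3)] by (simp add: L.minus_eq_zero_iff del: free_module_simps)
  have smult: "?h (u \<ominus>\<^bsub>?F\<^esub> r \<odot>\<^bsub>?F\<^esub> v) = \<zero>\<^bsub>L\<^esub> \<longleftrightarrow> ?h u = r \<odot>\<^bsub>L\<^esub> ?h v"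
    if "u \<in> carrier ?F" "v \<in> carrier ?F" "r \<in> carrier R" for u v r
    using that lin_maps_closed[OF h] lin_maps_minus[OF free_module L h that(1) F.smult_closed[OF that(3,2)]]
      lin_maps_smult[OF h that(3,2)] by (simp add: L.minus_eq_zero_iff del: free_module_simps)
  show ?thesis
  proof
    assume rels: "\<forall>t\<in>tensor_rels R M N. ?h t = \<zero>\<^bsub>L\<^esub>"
    show "b \<in> bilin_maps R M N L"
    proof (rule bilin_mapsI)
      fix x x' y assume c: "x \<in> carrier M" "x' \<in> carrier M" "y \<in> carrier N"
      have "gen R (x \<oplus>\<^bsub>M\<^esub> x', y) \<ominus>\<^bsub>?F\<^esub> (gen R (x, y) \<oplus>\<^bsub>?F\<^esub> gen R (x', y)) \<in> tensor_rels R M N"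
        using c unfolding tensor_rels_def Let_def by blast
      with rels have "?h (gen R (x \<oplus>\<^bsub>M\<^esub> x', y) \<ominus>\<^bsub>?F\<^esub> (gen R (x, y) \<oplus>\<^bsub>?F\<^esub> gen R (x', y))) = \<zero>\<^bsub>L\<^esub>"
        by blast
      then show "b (x \<oplus>\<^bsub>M\<^esub> x') y = b x y \<oplus>\<^bsub>L\<^esub> b x' y"
        using c by (simp only: add g M.a_closed)
    next
      fix x y y' assume c: "x \<in> carrier M" "y \<in> carrier N" "y' \<in> carrier N"
      have "gen R (x, y \<oplus>\<^bsub>N\<^esub> y') \<ominus>\<^bsub>?F\<^esub> (gen R (x, y) \<oplus>\<^bsub>?F\<^esub> gen R (x, y')) \<in> tensor_rels R M N"
        using c unfolding tensor_rels_def Let_def by blast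
      with rels have "?h (gen R (x, y \<oplus>\<^bsub>N\<^esub> y') \<ominus>\<^bsub>?F\<^esub> (gen R (x, y) \<oplus>\<^bsub>?F\<^esub> gen R (x, y'))) = \<zero>\<^bsub>L\<^esub>"
        by blast
      then show "b x (y \<oplus>\<^bsub>N\<^esub> y') = b x y \<oplus>\<^bsub>L\<^esub> b x y'"
        using c by (simp only: add g N.a_closed)
    next
      fix r x y assume c: "r \<in> carrier R" "x \<in> carrier M" "y \<in> carrier N"
      have "gen R (r \<odot>\<^bsub>M\<^esub> x, y) \<ominus>\<^bsub>?F\<^esub> r \<odot>\<^bsub>?F\<^esub> gen R (x, y) \<in> tensor_rels R M N"
        using c unfolding tensor_rels_def Let_def by blast
      with rels have "?h (gen R (r \<odot>\<^bsub>M\<^esub> x, y) \<ominus>\<^bsub>?F\<^esub> r \<odot>\<^bsub>?F\<^esub> gen R (x, y)) = \<zero>\<^bsub>L\<^esub>" by blast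
      then show "b (r \<odot>\<^bsub>M\<^esub> x) y = r \<odot>\<^bsub>L\<^esub> b x y"
        using c by (simp only: smult g M.smult_closed)
      have "gen R (x, r \<odot>\<^bsub>N\<^esub> y) \<ominus>\<^bsub>?F\<^esub> r \<odot>\<^bsub>?F\<^esub> gen R (x, y) \<in> tensor_rels R M N"
        using c unfolding tensor_rels_def Let_def by blast
      with rels have "?h (gen R (x, r \<odot>\<^bsub>N\<^esub> y) \<ominus>\<^bsub>?F\<^esub> r \<odot>\<^bsub>?F\<^esub> gen R (x, y)) = \<zero>\<^bsub>L\<^esub>" by blast
      then show "b x (r \<odot>\<^bsub>N\<^esub> y) = r \<odot>\<^bsub>L\<^esub> b x y"
        using c by (simp only: smult g N.smult_closed)
    qed (use b in auto)
  next
    assume "b \<in> bilin_maps R M N L"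
    note bil = bilin_mapsD[OF this]
    show "\<forall>t\<in>tensor_rels R M N. ?h t = \<zero>\<^bsub>L\<^esub>"
      unfolding tensor_rels_def Let_def
      by (auto simp only: Un_iff mem_Collect_eq add smult g bil
          M.a_closed N.a_closed M.smult_closed N.smult_closed)
  qed
qed

lemma pure_tensor_bilinear: "pure_tensor R M N \<in> bilin_maps R M N (tensor R M N)"
proof -
  have "case_prod (pure_tensor R M N) = pres_gen R (carrier M \<times> carrier N) (tensor_rels R M N)"
    by (auto simp: pure_tensor_def)
  then show ?thesis
    using pres_gen_relation[OF tensor_rels_closed] pure_tensor_closed
    by (subst lin_ext_tensor_rels[OF tensor_module, symmetric]) (auto simp: tensor_def)
qed

lemma tensor_lift:
  assumes L: "module R L" and b: "b \<in> bilin_maps R M N L"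
  shows "tensor_lift R L b \<in> lin_maps R (tensor R M N) L"
    and "\<lbrakk>x \<in> carrier M; y \<in> carrier N\<rbrakk> \<Longrightarrow> tensor_lift R L b (pure_tensor R M N x y) = b x y"
proof -
  have cl: "case_prod b a \<in> carrier L" if "a \<in> carrier M \<times> carrier N" for a
    using bilin_mapsD(1)[OF b] that by auto
  have rel: "lin_ext R L (case_prod b) t = \<zero>\<^bsub>L\<^esub>" if "t \<in> tensor_rels R M N" for t
    using lin_ext_tensor_rels[OF L, of b] bilin_mapsD(1)[OF b] b that by blast
  note lift = pres_lift_linear[OF tensor_rels_closed L cl rel]
  show "tensor_lift R L b \<in> lin_maps R (tensor R M N) L"
    unfolding tensor_lift_def tensor_def by (rule lift(1))
  show "tensor_lift R L b (pure_tensor R M N x y) = b x y" if "x \<in> carrier M" "y \<in> carrier N"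
    using lift(2)[of "(x, y)"] that by (simp add: tensor_lift_def pure_tensor_def)
qed

end

lemma tensor_map:
  assumes M': "module R M'" and N': "module R N'" and M: "module R M" and N: "module R N"
    and h: "h \<in> lin_maps R M' M" and k: "k \<in> lin_maps R N' N"
  shows "tensor_map R M N h k \<in> lin_maps R (tensor R M' N') (tensor R M N)"
    and "\<lbrakk>x \<in> carrier M'; y \<in> carrier N'\<rbrakk> \<Longrightarrow>
      tensor_map R M N h k (pure_tensor R M' N' x y) = pure_tensor R M N (h x) (k y)"
  unfolding tensor_map_def
  using tensor_lift[OF M' N' tensor_module[OF M N]
      bilin_maps_comp[OF pure_tensor_bilinear[OF M N] h k]] by auto

lemma direct_sum_module:
  assumes "\<And>i. i \<in> A \<Longrightarrow> module R (M i)"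
  shows "module R (direct_sum A M)"
proof -
  note ax = module.axioms[OF assms]
  note grp = abelian_group.axioms(1)[OF ax(2)]
  show ?thesis
    by (rule module_of_smult_zero)
      (auto simp: direct_sum_def is_cring fun_eq_iff PiE_iff extensional_def
        abelian_monoid.zero_closed[OF grp] abelian_monoid.a_closed[OF grp]
        abelian_monoid.a_assoc[OF grp] abelian_monoid.l_zero[OF grp]
        module.smult_closed[OF assms] module.smult_l_distr[OF assms]
        module.smult_r_distr[OF assms] module.smult_assoc1[OF assms]
        module.smult_one[OF assms] module.smult_l_null[OF assms]
        intro: abelian_monoid.a_comm[OF grp])
qed

lemma direct_sum_component: "i \<in> A \<Longrightarrow> (\<lambda>x. x i) \<in> lin_maps R (direct_sum A M) (M i)"
  by (auto simp: lin_maps_def direct_sum_def)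

end

section \<open>Species\<close>

lemma finite_decomps: "finite I \<Longrightarrow> finite (decomps I)"
  by (rule finite_subset[of _ "Pow I \<times> Pow I"]) (auto simp: decomps_def)

lemma decomps_image:
  "\<lbrakk>inj_on \<sigma> I; (S, T) \<in> decomps I\<rbrakk> \<Longrightarrow> (\<sigma> ` S, \<sigma> ` T) \<in> decomps (\<sigma> ` I)"
  by (auto simp: decomps_def inj_on_def)

lemma decomps_image_eq:
  assumes "inj_on \<sigma> I"
  shows "decomps (\<sigma> ` I) = (\<lambda>(S, T). (\<sigma> ` S, \<sigma> ` T)) ` decomps I"
proof -
  have "d \<in> (\<lambda>(S, T). (\<sigma> ` S, \<sigma> ` T)) ` decomps I" if d: "d \<in> decomps (\<sigma> ` I)" for d
  proof (rule image_eqI)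
    let ?S = "{i \<in> I. \<sigma> i \<in> fst d}" and ?T = "{i \<in> I. \<sigma> i \<in> snd d}"
    show "d = (\<lambda>(S, T). (\<sigma> ` S, \<sigma> ` T)) (?S, ?T)"
      using d by (cases d) (auto simp: decomps_def)
    show "(?S, ?T) \<in> decomps I" using d by (cases d) (auto simp: decomps_def)
  qed
  then show ?thesis using decomps_image[OF assms] by fast
qed

text \<open>The blocks of a decomposition of \<open>\<sigma> ` I\<close> are pulled back along \<open>\<sigma>\<close> in the definition of the
  action; on the image of a decomposition of \<open>I\<close> the pullback is undone by injectivity.\<close>

lemma cauchy_act_component:
  assumes "inj_on \<sigma> I" and d: "(S, T) \<in> decomps I"
  shows "act (cauchy R X Y) I \<sigma> c (\<sigma> ` S, \<sigma> ` T) =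
    tensor_map R (obj X (\<sigma> ` S)) (obj Y (\<sigma> ` T)) (act X S \<sigma>) (act Y T \<sigma>) (c (S, T))"
proof -
  have "{i \<in> I. \<sigma> i \<in> \<sigma> ` S} = S" "{i \<in> I. \<sigma> i \<in> \<sigma> ` T} = T"
    using assms by (auto simp: decomps_def inj_on_def)
  then show ?thesis using decomps_image[OF assms] by (simp add: cauchy_def)
qed

lemma obj_lin_species [simp]: "obj (lin_species R P) I = free_module R (elts P I)"
  by (simp add: lin_species_def)

lemma (in cring) lin_species_act:
  assumes P: "is_set_species P" and I: "finite I" "inj_on \<sigma> I"
  shows "act (lin_species R P) I \<sigma>
      \<in> lin_maps R (free_module R (elts P I)) (free_module R (elts P (\<sigma> ` I)))"
    and "x \<in> elts P I \<Longrightarrow> act (lin_species R P) I \<sigma> (gen R x) = gen R (relabel P I \<sigma> x)"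
proof -
  have cl: "gen R (relabel P I \<sigma> x) \<in> carrier (free_module R (elts P (\<sigma> ` I)))"
    if "x \<in> elts P I" for x
    using P I that by (intro gen_closed) (auto simp: is_set_species_def)
  show "act (lin_species R P) I \<sigma>
      \<in> lin_maps R (free_module R (elts P I)) (free_module R (elts P (\<sigma> ` I)))"
    unfolding lin_species_def by (simp del: free_module_simps, intro lin_ext_linear free_module cl)
  show "act (lin_species R P) I \<sigma> (gen R x) = gen R (relabel P I \<sigma> x)" if "x \<in> elts P I"
    using lin_ext_gen[where b = "\<lambda>x. gen R (relabel P I \<sigma> x)", OF free_module cl[OF that]]
    by (simp add: lin_species_def)
qed

lemma exp_set_species: "is_set_species exp_set_species"
  by (auto simp: is_set_species_def exp_set_species_def image_comp)

lemma obj_exp_species: "obj (exp_species R) I = free_module R {I}"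
  by (simp add: exp_species_def exp_set_species_def)

lemma (in cring) exp_species_act:
  assumes "finite I" "inj_on \<sigma> I"
  shows "act (exp_species R) I \<sigma> \<in> lin_maps R (free_module R {I}) (free_module R {\<sigma> ` I})"
    and "act (exp_species R) I \<sigma> (gen R I) = gen R (\<sigma> ` I)"
  using lin_species_act[OF exp_set_species assms] unfolding exp_species_def
  by (simp_all add: exp_set_species_def)

text \<open>The coaction is a morphism of species, so its components commute with relabelling. The factor
  in the exponential species is removed by pairing with the coefficient of its basis element. Over
  the trivial ring all basis vectors coincide, so a coaction determines the restriction maps only up
  to \<open>gen\<close>, and naturality is stated in the linearized species.\<close>

lemma (in linearized_exp_bicomodule) lres_natural:
  assumes I: "finite I" "inj_on \<sigma> I" and d: "(S, T) \<in> decomps I" and z: "z \<in> elts P I"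
  shows "gen R (lres (\<sigma> ` I) (\<sigma> ` T) (relabel P I \<sigma> z)) = gen R (relabel P T \<sigma> (lres I T z))"
proof -
  let ?X = "lin_species R P" and ?E = "exp_species R"
  let ?z = "relabel P I \<sigma> z" and ?x = "lres I T z"
  have ST: "finite S" "finite T" "inj_on \<sigma> S" "inj_on \<sigma> T"
    using I d by (auto simp: decomps_def inj_on_def)
  have z': "?z \<in> elts P (\<sigma> ` I)" using set_species I z by (auto simp: is_set_species_def)
  have x: "?x \<in> elts P T" using lres_closed[OF I(1) d z] .
  have x': "relabel P T \<sigma> ?x \<in> elts P (\<sigma> ` T)" using set_species ST x by (auto simp: is_set_species_def)
  have y': "lres (\<sigma> ` I) (\<sigma> ` T) ?z \<in> elts P (\<sigma> ` T)"
    using lres_closed[OF _ decomps_image[OF I(2) d] z'] I by simp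
  let ?F = "free_module R {\<sigma> ` S}" and ?G = "free_module R (elts P (\<sigma> ` T))"
  interpret G: module R ?G by (rule free_module)
  have "pure_tensor R ?F ?G (gen R (\<sigma> ` S)) (gen R (lres (\<sigma> ` I) (\<sigma> ` T) ?z))
      = lam (\<sigma> ` I) (gen R ?z) (\<sigma> ` S, \<sigma> ` T)"
    using lam_gen[OF _ decomps_image[OF I(2) d] z'] I by (simp add: obj_exp_species)
  also have "\<dots> = lam (\<sigma> ` I) (act ?X I \<sigma> (gen R z)) (\<sigma> ` S, \<sigma> ` T)"
    using lin_species_act(2)[OF set_species I z] by simp
  also have "\<dots> = act (cauchy R ?E ?X) I \<sigma> (lam I (gen R z)) (\<sigma> ` S, \<sigma> ` T)"
    using lam_morphism I gen_closed[OF z] unfolding is_species_morphism_def by simp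
  also have "\<dots> = tensor_map R ?F ?G (act ?E S \<sigma>) (act ?X T \<sigma>)
      (pure_tensor R (free_module R {S}) (free_module R (elts P T)) (gen R S) (gen R ?x))"
    using lam_gen[OF I(1) d z] by (simp add: cauchy_act_component[OF I(2) d] obj_exp_species)
  also have "\<dots> = pure_tensor R ?F ?G (gen R (\<sigma> ` S)) (gen R (relabel P T \<sigma> ?x))"
    using tensor_map(2)[OF free_module free_module free_module free_module
        exp_species_act(1)[OF ST(1,3)] lin_species_act(1)[OF set_species ST(2,4)]
        gen_closed gen_closed[OF x]]
      exp_species_act(2)[OF ST(1,3)] lin_species_act(2)[OF set_species ST(2,4) x] by simp
  finally have eq: "pure_tensor R ?F ?G (gen R (\<sigma> ` S)) (gen R (lres (\<sigma> ` I) (\<sigma> ` T) ?z))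
      = pure_tensor R ?F ?G (gen R (\<sigma> ` S)) (gen R (relabel P T \<sigma> ?x))" .
  have bil: "(\<lambda>e x. e (\<sigma> ` S) \<odot>\<^bsub>?G\<^esub> x) \<in> bilin_maps R ?F ?G ?G"
    by (rule bilin_mapsI; (rule G.smult_closed)?)
      (auto simp: l_distr r_distr m_assoc m_lcomm fun_eq_iff)
  have "tensor_lift R ?G (\<lambda>e x. e (\<sigma> ` S) \<odot>\<^bsub>?G\<^esub> x) (pure_tensor R ?F ?G (gen R (\<sigma> ` S)) (gen R y))
      = gen R y" if "y \<in> elts P (\<sigma> ` T)" for y
    using tensor_lift(2)[OF free_module free_module free_module bil gen_closed gen_closed[OF that]]
    by (simp add: gen_def fun_eq_iff)
  from this[OF y'] this[OF x'] eq show ?thesis by simp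
qed

lemma (in linearized_exp_bicomodule) rres_natural:
  assumes I: "finite I" "inj_on \<sigma> I" and d: "(S, T) \<in> decomps I" and z: "z \<in> elts P I"
  shows "gen R (rres (\<sigma> ` I) (\<sigma> ` S) (relabel P I \<sigma> z)) = gen R (relabel P S \<sigma> (rres I S z))"
proof -
  let ?X = "lin_species R P" and ?E = "exp_species R"
  let ?z = "relabel P I \<sigma> z" and ?x = "rres I S z"
  have ST: "finite S" "finite T" "inj_on \<sigma> S" "inj_on \<sigma> T"
    using I d by (auto simp: decomps_def inj_on_def)
  have z': "?z \<in> elts P (\<sigma> ` I)" using set_species I z by (auto simp: is_set_species_def)
  have x: "?x \<in> elts P S" using rres_closed[OF I(1) d z] .
  have x': "relabel P S \<sigma> ?x \<in> elts P (\<sigma> ` S)" using set_species ST x by (auto simp: is_set_species_def)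
  have y': "rres (\<sigma> ` I) (\<sigma> ` S) ?z \<in> elts P (\<sigma> ` S)"
    using rres_closed[OF _ decomps_image[OF I(2) d] z'] I by simp
  let ?F = "free_module R {\<sigma> ` T}" and ?G = "free_module R (elts P (\<sigma> ` S))"
  interpret G: module R ?G by (rule free_module)
  have "pure_tensor R ?G ?F (gen R (rres (\<sigma> ` I) (\<sigma> ` S) ?z)) (gen R (\<sigma> ` T))
      = rho (\<sigma> ` I) (gen R ?z) (\<sigma> ` S, \<sigma> ` T)"
    using rho_gen[OF _ decomps_image[OF I(2) d] z'] I by (simp add: obj_exp_species)
  also have "\<dots> = rho (\<sigma> ` I) (act ?X I \<sigma> (gen R z)) (\<sigma> ` S, \<sigma> ` T)"
    using lin_species_act(2)[OF set_species I z] by simp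
  also have "\<dots> = act (cauchy R ?X ?E) I \<sigma> (rho I (gen R z)) (\<sigma> ` S, \<sigma> ` T)"
    using rho_morphism I gen_closed[OF z] unfolding is_species_morphism_def by simp
  also have "\<dots> = tensor_map R ?G ?F (act ?X S \<sigma>) (act ?E T \<sigma>)
      (pure_tensor R (free_module R (elts P S)) (free_module R {T}) (gen R ?x) (gen R T))"
    using rho_gen[OF I(1) d z] by (simp add: cauchy_act_component[OF I(2) d] obj_exp_species)
  also have "\<dots> = pure_tensor R ?G ?F (gen R (relabel P S \<sigma> ?x)) (gen R (\<sigma> ` T))"
    using tensor_map(2)[OF free_module free_module free_module free_module
        lin_species_act(1)[OF set_species ST(1,3)] exp_species_act(1)[OF ST(2,4)]
        gen_closed[OF x] gen_closed]
      exp_species_act(2)[OF ST(2,4)] lin_species_act(2)[OF set_species ST(1,3) x] by simp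
  finally have eq: "pure_tensor R ?G ?F (gen R (rres (\<sigma> ` I) (\<sigma> ` S) ?z)) (gen R (\<sigma> ` T))
      = pure_tensor R ?G ?F (gen R (relabel P S \<sigma> ?x)) (gen R (\<sigma> ` T))" .
  have bil: "(\<lambda>x e. e (\<sigma> ` T) \<odot>\<^bsub>?G\<^esub> x) \<in> bilin_maps R ?G ?F ?G"
    by (rule bilin_mapsI; (rule G.smult_closed)?)
      (auto simp: l_distr r_distr m_assoc m_lcomm fun_eq_iff)
  have "tensor_lift R ?G (\<lambda>x e. e (\<sigma> ` T) \<odot>\<^bsub>?G\<^esub> x) (pure_tensor R ?G ?F (gen R y) (gen R (\<sigma> ` T)))
      = gen R y" if "y \<in> elts P (\<sigma> ` S)" for y
    using tensor_lift(2)[OF free_module free_module free_module bil gen_closed[OF that] gen_closed]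
    by (simp add: gen_def fun_eq_iff)
  from this[OF y'] this[OF x'] eq show ?thesis by simp
qed

section \<open>Inversions of lists\<close>

fun inversions :: "'a::linorder list \<Rightarrow> nat" where
  "inversions [] = 0"
| "inversions (x # xs) = length (filter (\<lambda>y. y < x) xs) + inversions xs"

definition cross_inversions :: "'a::linorder list \<Rightarrow> 'a list \<Rightarrow> nat" where
  "cross_inversions xs ys = (\<Sum>x\<leftarrow>xs. length (filter (\<lambda>y. y < x) ys))"

lemma inversions_append:
  "inversions (xs @ ys) = inversions xs + inversions ys + cross_inversions xs ys"
  by (induction xs) (auto simp: cross_inversions_def)

text \<open>Only the pair of the two exchanged entries changes its relative position.\<close>

lemma inversions_adjacent_swap:
  "b < a \<Longrightarrow> inversions (us @ [a, b] @ vs) = Suc (inversions (us @ [b, a] @ vs))"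
  by (auto simp: inversions_append cross_inversions_def not_less)
    (auto intro: arg_cong[of _ _ sum_list])

lemma minus_one_power_inversions_adjacent_swap:
  assumes "a \<noteq> b"
  shows "(- 1 :: int) ^ inversions (us @ [a, b] @ vs) = - ((- 1) ^ inversions (us @ [b, a] @ vs))"
proof (cases "b < a")
  case True
  then show ?thesis by (simp only: inversions_adjacent_swap) simp
next
  case False
  then have "a < b" using assms by simp
  then show ?thesis by (simp only: inversions_adjacent_swap) simp
qed

lemma inversions_sorted: "sorted xs \<Longrightarrow> inversions xs = 0"
  by (induction xs) (auto simp: filter_empty_conv not_less)

lemma inversions_map_strict_mono:
  "strict_mono_on (set xs) h \<Longrightarrow> inversions (map h xs) = inversions xs"
proof (induction xs)
  case (Cons x xs)
  then have "strict_mono_on (set xs) h" by (auto simp: strict_mono_on_def)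
  moreover have "filter (\<lambda>y. h y < h x) xs = filter (\<lambda>y. y < x) xs"
    using Cons.prems by (intro filter_cong) (auto simp: strict_mono_on_less)
  ultimately show ?case using Cons.IH by (simp add: filter_map comp_def)
qed simp

lemma cross_inversions_sch:
  assumes "distinct xs" "distinct ys"
  shows "cross_inversions xs ys = sch (set xs) (set ys)"
proof -
  have "{(s, t). s \<in> set xs \<and> t \<in> set ys \<and> s > t} = (SIGMA s:set xs. {t \<in> set ys. t < s})"
    by auto
  then have "sch (set xs) (set ys) = (\<Sum>s\<in>set xs. card {t \<in> set ys. t < s})"
    by (simp add: sch_def card_SigmaI)
  also have "\<dots> = (\<Sum>s\<in>set xs. length (filter (\<lambda>y. y < s) ys))"
    using assms(2) by (intro sum.cong refl)
      (metis distinct_card distinct_filter set_filter)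
  also have "\<dots> = cross_inversions xs ys"
    using assms(1) by (simp add: cross_inversions_def sum_list_distinct_conv_sum_set)
  finally show ?thesis by simp
qed

text \<open>Moving an entry across a block of length \<open>n\<close> takes \<open>n\<close> adjacent swaps.\<close>

lemma minus_one_power_inversions_move:
  assumes "a \<notin> set ms"
  shows "(- 1 :: int) ^ inversions (us @ a # ms @ vs)
    = (- 1) ^ length ms * (- 1) ^ inversions (us @ ms @ a # vs)"
  using assms
proof (induction ms arbitrary: us)
  case (Cons m ms)
  have "(- 1 :: int) ^ inversions (us @ a # (m # ms) @ vs)
      = - ((- 1) ^ inversions ((us @ [m]) @ a # ms @ vs))"
    using minus_one_power_inversions_adjacent_swap[of a m us "ms @ vs"] Cons.prems by simp
  also have "\<dots> = (- 1) ^ length (m # ms) * (- 1) ^ inversions (us @ (m # ms) @ a # vs)"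
    using Cons.IH[of "us @ [m]"] Cons.prems by simp
  finally show ?case .
qed simp

text \<open>Exchanging the first and the last entry of a block \<open>a # ms @ [b]\<close> takes \<open>2 |ms| + 1\<close> swaps of
  adjacent entries.\<close>

lemma minus_one_power_inversions_transpose:
  assumes "distinct xs" "a \<in> set xs" "b \<in> set xs" "a \<noteq> b"
  shows "(- 1 :: int) ^ inversions (map (Transposition.transpose a b) xs) = - ((- 1) ^ inversions xs)"
proof -
  have block: "(- 1 :: int) ^ inversions (map (Transposition.transpose a b) xs)
      = - ((- 1) ^ inversions xs)"
    if xs: "xs = us @ a # ms @ b # vs" and dist: "distinct xs" for a b us ms vs
  proof -
    have nin: "a \<noteq> b" "a \<notin> set ms" "b \<notin> set ms" "a \<notin> set us" "b \<notin> set us" "a \<notin> set vs" "b \<notin> set vs"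
      using dist xs by auto
    have fix': "map (Transposition.transpose a b) ys = ys" if "a \<notin> set ys" "b \<notin> set ys" for ys
      using that by (intro map_idI transpose_apply_other) auto
    have "map (Transposition.transpose a b) xs = us @ b # ms @ a # vs"
      using nin by (simp add: xs fix')
    then have "(- 1 :: int) ^ inversions (map (Transposition.transpose a b) xs)
        = (- 1) ^ length ms * (- 1) ^ inversions ((us @ ms) @ [b, a] @ vs)"
      using minus_one_power_inversions_move[of b ms us "a # vs"] nin by simp
    also have "\<dots> = - ((- 1) ^ length ms * (- 1) ^ inversions ((us @ ms) @ [a, b] @ vs))"
      using minus_one_power_inversions_adjacent_swap[of b a "us @ ms" vs] nin by simp
    also have "\<dots> = - ((- 1) ^ inversions xs)"
      using minus_one_power_inversions_move[of a ms us "b # vs"] nin by (simp add: xs)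
    finally show ?thesis .
  qed
  obtain us ws where ws: "xs = us @ a # ws" using assms(2) by (auto dest: split_list)
  show ?thesis
  proof (cases "b \<in> set ws")
    case True
    then obtain ms vs where "ws = ms @ b # vs" by (auto dest: split_list)
    then show ?thesis using block[of us a ms b vs] ws assms(1) by simp
  next
    case False
    then have "b \<in> set us" using assms ws by auto
    then obtain vs ms where "us = vs @ b # ms" by (auto dest: split_list)
    then show ?thesis
      using block[of vs b ms a ws] ws assms(1) by (simp add: transpose_commute)
  qed
qed

text \<open>Both sides change sign when the permutation is multiplied by a transposition.\<close>

lemma sign_eq_inversions:
  assumes "\<sigma> permutes set xs" and dist: "distinct xs"
  shows "(- 1 :: int) ^ inversions (map \<sigma> xs) = sign \<sigma> * (- 1) ^ inversions xs"
  using assms(1) finite_set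
proof (induction rule: permutes_induct)
  case id
  then show ?case by simp
next
  case (swap a b p)
  have p: "distinct (map p xs)" "set (map p xs) = set xs"
    using dist swap.hyps permutes_image[of p "set xs"]
    by (auto simp: distinct_map permutes_inj_on)
  have "map (Transposition.transpose a b \<circ> p) xs = map (Transposition.transpose a b) (map p xs)"
    by simp
  then have "(- 1 :: int) ^ inversions (map (Transposition.transpose a b \<circ> p) xs)
      = - ((- 1) ^ inversions (map p xs))"
    using minus_one_power_inversions_transpose[of "map p xs" a b] p swap.hyps by simp
  also have "\<dots> = sign (Transposition.transpose a b \<circ> p) * (- 1) ^ inversions xs"
    using swap by (simp add: sign_compose permutation_swap_id sign_swap_id
        permutes_imp_permutation[of "set xs" p])
  finally show ?case .
qed

section \<open>Standardization\<close>

text \<open>An order preserving bijection onto an initial segment lists its values in increasing order.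
  This determines it, and shows that standardizing creates no inversions.\<close>

lemma standardization_map_sorted_list:
  assumes "finite S" and h: "bij_betw h S {1..card S}" "strict_mono_on S h"
  shows "map h (sorted_list_of_set S) = [1..<Suc (card S)]"
proof (rule sorted_distinct_set_unique)
  have "mono_on S h" using h(2) by (rule strict_mono_on_imp_mono_on)
  then show "sorted (map h (sorted_list_of_set S))"
    using assms(1) by (auto simp: sorted_map mono_on_def intro: sorted_wrt_mono_rel[OF _ sorted_sorted_list_of_set])
  show "distinct (map h (sorted_list_of_set S))"
    using h(1) assms(1) by (simp add: distinct_map bij_betw_def)
  show "set (map h (sorted_list_of_set S)) = set [1..<Suc (card S)]"
    using h(1) assms(1) by (auto simp: bij_betw_def)
qed (auto simp del: upt_Suc)

lemma std:
  assumes "finite S"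
  shows std_bij: "bij_betw (std S) S {1..card S}"
    and std_strict_mono: "strict_mono_on S (std S)"
proof -
  let ?Q = "\<lambda>h. h \<in> extensional S \<and> bij_betw h S {1..card S} \<and> strict_mono_on S h"
  define h where "h = (\<lambda>i\<in>S. card {j \<in> S. j \<le> i})"
  have mono: "strict_mono_on S h"
  proof (rule strict_mono_onI)
    fix i j assume "i \<in> S" "j \<in> S" "i < j"
    moreover from this have "{k \<in> S. k \<le> i} \<subset> {k \<in> S. k \<le> j}" by force
    ultimately show "h i < h j" using assms by (auto simp: h_def intro!: psubset_card_mono)
  qed
  have inj: "inj_on h S" using mono by (rule strict_mono_on_imp_inj_on)
  have "h i \<in> {1..card S}" if "i \<in> S" for i
  proof -
    have "card {j \<in> S. j \<le> i} \<le> card S" using assms by (intro card_mono) auto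
    moreover have "card {j \<in> S. j \<le> i} > 0" using assms that by (auto simp: card_gt_0_iff)
    ultimately show ?thesis using that by (simp add: h_def)
  qed
  then have "h ` S = {1..card S}"
    using inj by (intro card_subset_eq) (simp_all add: card_image image_subset_iff)
  then have h: "?Q h" using inj mono by (auto simp: bij_betw_def h_def)
  have "k = h" if k: "?Q k" for k
  proof (rule extensionalityI)
    have "map k (sorted_list_of_set S) = map h (sorted_list_of_set S)"
      using standardization_map_sorted_list[OF assms] h k by metis
    then show "k i = h i" if "i \<in> S" for i using that assms by simp
  qed (use h k in auto)
  with h have "?Q (std S)" unfolding std_def by (rule theI[of ?Q h])
  then show "bij_betw (std S) S {1..card S}" "strict_mono_on S (std S)" by simp_all
qed

lemma map_std_sorted_list:
  "finite S \<Longrightarrow> map (std S) (sorted_list_of_set S) = [1..<Suc (card S)]"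
  by (intro standardization_map_sorted_list std_bij std_strict_mono)

section \<open>The Koszul dual of the exponential species\<close>

lemma not_sorted_adjacent_descent:
  "\<not> sorted xs \<Longrightarrow> \<exists>us a b vs. xs = us @ [a, b] @ vs \<and> b < a"
proof (induction xs)
  case (Cons x xs)
  show ?case
  proof (cases "sorted xs")
    case True
    with Cons.prems obtain y ys where "xs = y # ys" "y < x" by (cases xs) auto
    then have "x # xs = [] @ [x, y] @ ys \<and> y < x" by simp
    then show ?thesis by blast
  next
    case False
    with Cons.IH obtain us a b vs where "xs = us @ [a, b] @ vs" "b < a" by blast
    then have "x # xs = (x # us) @ [a, b] @ vs \<and> b < a" by simp
    then show ?thesis by blast
  qed
qed simp

definition koszul_coef :: "('r, 'm) ring_scheme \<Rightarrow> nat set \<Rightarrow> (nat list \<Rightarrow> 'r) set \<Rightarrow> 'r" where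
  "koszul_coef R I = pres_lift R (self_module R) (\<lambda>l. (\<ominus>\<^bsub>R\<^esub> \<one>\<^bsub>R\<^esub>) [^]\<^bsub>R\<^esub> inversions l)"

definition sorted_class :: "('r, 'm) ring_scheme \<Rightarrow> nat set \<Rightarrow> (nat list \<Rightarrow> 'r) set" where
  "sorted_class R I = order_class R I (sorted_list_of_set I)"

lemma sorted_list_in_permutations [simp]:
  "finite I \<Longrightarrow> sorted_list_of_set I \<in> permutations_of_set I"
  by (simp add: permutations_of_set_def)

lemma permutations_of_set_swap:
  "us @ [a, b] @ vs \<in> permutations_of_set I \<Longrightarrow> us @ [b, a] @ vs \<in> permutations_of_set I"
  by (auto simp: permutations_of_set_def)

lemma map_in_permutations:
  "\<lbrakk>inj_on \<sigma> I; l \<in> permutations_of_set I\<rbrakk> \<Longrightarrow> map \<sigma> l \<in> permutations_of_set (\<sigma> ` I)"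
  by (auto simp: permutations_of_set_def distinct_map)

lemma append_in_permutations:
  "\<lbrakk>(S, T) \<in> decomps I; l \<in> permutations_of_set S; l' \<in> permutations_of_set T\<rbrakk> \<Longrightarrow>
    l @ l' \<in> permutations_of_set I"
  by (auto simp: permutations_of_set_def decomps_def)

(* Keeps the interval {1..p} in this form under simplification. *)
declare One_nat_def [simp del]

context cring
begin

abbreviation sgn_pow :: "nat \<Rightarrow> 'a" where
  "sgn_pow n \<equiv> (\<ominus> \<one>) [^] n"

lemma sgn_pow_cases: "sgn_pow n = (if even n then \<one> else \<ominus> \<one>)"
  by (induction n) (auto simp: r_minus l_minus)

lemma sgn_pow_closed [simp]: "sgn_pow n \<in> carrier R"
  by simp

lemma sgn_pow_cong: "(- 1 :: int) ^ m = (- 1) ^ n \<Longrightarrow> sgn_pow m = sgn_pow n"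
  by (auto simp: sgn_pow_cases minus_one_power_iff split: if_splits)

lemma sgn_pow_add: "sgn_pow (m + n) = sgn_pow m \<otimes> sgn_pow n"
  by (simp add: nat_pow_mult)

lemma sgn_pow_square [simp]: "sgn_pow n \<otimes> sgn_pow n = \<one>"
  by (auto simp: sgn_pow_cases r_minus l_minus)

lemma sgn_pow_cancel [simp]: "r \<in> carrier R \<Longrightarrow> sgn_pow n \<otimes> (sgn_pow n \<otimes> r) = r"
  by (simp add: m_assoc[symmetric])

lemma add_pow_minus_one_power:
  "r \<in> carrier R \<Longrightarrow> [((- 1 :: int) ^ n)] \<cdot>\<^bsub>R\<^esub> r = sgn_pow n \<otimes> r"
  by (auto simp: sgn_pow_cases minus_one_power_iff l_minus add_pow_int_ge add_pow_int_lt)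

abbreviation Edual :: "nat set \<Rightarrow> ('a, (nat list \<Rightarrow> 'a) set) module" where
  "Edual \<equiv> obj (koszul_dual R)"

lemma swap_rels_closed: "swap_rels R I \<subseteq> carrier (free_module R (permutations_of_set I))"
proof -
  interpret F: module R "free_module R (permutations_of_set I)" by (rule free_module)
  show ?thesis
    unfolding swap_rels_def
    by (intro subsetI; elim CollectE exE conjE; hypsubst)
      (rule F.a_closed, erule gen_closed, rule gen_closed, erule permutations_of_set_swap)
qed

lemma Edual_module: "module R (Edual I)"
  using pres_module[OF swap_rels_closed] by (simp add: koszul_dual_def)

lemma order_class_closed: "l \<in> permutations_of_set I \<Longrightarrow> order_class R I l \<in> carrier (Edual I)"
  using pres_gen_closed[OF swap_rels_closed] by (simp add: koszul_dual_def order_class_def)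

lemma sorted_class_closed: "finite I \<Longrightarrow> sorted_class R I \<in> carrier (Edual I)"
  unfolding sorted_class_def by (rule order_class_closed) simp

lemma Edual_linear_eqI:
  assumes "module R N" and "h \<in> lin_maps R (Edual I) N" and "k \<in> lin_maps R (Edual I) N"
    and "\<And>l. l \<in> permutations_of_set I \<Longrightarrow> h (order_class R I l) = k (order_class R I l)"
    and "x \<in> carrier (Edual I)"
  shows "h x = k x"
  by (rule pres_module_linear_eqI[OF swap_rels_closed assms(1)])
    (use assms(2-5) in \<open>simp_all add: koszul_dual_def order_class_def\<close>)

text \<open>The linear extension of \<open>b\<close> kills a swap relation exactly when \<open>b\<close> is antisymmetric on the
  two orders, which is how the relations of \<open>E!\<close> are used below.\<close>

lemma lin_ext_swap_rel:
  assumes N: "module R N" and b: "\<And>l. l \<in> permutations_of_set I \<Longrightarrow> b l \<in> carrier N"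
    and l: "us @ [i, j] @ vs \<in> permutations_of_set I"
  shows "lin_ext R N b (gen R (us @ [i, j] @ vs) \<oplus>\<^bsub>free_module R (permutations_of_set I)\<^esub>
      gen R (us @ [j, i] @ vs)) = b (us @ [i, j] @ vs) \<oplus>\<^bsub>N\<^esub> b (us @ [j, i] @ vs)"
  using lin_maps_add[OF lin_ext_linear[where b = b, OF N b] gen_closed[OF l]
      gen_closed[OF permutations_of_set_swap[OF l]]]
    lin_ext_gen[where b = b, OF N b[OF l]]
    lin_ext_gen[where b = b, OF N b[OF permutations_of_set_swap[OF l]]] by simp

lemma order_class_swap:
  assumes "us @ [i, j] @ vs \<in> permutations_of_set I"
  shows "order_class R I (us @ [i, j] @ vs) \<oplus>\<^bsub>Edual I\<^esub> order_class R I (us @ [j, i] @ vs) = \<zero>\<^bsub>Edual I\<^esub>"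
proof -
  let ?r = "gen R (us @ [i, j] @ vs) \<oplus>\<^bsub>free_module R (permutations_of_set I)\<^esub> gen R (us @ [j, i] @ vs)"
  have "?r \<in> swap_rels R I" using assms unfolding swap_rels_def by blast
  then have "lin_ext R (Edual I) (order_class R I) ?r = \<zero>\<^bsub>Edual I\<^esub>"
    using pres_gen_relation[OF swap_rels_closed] by (simp add: koszul_dual_def order_class_def)
  then show ?thesis
    using lin_ext_swap_rel[OF Edual_module order_class_closed assms] by simp
qed

lemma Edual_lift:
  assumes N: "module R N" and b: "\<And>l. l \<in> permutations_of_set I \<Longrightarrow> b l \<in> carrier N"
    and swap: "\<And>us i j vs. us @ [i, j] @ vs \<in> permutations_of_set I \<Longrightarrow>
      b (us @ [i, j] @ vs) \<oplus>\<^bsub>N\<^esub> b (us @ [j, i] @ vs) = \<zero>\<^bsub>N\<^esub>"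
  shows "pres_lift R N b \<in> lin_maps R (Edual I) N"
    and "l \<in> permutations_of_set I \<Longrightarrow> pres_lift R N b (order_class R I l) = b l"
proof -
  have rel: "lin_ext R N b x = \<zero>\<^bsub>N\<^esub>" if "x \<in> swap_rels R I" for x
    using that lin_ext_swap_rel[where b = b, OF N b] swap unfolding swap_rels_def by auto
  show "pres_lift R N b \<in> lin_maps R (Edual I) N"
    using pres_lift_linear(1)[OF swap_rels_closed N b rel] by (simp add: koszul_dual_def)
  show "pres_lift R N b (order_class R I l) = b l" if "l \<in> permutations_of_set I"
    using pres_lift_linear(2)[where b = b, OF swap_rels_closed N b rel that]
    by (simp add: order_class_def)
qed

text \<open>Sorting by exchanges of adjacent descents lowers the number of inversions by one each time and
  changes the sign of the class.\<close>

lemma order_class_eq: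
  assumes "l \<in> permutations_of_set I"
  shows "order_class R I l = sgn_pow (inversions l) \<odot>\<^bsub>Edual I\<^esub> sorted_class R I"
  using assms
proof (induction "inversions l" arbitrary: l)
  case 0
  interpret E: module R "Edual I" by (rule Edual_module)
  have "sorted l"
  proof (rule ccontr)
    assume "\<not> sorted l"
    then obtain us i j vs where "l = us @ [i, j] @ vs" "j < i"
      using not_sorted_adjacent_descent by blast
    then show False using inversions_adjacent_swap[of j i us vs] 0 by simp
  qed
  then have "l = sorted_list_of_set I"
    using "0.prems" sorted_distinct_set_unique[of l "sorted_list_of_set I"]
    by (auto simp: permutations_of_set_def)
  then show ?case
    using "0.hyps" order_class_closed[OF "0.prems"] by (simp add: sorted_class_def)
next
  case (Suc n)
  interpret E: module R "Edual I" by (rule Edual_module)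
  have "\<not> sorted l" using Suc.hyps(2) inversions_sorted[of l] by auto
  then obtain us i j vs where l: "l = us @ [i, j] @ vs" "j < i"
    using not_sorted_adjacent_descent by blast
  let ?l = "us @ [j, i] @ vs"
  have l': "?l \<in> permutations_of_set I" using Suc.prems unfolding l(1) by (rule permutations_of_set_swap)
  have inv: "inversions l = Suc (inversions ?l)" unfolding l(1) by (rule inversions_adjacent_swap[OF l(2)])
  have fin: "finite I" using Suc.prems by (auto simp: permutations_of_set_def)
  have "order_class R I l \<oplus>\<^bsub>Edual I\<^esub> order_class R I ?l = \<zero>\<^bsub>Edual I\<^esub>"
    unfolding l(1) by (rule order_class_swap) (use Suc.prems l in simp)
  then have "order_class R I l = \<ominus>\<^bsub>Edual I\<^esub> order_class R I ?l"
    by (rule E.minus_equality[OF _ order_class_closed[OF l'] order_class_closed[OF Suc.prems], symmetric])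
  also have "\<dots> = \<ominus>\<^bsub>Edual I\<^esub> (sgn_pow (inversions ?l) \<odot>\<^bsub>Edual I\<^esub> sorted_class R I)"
    using Suc.hyps(1)[OF _ l'] Suc.hyps(2) inv by simp
  also have "\<dots> = sgn_pow (inversions l) \<odot>\<^bsub>Edual I\<^esub> sorted_class R I"
    using sorted_class_closed[OF fin] by (simp add: inv r_minus E.smult_l_minus)
  finally show ?case .
qed

text \<open>The signs \<open>(-1)^inversions l\<close> are compatible with the swap relations, so they induce a
  functional. It takes the value one on the class of the sorted list, which generates; hence each
  \<open>E![I]\<close> is free of rank one on that class, with this functional as the coordinate.\<close>

lemma koszul_coef_lift:
  shows koszul_coef_linear: "koszul_coef R I \<in> lin_maps R (Edual I) (self_module R)"
    and koszul_coef_order_class: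
      "l \<in> permutations_of_set I \<Longrightarrow> koszul_coef R I (order_class R I l) = sgn_pow (inversions l)"
proof -
  have swap: "sgn_pow (inversions (us @ [i, j] @ vs)) \<oplus>\<^bsub>self_module R\<^esub>
      sgn_pow (inversions (us @ [j, i] @ vs)) = \<zero>\<^bsub>self_module R\<^esub>"
    if l: "us @ [i, j] @ vs \<in> permutations_of_set I" for us i j vs
  proof -
    have "i \<noteq> j" using l by (auto simp: permutations_of_set_def)
    from minus_one_power_inversions_adjacent_swap[OF this, of us vs]
    have "(- 1 :: int) ^ inversions (us @ [i, j] @ vs) = (- 1) ^ Suc (inversions (us @ [j, i] @ vs))"
      by simp
    then have "sgn_pow (inversions (us @ [i, j] @ vs)) = sgn_pow (Suc (inversions (us @ [j, i] @ vs)))"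
      by (rule sgn_pow_cong)
    then show ?thesis by (simp add: r_minus l_neg)
  qed
  note lift = Edual_lift[where b = "\<lambda>l. sgn_pow (inversions l)", OF self_module _ swap]
  show "koszul_coef R I \<in> lin_maps R (Edual I) (self_module R)"
    unfolding koszul_coef_def by (rule lift(1)) auto
  show "koszul_coef R I (order_class R I l) = sgn_pow (inversions l)" if "l \<in> permutations_of_set I"
    unfolding koszul_coef_def using that by (intro lift(2)) auto
qed

lemma koszul_coef_closed: "x \<in> carrier (Edual I) \<Longrightarrow> koszul_coef R I x \<in> carrier R"
  using lin_maps_closed[OF koszul_coef_linear] by simp

lemma koszul_coef_add:
  "\<lbrakk>x \<in> carrier (Edual I); y \<in> carrier (Edual I)\<rbrakk> \<Longrightarrow>
    koszul_coef R I (x \<oplus>\<^bsub>Edual I\<^esub> y) = koszul_coef R I x \<oplus> koszul_coef R I y"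
  using lin_maps_add[OF koszul_coef_linear] by simp

lemma koszul_coef_smult:
  "\<lbrakk>r \<in> carrier R; x \<in> carrier (Edual I)\<rbrakk> \<Longrightarrow>
    koszul_coef R I (r \<odot>\<^bsub>Edual I\<^esub> x) = r \<otimes> koszul_coef R I x"
  using lin_maps_smult[OF koszul_coef_linear] by simp

lemma koszul_coef_zero: "koszul_coef R I \<zero>\<^bsub>Edual I\<^esub> = \<zero>"
  using lin_maps_zero[OF Edual_module self_module koszul_coef_linear] by simp

lemma koszul_coef_sorted_class: "finite I \<Longrightarrow> koszul_coef R I (sorted_class R I) = \<one>"
  by (simp add: sorted_class_def koszul_coef_order_class inversions_sorted)

lemma koszul_coef_smult_sorted_class:
  "\<lbrakk>finite I; r \<in> carrier R\<rbrakk> \<Longrightarrow> koszul_coef R I (r \<odot>\<^bsub>Edual I\<^esub> sorted_class R I) = r"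
  by (simp add: koszul_coef_smult sorted_class_closed koszul_coef_sorted_class)

lemma Edual_rank_one:
  assumes "finite I" and "x \<in> carrier (Edual I)"
  shows "x = koszul_coef R I x \<odot>\<^bsub>Edual I\<^esub> sorted_class R I"
proof (rule Edual_linear_eqI[OF Edual_module, where h = "\<lambda>x. x" and
      k = "\<lambda>x. koszul_coef R I x \<odot>\<^bsub>Edual I\<^esub> sorted_class R I"])
  interpret E: module R "Edual I" by (rule Edual_module)
  show "(\<lambda>x. x) \<in> lin_maps R (Edual I) (Edual I)" by (rule lin_maps_id)
  show "(\<lambda>x. koszul_coef R I x \<odot>\<^bsub>Edual I\<^esub> sorted_class R I) \<in> lin_maps R (Edual I) (Edual I)"
    using sorted_class_closed[OF assms(1)]
    by (intro lin_mapsI) (auto simp: koszul_coef_add koszul_coef_smult koszul_coef_closed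
        E.smult_l_distr E.smult_assoc1)
  show "order_class R I l = koszul_coef R I (order_class R I l) \<odot>\<^bsub>Edual I\<^esub> sorted_class R I"
    if "l \<in> permutations_of_set I" for l
    using that by (simp add: koszul_coef_order_class order_class_eq[symmetric])
qed fact

lemma Edual_eqI:
  assumes "finite I" "x \<in> carrier (Edual I)" "y \<in> carrier (Edual I)"
    and "koszul_coef R I x = koszul_coef R I y"
  shows "x = y"
  using assms Edual_rank_one by metis

lemma Edual_act:
  assumes "inj_on \<sigma> I"
  shows Edual_act_linear: "act (koszul_dual R) I \<sigma> \<in> lin_maps R (Edual I) (Edual (\<sigma> ` I))"
    and Edual_act_order_class: "l \<in> permutations_of_set I \<Longrightarrow>
      act (koszul_dual R) I \<sigma> (order_class R I l) = order_class R (\<sigma> ` I) (map \<sigma> l)"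
proof -
  have cl: "order_class R (\<sigma> ` I) (map \<sigma> l) \<in> carrier (Edual (\<sigma> ` I))"
    if "l \<in> permutations_of_set I" for l
    using map_in_permutations[OF assms that] by (rule order_class_closed)
  have swap: "order_class R (\<sigma> ` I) (map \<sigma> (us @ [i, j] @ vs)) \<oplus>\<^bsub>Edual (\<sigma> ` I)\<^esub>
      order_class R (\<sigma> ` I) (map \<sigma> (us @ [j, i] @ vs)) = \<zero>\<^bsub>Edual (\<sigma> ` I)\<^esub>"
    if "us @ [i, j] @ vs \<in> permutations_of_set I" for us i j vs
    using order_class_swap[of "map \<sigma> us" "\<sigma> i" "\<sigma> j" "map \<sigma> vs"] map_in_permutations[OF assms that]
    by simp
  have act: "act (koszul_dual R) I \<sigma>
      = pres_lift R (Edual (\<sigma> ` I)) (\<lambda>l. order_class R (\<sigma> ` I) (map \<sigma> l))"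
    by (simp add: koszul_dual_def)
  show "act (koszul_dual R) I \<sigma> \<in> lin_maps R (Edual I) (Edual (\<sigma> ` I))"
    unfolding act by (intro Edual_lift Edual_module cl swap)
  show "act (koszul_dual R) I \<sigma> (order_class R I l) = order_class R (\<sigma> ` I) (map \<sigma> l)"
    if "l \<in> permutations_of_set I"
    unfolding act
    by (rule Edual_lift(2)[where b = "\<lambda>l. order_class R (\<sigma> ` I) (map \<sigma> l)",
          OF Edual_module cl swap that])
qed

text \<open>A relabelling sends the class of the sorted list to the class of a list that is in general
  not sorted; the sign is the cost of sorting it.\<close>

lemma koszul_coef_act:
  assumes "finite I" "inj_on \<sigma> I" "x \<in> carrier (Edual I)"
  shows "koszul_coef R (\<sigma> ` I) (act (koszul_dual R) I \<sigma> x)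
    = sgn_pow (inversions (map \<sigma> (sorted_list_of_set I))) \<otimes> koszul_coef R I x"
proof -
  let ?l = "sorted_list_of_set I"
  have "koszul_coef R (\<sigma> ` I) (act (koszul_dual R) I \<sigma> x)
      = koszul_coef R (\<sigma> ` I) (act (koszul_dual R) I \<sigma> (koszul_coef R I x \<odot>\<^bsub>Edual I\<^esub> sorted_class R I))"
    using Edual_rank_one[OF assms(1,3)] by simp
  also have "\<dots> = koszul_coef R (\<sigma> ` I) (koszul_coef R I x \<odot>\<^bsub>Edual (\<sigma> ` I)\<^esub>
      act (koszul_dual R) I \<sigma> (order_class R I ?l))"
    using lin_maps_smult[OF Edual_act_linear[OF assms(2)] koszul_coef_closed[OF assms(3)]
        sorted_class_closed[OF assms(1)]] by (simp add: sorted_class_def)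
  also have "\<dots> = koszul_coef R I x \<otimes> sgn_pow (inversions (map \<sigma> ?l))"
    using assms by (simp add: Edual_act_order_class koszul_coef_smult koszul_coef_closed
        koszul_coef_order_class order_class_closed map_in_permutations)
  finally show ?thesis using koszul_coef_closed[OF assms(3)] by (simp add: m_comm)
qed

section \<open>The Koszul complex\<close>

context
  fixes X :: "('a, 'x) species"
  assumes X: "is_species R X"
begin

lemma species_module: "finite I \<Longrightarrow> module R (obj X I)"
  using X by (simp add: is_species_def)

lemma species_act_linear:
  "\<lbrakk>finite I; inj_on \<sigma> I\<rbrakk> \<Longrightarrow> act X I \<sigma> \<in> lin_maps R (obj X I) (obj X (\<sigma> ` I))"
  using X by (simp add: is_species_def)

lemma species_act_comp:
  "\<lbrakk>finite I; inj_on \<sigma> I; inj_on \<tau> (\<sigma> ` I); x \<in> carrier (obj X I)\<rbrakk> \<Longrightarrow>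
    act X I (\<tau> \<circ> \<sigma>) x = act X (\<sigma> ` I) \<tau> (act X I \<sigma> x)"
  using X unfolding is_species_def by blast

lemma species_act_cong:
  assumes "finite I" "inj_on \<sigma> I" "\<And>i. i \<in> I \<Longrightarrow> \<sigma> i = \<tau> i" "x \<in> carrier (obj X I)"
  shows "act X I \<sigma> x = act X I \<tau> x"
proof -
  have "\<forall>I \<sigma> \<tau> x. finite I \<and> inj_on \<sigma> I \<and> (\<forall>i\<in>I. \<sigma> i = \<tau> i) \<and> x \<in> carrier (obj X I) \<longrightarrow>
      act X I \<sigma> x = act X I \<tau> x"
    using X unfolding is_species_def by (elim conjE)
  then show ?thesis using assms by simp
qed

lemma species_act_id: "\<lbrakk>finite I; x \<in> carrier (obj X I)\<rbrakk> \<Longrightarrow> act X I id x = x"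
  using X by (simp add: is_species_def)

lemma species_act_std:
  assumes "finite I" "z \<in> carrier (obj X I)"
  shows "act X I (std I) z \<in> carrier (obj X {1..card I})"
  using lin_maps_closed[OF species_act_linear[OF assms(1) bij_betw_imp_inj_on[OF std_bij[OF assms(1)]]] assms(2)]
    bij_betw_imp_surj_on[OF std_bij[OF assms(1)]] by simp

lemma koszul_cochainsD:
  assumes "\<phi> \<in> carrier (koszul_cochains R X p)" and "finite I"
  shows cochain_linear: "\<phi> I \<in> lin_maps R (obj X I) (Edual I)"
    and cochain_natural: "\<lbrakk>inj_on \<sigma> I; z \<in> carrier (obj X I)\<rbrakk> \<Longrightarrow>
      \<phi> (\<sigma> ` I) (act X I \<sigma> z) = act (koszul_dual R) I \<sigma> (\<phi> I z)"
    and cochain_degree: "\<lbrakk>card I \<noteq> p; z \<in> carrier (obj X I)\<rbrakk> \<Longrightarrow> \<phi> I z = \<zero>\<^bsub>Edual I\<^esub>"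
  using assms by (auto simp: koszul_cochains_def is_species_morphism_def)

text \<open>Zero, sums, multiples, the cochain of an equivariant map and the cup product are all given by a
  formula that is restricted to the modules \<open>X[I]\<close>, so that one closure lemma serves for all.\<close>

lemma koszul_cochains_restrictI:
  assumes lin: "\<And>I. finite I \<Longrightarrow> \<phi> I \<in> lin_maps R (obj X I) (Edual I)"
    and nat: "\<And>I \<sigma> z. \<lbrakk>finite I; inj_on \<sigma> I; z \<in> carrier (obj X I)\<rbrakk> \<Longrightarrow>
      \<phi> (\<sigma> ` I) (act X I \<sigma> z) = act (koszul_dual R) I \<sigma> (\<phi> I z)"
    and deg: "\<And>I z. \<lbrakk>finite I; card I \<noteq> p; z \<in> carrier (obj X I)\<rbrakk> \<Longrightarrow> \<phi> I z = \<zero>\<^bsub>Edual I\<^esub>"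
  shows "(\<lambda>I\<in>{I. finite I}. \<lambda>z\<in>carrier (obj X I). \<phi> I z) \<in> carrier (koszul_cochains R X p)"
proof -
  have "(\<lambda>z\<in>carrier (obj X I). \<phi> I z) \<in> lin_maps R (obj X I) (Edual I)" if "finite I" for I
    by (rule lin_maps_cong[OF species_module[OF that] lin[OF that]]) simp
  moreover have "act X I \<sigma> z \<in> carrier (obj X (\<sigma> ` I))"
    if "finite I" "inj_on \<sigma> I" "z \<in> carrier (obj X I)" for I \<sigma> z
    using lin_maps_closed[OF species_act_linear] that by blast
  ultimately show ?thesis
    using nat deg by (auto simp: koszul_cochains_def is_species_morphism_def)
qed

lemma koszul_cochains_eqI:
  assumes "\<phi> \<in> carrier (koszul_cochains R X p)" "\<psi> \<in> carrier (koszul_cochains R X p)"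
    and "\<And>I z. \<lbrakk>finite I; z \<in> carrier (obj X I)\<rbrakk> \<Longrightarrow> \<phi> I z = \<psi> I z"
  shows "\<phi> = \<psi>"
proof (rule PiE_ext)
  have PiE: "\<chi> \<in> (\<Pi>\<^sub>E I\<in>{I. finite I}. extensional (carrier (obj X I)))"
    if "\<chi> \<in> carrier (koszul_cochains R X p)" for \<chi>
    using that by (simp add: koszul_cochains_def)
  show "\<phi> \<in> (\<Pi>\<^sub>E I\<in>{I. finite I}. extensional (carrier (obj X I)))"
    "\<psi> \<in> (\<Pi>\<^sub>E I\<in>{I. finite I}. extensional (carrier (obj X I)))"
    by (rule PiE[OF assms(1)], rule PiE[OF assms(2)])
  show "\<phi> I = \<psi> I" if I: "I \<in> {I. finite I}" for I
  proof (rule extensionalityI)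
    show "\<phi> I \<in> extensional (carrier (obj X I))" "\<psi> I \<in> extensional (carrier (obj X I))"
      by (rule PiE_mem[OF PiE[OF assms(1)] I], rule PiE_mem[OF PiE[OF assms(2)] I])
    show "\<phi> I z = \<psi> I z" if "z \<in> carrier (obj X I)" for z
      using assms(3)[OF _ that] I by simp
  qed
qed

lemma koszul_cochains_apply:
  assumes "finite I" "z \<in> carrier (obj X I)"
  shows "(\<phi> \<oplus>\<^bsub>koszul_cochains R X p\<^esub> \<psi>) I z = \<phi> I z \<oplus>\<^bsub>Edual I\<^esub> \<psi> I z"
    and "(r \<odot>\<^bsub>koszul_cochains R X p\<^esub> \<phi>) I z = r \<odot>\<^bsub>Edual I\<^esub> \<phi> I z"
    and "\<zero>\<^bsub>koszul_cochains R X p\<^esub> I z = \<zero>\<^bsub>Edual I\<^esub>"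
  using assms by (simp_all add: koszul_cochains_def)

lemma koszul_cochains_module: "module R (koszul_cochains R X p)"
proof -
  let ?C = "koszul_cochains R X p"
  note lin = cochain_linear lin_maps_closed[OF cochain_linear]
  have act: "act (koszul_dual R) I \<sigma> \<zero>\<^bsub>Edual I\<^esub> = \<zero>\<^bsub>Edual (\<sigma> ` I)\<^esub>" if "inj_on \<sigma> I" for I \<sigma>
    using lin_maps_zero[OF Edual_module Edual_module Edual_act_linear[OF that]] .
  have zero: "\<zero>\<^bsub>?C\<^esub> \<in> carrier ?C"
  proof -
    have "(\<lambda>I\<in>{I. finite I}. \<lambda>z\<in>carrier (obj X I). \<zero>\<^bsub>Edual I\<^esub>) \<in> carrier ?C"
    proof (rule koszul_cochains_restrictI)
      fix I :: "nat set"
      interpret E: module R "Edual I" by (rule Edual_module)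
      show "(\<lambda>z. \<zero>\<^bsub>Edual I\<^esub>) \<in> lin_maps R (obj X I) (Edual I)" by (rule lin_mapsI) auto
    qed (auto simp: act)
    then show ?thesis by (simp add: koszul_cochains_def)
  qed
  have add: "\<phi> \<oplus>\<^bsub>?C\<^esub> \<psi> \<in> carrier ?C" if \<phi>: "\<phi> \<in> carrier ?C" and \<psi>: "\<psi> \<in> carrier ?C" for \<phi> \<psi>
  proof -
    have "(\<lambda>I\<in>{I. finite I}. \<lambda>z\<in>carrier (obj X I). \<phi> I z \<oplus>\<^bsub>Edual I\<^esub> \<psi> I z) \<in> carrier ?C"
    proof (rule koszul_cochains_restrictI)
      fix I :: "nat set" assume I: "finite I"
      interpret E: module R "Edual I" by (rule Edual_module)
      note f = lin_mapsD[OF cochain_linear[OF \<phi> I]] and g = lin_mapsD[OF cochain_linear[OF \<psi> I]]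
      show "(\<lambda>z. \<phi> I z \<oplus>\<^bsub>Edual I\<^esub> \<psi> I z) \<in> lin_maps R (obj X I) (Edual I)"
        by (rule lin_mapsI) (auto simp: f g E.a_ac E.smult_r_distr)
      show "\<phi> (\<sigma> ` I) (act X I \<sigma> z) \<oplus>\<^bsub>Edual (\<sigma> ` I)\<^esub> \<psi> (\<sigma> ` I) (act X I \<sigma> z)
          = act (koszul_dual R) I \<sigma> (\<phi> I z \<oplus>\<^bsub>Edual I\<^esub> \<psi> I z)"
        if "inj_on \<sigma> I" "z \<in> carrier (obj X I)" for \<sigma> z
        using that I by (simp add: cochain_natural[OF \<phi>] cochain_natural[OF \<psi>] f g
            lin_maps_add[OF Edual_act_linear])
      show "\<phi> I z \<oplus>\<^bsub>Edual I\<^esub> \<psi> I z = \<zero>\<^bsub>Edual I\<^esub>" if "card I \<noteq> p" "z \<in> carrier (obj X I)" for z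
        using that I by (simp add: cochain_degree[OF \<phi>] cochain_degree[OF \<psi>])
    qed
    then show ?thesis by (simp add: koszul_cochains_def)
  qed
  have smult: "r \<odot>\<^bsub>?C\<^esub> \<phi> \<in> carrier ?C" if r: "r \<in> carrier R" and \<phi>: "\<phi> \<in> carrier ?C" for r \<phi>
  proof -
    have "(\<lambda>I\<in>{I. finite I}. \<lambda>z\<in>carrier (obj X I). r \<odot>\<^bsub>Edual I\<^esub> \<phi> I z) \<in> carrier ?C"
    proof (rule koszul_cochains_restrictI)
      fix I :: "nat set" assume I: "finite I"
      interpret E: module R "Edual I" by (rule Edual_module)
      note f = lin_mapsD[OF cochain_linear[OF \<phi> I]]
      show "(\<lambda>z. r \<odot>\<^bsub>Edual I\<^esub> \<phi> I z) \<in> lin_maps R (obj X I) (Edual I)"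
        using r by (intro lin_mapsI) (auto simp: f E.smult_r_distr E.smult_assoc1[symmetric] m_comm)
      show "r \<odot>\<^bsub>Edual (\<sigma> ` I)\<^esub> \<phi> (\<sigma> ` I) (act X I \<sigma> z)
          = act (koszul_dual R) I \<sigma> (r \<odot>\<^bsub>Edual I\<^esub> \<phi> I z)"
        if "inj_on \<sigma> I" "z \<in> carrier (obj X I)" for \<sigma> z
        using that I r by (simp add: cochain_natural[OF \<phi>] f lin_maps_smult[OF Edual_act_linear])
      show "r \<odot>\<^bsub>Edual I\<^esub> \<phi> I z = \<zero>\<^bsub>Edual I\<^esub>" if "card I \<noteq> p" "z \<in> carrier (obj X I)" for z
        using that I r by (simp add: cochain_degree[OF \<phi>])
    qed
    then show ?thesis by (simp add: koszul_cochains_def)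
  qed
  note E = module.axioms(2)[OF Edual_module]
  note G = abelian_group.axioms(1)[OF E]
  show ?thesis
    by (rule module_of_smult_zero; (rule is_cring zero add smult | rule koszul_cochains_eqI);
        (rule add smult zero | simp_all)?)
      (auto simp: koszul_cochains_apply lin abelian_monoid.a_assoc[OF G]
        abelian_monoid.a_comm[OF G] abelian_monoid.l_zero[OF G] module.smult_l_distr[OF Edual_module]
        module.smult_r_distr[OF Edual_module] module.smult_assoc1[OF Edual_module]
        module.smult_l_null[OF Edual_module] module.smult_one[OF Edual_module] add smult zero)
qed

text \<open>Standardization identifies \<open>I\<close> with \<open>{1..card I}\<close> in an order preserving way, so that it maps
  the class of the sorted list to the class of the sorted list. Naturality with respect to it
  recovers a cochain from its component at \<open>{1..p}\<close>.\<close>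

lemma koszul_cochain_standardize:
  assumes \<phi>: "\<phi> \<in> carrier (koszul_cochains R X p)" and I: "finite I" and z: "z \<in> carrier (obj X I)"
  shows "koszul_coef R I (\<phi> I z)
    = koszul_coef R {1..card I} (\<phi> {1..card I} (act X I (std I) z))"
proof -
  have inj: "inj_on (std I) I" and im: "std I ` I = {1..card I}"
    using std_bij[OF I] by (auto simp: bij_betw_def)
  have "inversions (map (std I) (sorted_list_of_set I)) = 0"
    by (simp add: map_std_sorted_list[OF I] inversions_sorted del: upt_Suc)
  then have "koszul_coef R {1..card I} (act (koszul_dual R) I (std I) (\<phi> I z)) = koszul_coef R I (\<phi> I z)"
    using koszul_coef_act[OF I inj, of "\<phi> I z"] lin_maps_closed[OF cochain_linear[OF \<phi> I] z]
    by (simp add: im koszul_coef_closed)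
  then show ?thesis using cochain_natural[OF \<phi> I inj z] by (simp add: im)
qed

lemma koszul_cochains_eqI_standard:
  assumes \<phi>: "\<phi> \<in> carrier (koszul_cochains R X p)" and \<psi>: "\<psi> \<in> carrier (koszul_cochains R X p)"
    and eq: "\<And>z. z \<in> carrier (obj X {1..p}) \<Longrightarrow> \<phi> {1..p} z = \<psi> {1..p} z"
  shows "\<phi> = \<psi>"
proof (rule koszul_cochains_eqI[OF \<phi> \<psi>])
  fix I z assume I: "finite I" and z: "z \<in> carrier (obj X I)"
  show "\<phi> I z = \<psi> I z"
  proof (cases "card I = p")
    case True
    then have "koszul_coef R I (\<phi> I z) = koszul_coef R I (\<psi> I z)"
      using koszul_cochain_standardize[OF \<phi> I z] koszul_cochain_standardize[OF \<psi> I z]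
        eq species_act_std[OF I z] by simp
    then show ?thesis
      using Edual_eqI[OF I] lin_maps_closed[OF cochain_linear[OF \<phi> I] z]
        lin_maps_closed[OF cochain_linear[OF \<psi> I] z] by blast
  next
    case False
    then show ?thesis using cochain_degree[OF \<phi> I _ z] cochain_degree[OF \<psi> I _ z] by simp
  qed
qed

lemma sgn_homsD:
  assumes "f \<in> sgn_homs R X p"
  shows "f \<in> lin_maps R (obj X {1..p}) (self_module R)"
    and "\<lbrakk>\<sigma> permutes {1..p}; z \<in> carrier (obj X {1..p})\<rbrakk> \<Longrightarrow> f (act X {1..p} \<sigma> z) = [sign \<sigma>] \<cdot>\<^bsub>R\<^esub> f z"
    and "z \<in> carrier (obj X {1..p}) \<Longrightarrow> f z \<in> carrier R"
  using assms by (auto simp: sgn_homs_def lin_maps_def Pi_def)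

text \<open>Relabelling along \<open>\<sigma>\<close> is, after standardization of source and target, the action of a
  permutation of \<open>{1..p}\<close>, whose sign is the parity of the inversions that \<open>\<sigma>\<close> creates. This is
  the sign by which \<open>\<sigma>\<close> acts on the classes of the sorted lists.\<close>

lemma sgn_hom_std_relabel:
  assumes f: "f \<in> sgn_homs R X p" and I: "finite I" "card I = p" and \<sigma>: "inj_on \<sigma> I"
    and z: "z \<in> carrier (obj X I)"
  shows "f (act X (\<sigma> ` I) (std (\<sigma> ` I)) (act X I \<sigma> z))
    = sgn_pow (inversions (map \<sigma> (sorted_list_of_set I))) \<otimes> f (act X I (std I) z)"
proof -
  let ?J = "\<sigma> ` I" and ?P = "{1..p}"
  have J: "finite ?J" "card ?J = p" using I \<sigma> by (auto simp: card_image)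
  have bI: "bij_betw (std I) I ?P" and bJ: "bij_betw (std ?J) ?J ?P"
    using std_bij[OF I(1)] std_bij[OF J(1)] by (simp_all only: I(2) J(2))
  have injI: "inj_on (std I) I" and imI: "std I ` I = ?P" using bI by (auto simp: bij_betw_def)
  (* The permutation that corresponds to \<sigma> under the two standardizations. *)
  define \<tau> where "\<tau> i = (if i \<in> ?P then std ?J (\<sigma> (inv_into I (std I) i)) else i)" for i
  have \<tau>: "\<tau> (std I i) = std ?J (\<sigma> i)" if "i \<in> I" for i
    using that injI imI by (auto simp: \<tau>_def)
  have "bij_betw (std ?J \<circ> \<sigma> \<circ> inv_into I (std I)) ?P ?P"
    using bij_betw_inv_into[OF bI] \<sigma> bJ by (auto intro!: bij_betw_trans simp: inj_on_imp_bij_betw)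
  then have "bij_betw \<tau> ?P ?P" by (rule iffD1[OF bij_betw_cong, rotated]) (simp add: \<tau>_def)
  then have perm: "\<tau> permutes ?P" by (rule bij_imp_permutes) (auto simp: \<tau>_def)
  have "[1..<Suc p] = map (std I) (sorted_list_of_set I)"
    using map_std_sorted_list[OF I(1)] by (simp only: I(2))
  then have l: "map \<tau> [1..<Suc p] = map (std ?J) (map \<sigma> (sorted_list_of_set I))"
    using I(1) \<tau> by (simp del: upt_Suc)
  have "(- 1 :: int) ^ inversions (map \<tau> [1..<Suc p]) = sign \<tau> * (- 1) ^ inversions [1..<Suc p]"
    using perm by (intro sign_eq_inversions) (simp_all add: atLeastLessThanSuc_atLeastAtMost del: upt_Suc)
  then have sign: "sign \<tau> = (- 1) ^ inversions (map \<sigma> (sorted_list_of_set I))"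
    using inversions_map_strict_mono[of "map \<sigma> (sorted_list_of_set I)" "std ?J"] std_strict_mono[OF J(1)] I(1)
    by (simp add: l inversions_sorted del: upt_Suc map_map)
  have inj_comp: "inj_on (std ?J \<circ> \<sigma>) I"
    using \<sigma> bJ by (auto intro: comp_inj_on simp: bij_betw_def)
  have "act X ?J (std ?J) (act X I \<sigma> z) = act X I (std ?J \<circ> \<sigma>) z"
    using species_act_comp[OF I(1) \<sigma> _ z, of "std ?J"] bJ by (simp add: bij_betw_def)
  also have "\<dots> = act X I (\<tau> \<circ> std I) z"
    by (rule species_act_cong[OF I(1) inj_comp _ z]) (simp add: \<tau>)
  also have "\<dots> = act X ?P \<tau> (act X I (std I) z)"
    using species_act_comp[OF I(1) injI _ z, of \<tau>] permutes_inj_on[OF perm] by (simp add: imI)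
  finally show ?thesis
    using sgn_homsD[OF f] perm species_act_std[OF I(1) z] I(2) sign
    by (simp add: add_pow_minus_one_power)
qed

text \<open>The value on \<open>I\<close> is transported from \<open>{1..p}\<close> by standardization, which carries the class of
  the sorted list to the class of the sorted list without a sign.\<close>

definition cochain_of_hom :: "nat \<Rightarrow> ('x \<Rightarrow> 'a) \<Rightarrow> nat set \<Rightarrow> 'x \<Rightarrow> (nat list \<Rightarrow> 'a) set" where
  "cochain_of_hom p f = (\<lambda>I\<in>{I. finite I}. \<lambda>z\<in>carrier (obj X I).
     if card I = p then (sgn_pow p \<otimes> f (act X I (std I) z)) \<odot>\<^bsub>Edual I\<^esub> sorted_class R I
     else \<zero>\<^bsub>Edual I\<^esub>)"

lemma cochain_of_hom_closed:
  assumes f: "f \<in> sgn_homs R X p"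
  shows "cochain_of_hom p f \<in> carrier (koszul_cochains R X p)"
  unfolding cochain_of_hom_def
proof (rule koszul_cochains_restrictI)
  fix I :: "nat set" assume I: "finite I"
  interpret E: module R "Edual I" by (rule Edual_module)
  interpret XI: module R "obj X I" by (rule species_module[OF I])
  have inj: "inj_on (std I) I" and im: "std I ` I = {1..card I}"
    using std_bij[OF I] by (auto simp: bij_betw_def)
  note a = lin_mapsD[OF species_act_linear[OF I inj], unfolded im]
  note g = lin_mapsD[OF sgn_homsD(1)[OF f], simplified]
  note e = sorted_class_closed[OF I]
  show "(\<lambda>z. if card I = p then (sgn_pow p \<otimes> f (act X I (std I) z)) \<odot>\<^bsub>Edual I\<^esub> sorted_class R I
      else \<zero>\<^bsub>Edual I\<^esub>) \<in> lin_maps R (obj X I) (Edual I)"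
  proof (cases "card I = p")
    case True
    note a = a[unfolded True]
    show ?thesis
      using True e by (intro lin_mapsI)
        (simp_all add: a g r_distr E.smult_l_distr E.smult_assoc1[symmetric] m_lcomm)
  next
    case False
    then show ?thesis by (intro lin_mapsI) simp_all
  qed
  show "(if card (\<sigma> ` I) = p then (sgn_pow p \<otimes> f (act X (\<sigma> ` I) (std (\<sigma> ` I)) (act X I \<sigma> z)))
        \<odot>\<^bsub>Edual (\<sigma> ` I)\<^esub> sorted_class R (\<sigma> ` I) else \<zero>\<^bsub>Edual (\<sigma> ` I)\<^esub>)
      = act (koszul_dual R) I \<sigma> (if card I = p then (sgn_pow p \<otimes> f (act X I (std I) z))
        \<odot>\<^bsub>Edual I\<^esub> sorted_class R I else \<zero>\<^bsub>Edual I\<^esub>)"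
    if \<sigma>: "inj_on \<sigma> I" and z: "z \<in> carrier (obj X I)" for \<sigma> z
  proof (cases "card I = p")
    case True
    interpret E': module R "Edual (\<sigma> ` I)" by (rule Edual_module)
    let ?n = "inversions (map \<sigma> (sorted_list_of_set I))"
    have fz: "f (act X I (std I) z) \<in> carrier R"
      using sgn_homsD(3)[OF f] species_act_std[OF I z] True by simp
    have "act (koszul_dual R) I \<sigma> (sorted_class R I) = sgn_pow ?n \<odot>\<^bsub>Edual (\<sigma> ` I)\<^esub> sorted_class R (\<sigma> ` I)"
      using I \<sigma> by (simp add: sorted_class_def Edual_act_order_class order_class_eq[OF map_in_permutations])
    then show ?thesis
      using True \<sigma> fz e sorted_class_closed[of "\<sigma> ` I"] I
      by (simp add: card_image sgn_hom_std_relabel[OF f I True \<sigma> z]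
          lin_maps_smult[OF Edual_act_linear[OF \<sigma>]] E'.smult_assoc1[symmetric] m_ac)
  next
    case False
    then show ?thesis
      using \<sigma> lin_maps_zero[OF Edual_module Edual_module Edual_act_linear[OF \<sigma>]]
      by (simp add: card_image)
  qed
qed simp

lemma std_initial_segment: "i \<in> {1..p} \<Longrightarrow> std {1..p} i = i"
proof -
  have "sorted_list_of_set {1..p} = [1..<Suc p]"
    by (metis atLeastLessThanSuc_atLeastAtMost sorted_list_of_set_range)
  then have "map (std {1..p}) [1..<Suc p] = map id [1..<Suc p]"
    using map_std_sorted_list[of "{1..p}"] by simp
  then have "\<forall>x\<in>set [1..<Suc p]. std {1..p} x = id x" by (simp only: map_eq_conv)
  then show "i \<in> {1..p} \<Longrightarrow> std {1..p} i = i" by auto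
qed

lemma sorted_class_initial_segment: "sorted_class R {1..p} = order_class R {1..p} [1..<Suc p]"
  by (metis sorted_class_def atLeastLessThanSuc_atLeastAtMost sorted_list_of_set_range)

lemma cochain_of_hom_standard:
  assumes "f \<in> sgn_homs R X p" "z \<in> carrier (obj X {1..p})"
  shows "cochain_of_hom p f {1..p} z = (sgn_pow p \<otimes> f z) \<odot>\<^bsub>Edual {1..p}\<^esub> sorted_class R {1..p}"
proof -
  have "act X {1..p} (std {1..p}) z = act X {1..p} id z"
    using assms(2) bij_betw_imp_inj_on[OF std_bij[of "{1..p}"]] std_initial_segment
    by (intro species_act_cong) auto
  then show ?thesis using assms species_act_id by (simp add: cochain_of_hom_def)
qed

lemma koszul_of_hom_eq:
  assumes f: "f \<in> sgn_homs R X p"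
  shows "koszul_of_hom R X p f = cochain_of_hom p f"
  unfolding koszul_of_hom_def
proof (rule the_equality)
  show "cochain_of_hom p f \<in> carrier (koszul_cochains R X p) \<and>
      (\<forall>z\<in>carrier (obj X {1..p}). cochain_of_hom p f {1..p} z
        = (sgn_pow p \<otimes> f z) \<odot>\<^bsub>Edual {1..p}\<^esub> order_class R {1..p} [1..<Suc p])"
    using cochain_of_hom_closed[OF f] cochain_of_hom_standard[OF f]
    by (simp add: sorted_class_initial_segment del: upt_Suc)
  then show "\<phi> = cochain_of_hom p f" if "\<phi> \<in> carrier (koszul_cochains R X p) \<and>
      (\<forall>z\<in>carrier (obj X {1..p}). \<phi> {1..p} z
        = (sgn_pow p \<otimes> f z) \<odot>\<^bsub>Edual {1..p}\<^esub> order_class R {1..p} [1..<Suc p])" for \<phi>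
    using that by (intro koszul_cochains_eqI_standard) auto
qed

lemma koszul_of_hom_closed:
  "f \<in> sgn_homs R X p \<Longrightarrow> koszul_of_hom R X p f \<in> carrier (koszul_cochains R X p)"
  by (simp add: koszul_of_hom_eq cochain_of_hom_closed)

lemma koszul_coef_koszul_of_hom:
  assumes "f \<in> sgn_homs R X p" "finite I" "card I = p" "z \<in> carrier (obj X I)"
  shows "koszul_coef R I (koszul_of_hom R X p f I z) = sgn_pow p \<otimes> f (act X I (std I) z)"
  using assms sgn_homsD(3)[OF assms(1)] species_act_std[OF assms(2,4)]
  by (simp add: koszul_of_hom_eq cochain_of_hom_def koszul_coef_smult_sorted_class)

lemma koszul_coef_koszul_of_hom_standard:
  assumes "f \<in> sgn_homs R X p" "z \<in> carrier (obj X {1..p})"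
  shows "koszul_coef R {1..p} (koszul_of_hom R X p f {1..p} z) = sgn_pow p \<otimes> f z"
  using assms sgn_homsD(3)[OF assms(1)]
  by (simp add: koszul_of_hom_eq cochain_of_hom_standard koszul_coef_smult_sorted_class)

text \<open>The equivariant map of a cochain \<open>\<phi>\<close> is the coordinate of \<open>\<phi>\<close> at \<open>{1..p}\<close>, corrected by
  \<open>(-1)^p\<close>, which is its own inverse. Cancelling the generator of \<open>E![p]\<close> is what makes the
  correspondence injective.\<close>

lemma koszul_of_hom_bij:
  "bij_betw (koszul_of_hom R X p) (sgn_homs R X p) (carrier (koszul_cochains R X p))"
proof (rule bij_betwI')
  let ?P = "{1..p}"
  fix f g assume f: "f \<in> sgn_homs R X p" and g: "g \<in> sgn_homs R X p"
  show "koszul_of_hom R X p f = koszul_of_hom R X p g \<longleftrightarrow> f = g"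
  proof
    assume eq: "koszul_of_hom R X p f = koszul_of_hom R X p g"
    show "f = g"
    proof (rule extensionalityI)
      show "f \<in> extensional (carrier (obj X ?P))" "g \<in> extensional (carrier (obj X ?P))"
        using f g by (auto simp: sgn_homs_def)
      fix z assume z: "z \<in> carrier (obj X ?P)"
      have "sgn_pow p \<otimes> f z = sgn_pow p \<otimes> g z"
        using koszul_coef_koszul_of_hom_standard[OF f z] koszul_coef_koszul_of_hom_standard[OF g z] eq
        by simp
      then show "f z = g z"
        using sgn_homsD(3)[OF f z] sgn_homsD(3)[OF g z] by (metis sgn_pow_cancel)
    qed
  qed simp
next
  fix f assume "f \<in> sgn_homs R X p"
  then show "koszul_of_hom R X p f \<in> carrier (koszul_cochains R X p)" by (rule koszul_of_hom_closed)
next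
  let ?P = "{1..p}"
  fix \<phi> assume \<phi>: "\<phi> \<in> carrier (koszul_cochains R X p)"
  define f where "f = (\<lambda>z\<in>carrier (obj X ?P). sgn_pow p \<otimes> koszul_coef R ?P (\<phi> ?P z))"
  interpret XP: module R "obj X ?P" by (rule species_module) simp
  have \<phi>P: "\<phi> ?P \<in> lin_maps R (obj X ?P) (Edual ?P)" using cochain_linear[OF \<phi>] by simp
  note a = lin_mapsD[OF \<phi>P]
  have c: "koszul_coef R ?P (\<phi> ?P z) \<in> carrier R" if "z \<in> carrier (obj X ?P)" for z
    by (rule koszul_coef_closed[OF a(1)[OF that]])
  have "f \<in> lin_maps R (obj X ?P) (self_module R)"
    by (rule lin_mapsI) (simp_all add: a c f_def koszul_coef_add koszul_coef_smult r_distr m_lcomm)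
  moreover have "f (act X ?P \<sigma> z) = [sign \<sigma>] \<cdot>\<^bsub>R\<^esub> f z"
    if \<sigma>: "\<sigma> permutes ?P" and z: "z \<in> carrier (obj X ?P)" for \<sigma> z
  proof -
    let ?l = "[1..<Suc p]"
    have inj: "inj_on \<sigma> ?P" and im: "\<sigma> ` ?P = ?P"
      using permutes_inj_on[OF \<sigma>] permutes_image[OF \<sigma>] by auto
    have act: "act X ?P \<sigma> z \<in> carrier (obj X ?P)"
      using lin_maps_closed[OF species_act_linear[of ?P, OF _ inj] z] im by simp
    have "(- 1 :: int) ^ inversions (map \<sigma> ?l) = sign \<sigma> * (- 1) ^ inversions ?l"
      using \<sigma> by (intro sign_eq_inversions) (simp_all add: atLeastLessThanSuc_atLeastAtMost del: upt_Suc)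
    then have sign: "sign \<sigma> = (- 1) ^ inversions (map \<sigma> ?l)"
      by (simp add: inversions_sorted del: upt_Suc)
    have "sorted_list_of_set ?P = ?l"
      by (metis atLeastLessThanSuc_atLeastAtMost sorted_list_of_set_range)
    then have "koszul_coef R ?P (\<phi> ?P (act X ?P \<sigma> z))
        = sgn_pow (inversions (map \<sigma> ?l)) \<otimes> koszul_coef R ?P (\<phi> ?P z)"
      using koszul_coef_act[OF _ inj, of "\<phi> ?P z"] cochain_natural[OF \<phi> _ inj z] a(1)[OF z] im by simp
    then show ?thesis
      using z act c[OF z] by (simp add: f_def sign add_pow_minus_one_power m_lcomm del: upt_Suc)
  qed
  ultimately have f: "f \<in> sgn_homs R X p" by (simp add: sgn_homs_def f_def)
  have "koszul_of_hom R X p f = \<phi>"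
  proof (rule koszul_cochains_eqI_standard[OF koszul_of_hom_closed[OF f] \<phi>])
    fix z assume z: "z \<in> carrier (obj X ?P)"
    have "koszul_coef R ?P (koszul_of_hom R X p f ?P z) = koszul_coef R ?P (\<phi> ?P z)"
      using koszul_coef_koszul_of_hom_standard[OF f z] z c by (simp add: f_def)
    then show "koszul_of_hom R X p f ?P z = \<phi> ?P z"
      using lin_maps_closed[OF cochain_linear[OF koszul_of_hom_closed[OF f]] z] a(1)[OF z]
      by (intro Edual_eqI) simp_all
  qed
  then show "\<exists>f\<in>sgn_homs R X p. \<phi> = koszul_of_hom R X p f" using f by auto
qed

end

end

section \<open>The cup product\<close>

(* From here on membership in a free module is used only through linearity and generators. *)
declare free_module_simps(1) [simp del]

context cring
begin

lemma koszul_coef_finsum: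
  assumes "finite A" and "\<And>a. a \<in> A \<Longrightarrow> f a \<in> carrier (Edual I)"
  shows "koszul_coef R I (\<Oplus>\<^bsub>Edual I\<^esub>a\<in>A. f a) = (\<Oplus>a\<in>A. koszul_coef R I (f a))"
  using assms
proof (induction A rule: finite_induct)
  case empty
  interpret E: module R "Edual I" by (rule Edual_module)
  show ?case by (simp add: koszul_coef_zero)
next
  case (insert a A)
  interpret E: module R "Edual I" by (rule Edual_module)
  have "f \<in> A \<rightarrow> carrier (Edual I)" "(\<lambda>a. koszul_coef R I (f a)) \<in> A \<rightarrow> carrier R"
    using insert.prems koszul_coef_closed by auto
  then show ?case using insert by (simp add: koszul_coef_add koszul_coef_closed)
qed

text \<open>In the coordinates of the sorted classes, the product of \<open>E!\<close> is the product of \<open>R\<close> up to the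
  sign of the shuffle that sorts the concatenation of the sorted lists of \<open>S\<close> and \<open>T\<close>; its
  inversions are the pairs counted by \<open>sch S T\<close>.\<close>

lemma koszul_concat_eq:
  assumes I: "finite I" and d: "(S, T) \<in> decomps I"
    and x: "x \<in> carrier (Edual S)" and y: "y \<in> carrier (Edual T)"
  shows "koszul_concat R I x y
    = (sgn_pow (sch S T) \<otimes> (koszul_coef R S x \<otimes> koszul_coef R T y)) \<odot>\<^bsub>Edual I\<^esub> sorted_class R I"
proof -
  interpret E: module R "Edual I" by (rule Edual_module)
  have S: "finite S" and T: "finite T" using I d by (auto simp: decomps_def)
  let ?s = "sorted_list_of_set S" and ?t = "sorted_list_of_set T"
  let ?b = "koszul_coef R T y"
  note app = append_in_permutations[OF d]
  define inner where "inner l = pres_lift R (Edual I) (\<lambda>l'. order_class R I (l @ l'))" for l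
  have inner: "inner l y = ?b \<odot>\<^bsub>Edual I\<^esub> order_class R I (l @ ?t)" if l: "l \<in> permutations_of_set S" for l
  proof -
    have swap: "order_class R I (l @ us @ [i, j] @ vs) \<oplus>\<^bsub>Edual I\<^esub> order_class R I (l @ us @ [j, i] @ vs)
        = \<zero>\<^bsub>Edual I\<^esub>" if "us @ [i, j] @ vs \<in> permutations_of_set T" for us i j vs
      using order_class_swap[of "l @ us" i j vs] app[OF l that] by simp
    note lift = Edual_lift[where b = "\<lambda>l'. order_class R I (l @ l')" and I = T,
        OF Edual_module order_class_closed[OF app[OF l]] swap]
    have lin: "inner l \<in> lin_maps R (Edual T) (Edual I)" unfolding inner_def by (rule lift(1))
    have "inner l y = inner l (?b \<odot>\<^bsub>Edual T\<^esub> sorted_class R T)"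
      using Edual_rank_one[OF T y] by simp
    also have "\<dots> = ?b \<odot>\<^bsub>Edual I\<^esub> inner l (order_class R T ?t)"
      using lin_maps_smult[OF lin koszul_coef_closed[OF y] sorted_class_closed[OF T]]
      by (simp add: sorted_class_def)
    also have "inner l (order_class R T ?t) = order_class R I (l @ ?t)"
      unfolding inner_def by (rule lift(2)) (use T in simp_all)
    finally show ?thesis .
  qed
  have cl: "inner l y \<in> carrier (Edual I)" if "l \<in> permutations_of_set S" for l
    using that T koszul_coef_closed[OF y] by (simp add: inner order_class_closed app)
  have swap: "inner (us @ [i, j] @ vs) y \<oplus>\<^bsub>Edual I\<^esub> inner (us @ [j, i] @ vs) y = \<zero>\<^bsub>Edual I\<^esub>"
    if l: "us @ [i, j] @ vs \<in> permutations_of_set S" for us i j vs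
  proof -
    have l': "us @ [j, i] @ vs \<in> permutations_of_set S" using l by (rule permutations_of_set_swap)
    have "inner (us @ [i, j] @ vs) y \<oplus>\<^bsub>Edual I\<^esub> inner (us @ [j, i] @ vs) y
        = ?b \<odot>\<^bsub>Edual I\<^esub> (order_class R I ((us @ [i, j] @ vs) @ ?t)
          \<oplus>\<^bsub>Edual I\<^esub> order_class R I ((us @ [j, i] @ vs) @ ?t))"
      using T koszul_coef_closed[OF y] inner[OF l] inner[OF l']
        order_class_closed[OF app[OF l, of ?t]] order_class_closed[OF app[OF l', of ?t]]
      by (simp add: E.smult_r_distr)
    also have "order_class R I ((us @ [i, j] @ vs) @ ?t) \<oplus>\<^bsub>Edual I\<^esub> order_class R I ((us @ [j, i] @ vs) @ ?t)
        = \<zero>\<^bsub>Edual I\<^esub>"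
      using order_class_swap[of us i j "vs @ ?t"] app[OF l, of ?t] T by simp
    finally show ?thesis using koszul_coef_closed[OF y] by simp
  qed
  note lift = Edual_lift[where b = "\<lambda>l. inner l y" and I = S, OF Edual_module cl swap]
  have concat: "koszul_concat R I z y = pres_lift R (Edual I) (\<lambda>l. inner l y) z" for z
    by (simp add: koszul_concat_def inner_def)
  have lin: "(\<lambda>z. koszul_concat R I z y) \<in> lin_maps R (Edual S) (Edual I)"
    unfolding concat by (rule lift(1))
  have "koszul_concat R I x y = koszul_concat R I (koszul_coef R S x \<odot>\<^bsub>Edual S\<^esub> sorted_class R S) y"
    using Edual_rank_one[OF S x] by simp
  also have "\<dots> = koszul_coef R S x \<odot>\<^bsub>Edual I\<^esub> koszul_concat R I (order_class R S ?s) y"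
    using lin_maps_smult[OF lin koszul_coef_closed[OF x] sorted_class_closed[OF S]]
    by (simp add: sorted_class_def)
  also have "koszul_concat R I (order_class R S ?s) y = ?b \<odot>\<^bsub>Edual I\<^esub> order_class R I (?s @ ?t)"
    unfolding concat using lift(2)[where l = ?s] inner[of ?s] S by simp
  also have "order_class R I (?s @ ?t) = sgn_pow (sch S T) \<odot>\<^bsub>Edual I\<^esub> sorted_class R I"
    using S T app[of ?s ?t]
    by (simp add: order_class_eq inversions_append inversions_sorted cross_inversions_sch)
  finally show ?thesis
    using koszul_coef_closed[OF x] koszul_coef_closed[OF y] sorted_class_closed[OF I]
    by (simp add: E.smult_assoc1[symmetric] m_ac)
qed

lemma koszul_concat_bilinear:
  assumes "finite I" and "(S, T) \<in> decomps I"
  shows "koszul_concat R I \<in> bilin_maps R (Edual S) (Edual T) (Edual I)"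
proof -
  interpret E: module R "Edual I" by (rule Edual_module)
  interpret S: module R "Edual S" by (rule Edual_module)
  interpret T: module R "Edual T" by (rule Edual_module)
  show ?thesis
    using sorted_class_closed[OF assms(1)]
    by (intro bilin_mapsI)
      (simp_all add: koszul_concat_eq[OF assms] koszul_coef_closed koszul_coef_add koszul_coef_smult
        l_distr r_distr E.smult_l_distr E.smult_assoc1[symmetric] m_ac)
qed

lemma koszul_coef_concat:
  assumes "finite I" and "(S, T) \<in> decomps I"
    and "x \<in> carrier (Edual S)" and "y \<in> carrier (Edual T)"
  shows "koszul_coef R I (koszul_concat R I x y)
    = sgn_pow (sch S T) \<otimes> (koszul_coef R S x \<otimes> koszul_coef R T y)"
  using assms by (simp add: koszul_concat_eq koszul_coef_smult_sorted_class koszul_coef_closed)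

text \<open>Both sides are the sign of \<open>\<sigma>\<close> applied to the concatenation of the sorted lists of \<open>S\<close> and
  \<open>T\<close>: on the left the concatenation is sorted before \<open>\<sigma>\<close> is applied, on the right after.\<close>

lemma sgn_pow_relabel_shuffle:
  assumes I: "finite I" and \<sigma>: "inj_on \<sigma> I" and d: "(S, T) \<in> decomps I"
  shows "sgn_pow (inversions (map \<sigma> (sorted_list_of_set I))) \<otimes> sgn_pow (sch S T)
    = sgn_pow (sch (\<sigma> ` S) (\<sigma> ` T)) \<otimes>
      (sgn_pow (inversions (map \<sigma> (sorted_list_of_set S))) \<otimes>
       sgn_pow (inversions (map \<sigma> (sorted_list_of_set T))))"
proof -
  have S: "finite S" and T: "finite T" and inj: "inj_on \<sigma> S" "inj_on \<sigma> T"
    using I d \<sigma> by (auto simp: decomps_def inj_on_def)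
  let ?s = "sorted_list_of_set S" and ?t = "sorted_list_of_set T"
  have l: "?s @ ?t \<in> permutations_of_set I" using append_in_permutations[OF d] S T by simp
  have "sgn_pow (inversions (map \<sigma> (sorted_list_of_set I))) \<otimes> sgn_pow (sch S T)
      = koszul_coef R (\<sigma> ` I) (act (koszul_dual R) I \<sigma> (order_class R I (?s @ ?t)))"
    using koszul_coef_act[OF I \<sigma> order_class_closed[OF l]] S T
    by (simp add: koszul_coef_order_class[OF l] inversions_append inversions_sorted cross_inversions_sch)
  also have "\<dots> = sgn_pow (inversions (map \<sigma> ?s @ map \<sigma> ?t))"
    using koszul_coef_order_class[OF map_in_permutations[OF \<sigma> l]]
    by (simp add: Edual_act_order_class[OF \<sigma> l])
  also have "\<dots> = sgn_pow (sch (\<sigma> ` S) (\<sigma> ` T)) \<otimes>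
      (sgn_pow (inversions (map \<sigma> ?s)) \<otimes> sgn_pow (inversions (map \<sigma> ?t)))"
    using S T inj by (simp add: inversions_append sgn_pow_add cross_inversions_sch distinct_map m_ac)
  finally show ?thesis .
qed

end

context linearized_exp_bicomodule
begin

text \<open>The diagonal is a linear extension into a direct sum; projecting to one summand keeps it
  linear, and its values on basis elements are read off there.\<close>

lemma diagonal_component:
  assumes I: "finite I" and d: "(S, T) \<in> decomps I"
  shows "(\<lambda>z. diagonal R P lres rres I z (S, T)) \<in> lin_maps R (free_module R (elts P I))
      (tensor R (free_module R (elts P S)) (free_module R (elts P T)))"
    and "x \<in> elts P I \<Longrightarrow> diagonal R P lres rres I (gen R x) (S, T)
      = pure_tensor R (free_module R (elts P S)) (free_module R (elts P T))
          (gen R (rres I S x)) (gen R (lres I T x))"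
proof -
  let ?M = "\<lambda>(S, T). tensor R (free_module R (elts P S)) (free_module R (elts P T))"
  let ?b = "\<lambda>z. \<lambda>(S, T)\<in>decomps I. pure_tensor R (free_module R (elts P S)) (free_module R (elts P T))
    (gen R (rres I S z)) (gen R (lres I T z))"
  have sum: "module R (direct_sum (decomps I) ?M)"
    by (rule direct_sum_module) (auto intro: tensor_module free_module)
  have diag: "diagonal R P lres rres I = lin_ext R (direct_sum (decomps I) ?M) ?b"
    by (simp add: diagonal_def cauchy_def)
  have b: "?b z \<in> carrier (direct_sum (decomps I) ?M)" if z: "z \<in> elts P I" for z
  proof -
    have "pure_tensor R (free_module R (elts P S)) (free_module R (elts P T))
        (gen R (rres I S z)) (gen R (lres I T z)) \<in> carrier (?M (S, T))"
      if "(S, T) \<in> decomps I" for S T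
      using pure_tensor_closed[OF free_module free_module gen_closed[OF rres_closed[OF I that z]]
          gen_closed[OF lres_closed[OF I that z]]] by simp
    then show ?thesis by (auto simp: direct_sum_def)
  qed
  have "(\<lambda>z. diagonal R P lres rres I z (S, T)) \<in> lin_maps R (free_module R (elts P I)) (?M (S, T))"
    unfolding diag by (rule lin_maps_comp[OF lin_ext_linear[OF sum b] direct_sum_component[OF d]])
  then show "(\<lambda>z. diagonal R P lres rres I z (S, T)) \<in> lin_maps R (free_module R (elts P I))
      (tensor R (free_module R (elts P S)) (free_module R (elts P T)))" by simp
  show "diagonal R P lres rres I (gen R x) (S, T)
      = pure_tensor R (free_module R (elts P S)) (free_module R (elts P T))
          (gen R (rres I S x)) (gen R (lres I T x))" if "x \<in> elts P I"
    using lin_ext_gen[where b = ?b, OF sum b[OF that]] d by (simp add: diag)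
qed

text \<open>The cup product before its restriction to the modules \<open>X[I]\<close>; as a composite of linear maps
  it is linear in \<open>z\<close>, so it is determined by its values on basis elements.\<close>

definition cup_map ::
    "(nat set \<Rightarrow> ('a \<Rightarrow> 'r) \<Rightarrow> (nat list \<Rightarrow> 'r) set) \<Rightarrow> (nat set \<Rightarrow> ('a \<Rightarrow> 'r) \<Rightarrow> (nat list \<Rightarrow> 'r) set)
      \<Rightarrow> nat set \<Rightarrow> ('a \<Rightarrow> 'r) \<Rightarrow> (nat list \<Rightarrow> 'r) set" where
  "cup_map \<phi> \<psi> I z = koszul_mult R I
     (cauchy_map R (koszul_dual R) (koszul_dual R) \<phi> \<psi> I (diagonal R P lres rres I z))"

lemma koszul_cup_eq:
  "koszul_cup R P lres rres \<phi> \<psi>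
    = (\<lambda>I\<in>{I. finite I}. \<lambda>z\<in>carrier (obj (lin_species R P) I). cup_map \<phi> \<psi> I z)"
  by (simp add: koszul_cup_def cup_map_def)

lemma koszul_cup_apply:
  "\<lbrakk>finite I; z \<in> carrier (free_module R (elts P I))\<rbrakk> \<Longrightarrow>
    koszul_cup R P lres rres \<phi> \<psi> I z = cup_map \<phi> \<psi> I z"
  by (simp add: koszul_cup_eq)

definition cup_term ::
    "(nat set \<Rightarrow> ('a \<Rightarrow> 'r) \<Rightarrow> (nat list \<Rightarrow> 'r) set) \<Rightarrow> (nat set \<Rightarrow> ('a \<Rightarrow> 'r) \<Rightarrow> (nat list \<Rightarrow> 'r) set)
      \<Rightarrow> nat set \<Rightarrow> 'a \<Rightarrow> nat set \<times> nat set \<Rightarrow> 'r" where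
  "cup_term \<phi> \<psi> I x = (\<lambda>(S, T). sgn_pow (sch S T) \<otimes> (koszul_coef R S (\<phi> S (gen R (rres I S x)))
        \<otimes> koszul_coef R T (\<psi> T (gen R (lres I T x)))))"

text \<open>Each decomposition contributes a composite of linear maps, which sends a basis element to the
  product in \<open>E!\<close> of the two cochains at the restrictions.\<close>

lemma cup_map_expand:
  assumes \<phi>: "\<And>S. finite S \<Longrightarrow> \<phi> S \<in> lin_maps R (free_module R (elts P S)) (Edual S)"
    and \<psi>: "\<And>T. finite T \<Longrightarrow> \<psi> T \<in> lin_maps R (free_module R (elts P T)) (Edual T)"
    and I: "finite I"
  shows cup_map_linear: "cup_map \<phi> \<psi> I \<in> lin_maps R (free_module R (elts P I)) (Edual I)"
    and cup_map_gen: "x \<in> elts P I \<Longrightarrow> koszul_coef R I (cup_map \<phi> \<psi> I (gen R x)) =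
      (\<Oplus>d\<in>decomps I. cup_term \<phi> \<psi> I x d)"
proof -
  let ?F = "\<lambda>I. free_module R (elts P I)"
  let ?h = "\<lambda>d z. tensor_lift R (Edual I) (koszul_concat R I)
    (tensor_map R (Edual (fst d)) (Edual (snd d)) (\<phi> (fst d)) (\<psi> (snd d)) (diagonal R P lres rres I z d))"
  interpret E: module R "Edual I" by (rule Edual_module)
  have fin: "finite S" "finite T" if "(S, T) \<in> decomps I" for S T
    using that I by (auto simp: decomps_def)
  have h: "?h (S, T) \<in> lin_maps R (?F I) (Edual I)"
    and hx: "x \<in> elts P I \<Longrightarrow> ?h (S, T) (gen R x)
      = koszul_concat R I (\<phi> S (gen R (rres I S x))) (\<psi> T (gen R (lres I T x)))"
    if d: "(S, T) \<in> decomps I" for S T x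
  proof -
    note tm = tensor_map[OF free_module free_module Edual_module Edual_module
        \<phi>[OF fin(1)[OF d]] \<psi>[OF fin(2)[OF d]]]
    note tl = tensor_lift[OF Edual_module Edual_module Edual_module koszul_concat_bilinear[OF I d]]
    show "?h (S, T) \<in> lin_maps R (?F I) (Edual I)"
      using lin_maps_comp[OF lin_maps_comp[OF diagonal_component(1)[OF I d] tm(1)] tl(1)] by simp
    assume x: "x \<in> elts P I"
    note g = gen_closed[OF rres_closed[OF I d x]] gen_closed[OF lres_closed[OF I d x]]
    show "?h (S, T) (gen R x)
        = koszul_concat R I (\<phi> S (gen R (rres I S x))) (\<psi> T (gen R (lres I T x)))"
      using tm(2)[OF g] tl(2)[OF lin_maps_closed[OF \<phi>[OF fin(1)[OF d]] g(1)]
          lin_maps_closed[OF \<psi>[OF fin(2)[OF d]] g(2)]]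
      by (simp add: diagonal_component(2)[OF I d x])
  qed
  have h': "?h d \<in> lin_maps R (?F I) (Edual I)" if "d \<in> decomps I" for d
    using h[of "fst d" "snd d"] that by simp
  have eq: "cup_map \<phi> \<psi> I z = (\<Oplus>\<^bsub>Edual I\<^esub>d\<in>decomps I. ?h d z)" if z: "z \<in> carrier (?F I)" for z
    unfolding cup_map_def koszul_mult_def
  proof (rule E.finsum_cong'[OF refl])
    show "(\<lambda>d. ?h d z) \<in> decomps I \<rightarrow> carrier (Edual I)"
      using lin_maps_closed[OF h' z] by blast
  qed (auto simp: cauchy_map_def)
  show "cup_map \<phi> \<psi> I \<in> lin_maps R (?F I) (Edual I)"
    by (rule lin_maps_cong[OF free_module lin_maps_finsum_pointwise[OF free_module Edual_module
            finite_decomps[OF I] h'] eq])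
  assume x: "x \<in> elts P I"
  have "koszul_coef R I (cup_map \<phi> \<psi> I (gen R x)) = (\<Oplus>d\<in>decomps I. koszul_coef R I (?h d (gen R x)))"
    unfolding eq[OF gen_closed[OF x]]
    by (rule koszul_coef_finsum[OF finite_decomps[OF I] lin_maps_closed[OF h' gen_closed[OF x]]])
  also have "\<dots> = (\<Oplus>d\<in>decomps I. cup_term \<phi> \<psi> I x d)"
  proof (rule finsum_cong'[OF refl])
    have val: "koszul_coef R I (?h (S, T) (gen R x)) = sgn_pow (sch S T) \<otimes>
        (koszul_coef R S (\<phi> S (gen R (rres I S x))) \<otimes> koszul_coef R T (\<psi> T (gen R (lres I T x))))"
      and cl: "sgn_pow (sch S T) \<otimes> (koszul_coef R S (\<phi> S (gen R (rres I S x)))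
        \<otimes> koszul_coef R T (\<psi> T (gen R (lres I T x)))) \<in> carrier R"
      if d: "(S, T) \<in> decomps I" for S T
    proof -
      have a: "\<phi> S (gen R (rres I S x)) \<in> carrier (Edual S)" "\<psi> T (gen R (lres I T x)) \<in> carrier (Edual T)"
        by (rule lin_maps_closed[OF \<phi>[OF fin(1)[OF d]] gen_closed[OF rres_closed[OF I d x]]],
            rule lin_maps_closed[OF \<psi>[OF fin(2)[OF d]] gen_closed[OF lres_closed[OF I d x]]])
      show "koszul_coef R I (?h (S, T) (gen R x)) = sgn_pow (sch S T) \<otimes>
        (koszul_coef R S (\<phi> S (gen R (rres I S x))) \<otimes> koszul_coef R T (\<psi> T (gen R (lres I T x))))"
        unfolding hx[OF d x] by (rule koszul_coef_concat[OF I d a])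
      show "sgn_pow (sch S T) \<otimes> (koszul_coef R S (\<phi> S (gen R (rres I S x)))
        \<otimes> koszul_coef R T (\<psi> T (gen R (lres I T x)))) \<in> carrier R"
        using koszul_coef_closed[OF a(1)] koszul_coef_closed[OF a(2)] by simp
    qed
    show "koszul_coef R I (?h d (gen R x)) = cup_term \<phi> \<psi> I x d" if "d \<in> decomps I" for d
      using val that by (cases d) (simp add: cup_term_def)
    show "cup_term \<phi> \<psi> I x \<in> decomps I \<rightarrow> carrier R"
      using cl by (auto simp: cup_term_def)
  qed
  finally show "koszul_coef R I (cup_map \<phi> \<psi> I (gen R x)) =
      (\<Oplus>d\<in>decomps I. cup_term \<phi> \<psi> I x d)" .
qed

abbreviation K :: "nat \<Rightarrow> ('r, nat set \<Rightarrow> ('a \<Rightarrow> 'r) \<Rightarrow> (nat list \<Rightarrow> 'r) set) module" where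
  "K \<equiv> koszul_cochains R (lin_species R P)"

lemmas cochain_lin = cochain_linear[OF species, simplified]

lemma koszul_coef_cup_gen:
  assumes "\<phi> \<in> carrier (K p)" "\<psi> \<in> carrier (K q)" "finite I" "x \<in> elts P I"
  shows "koszul_coef R I (cup_map \<phi> \<psi> I (gen R x)) = (\<Oplus>d\<in>decomps I. cup_term \<phi> \<psi> I x d)"
  by (rule cup_map_gen[OF cochain_lin[OF assms(1)] cochain_lin[OF assms(2)] assms(3,4)])

context
  fixes I S T x
  assumes I: "finite I" and d: "(S, T) \<in> decomps I" and x: "x \<in> elts P I"
begin

lemma finite_decomp: "finite S" "finite T"
  using I d by (auto simp: decomps_def)

lemma gen_restrictions_closed:
  "gen R (rres I S x) \<in> carrier (free_module R (elts P S))"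
  "gen R (lres I T x) \<in> carrier (free_module R (elts P T))"
  by (rule gen_closed[OF rres_closed[OF I d x]], rule gen_closed[OF lres_closed[OF I d x]])

lemma cochain_restrictions_closed:
  "\<phi> \<in> carrier (K p) \<Longrightarrow> \<phi> S (gen R (rres I S x)) \<in> carrier (Edual S)"
  "\<psi> \<in> carrier (K q) \<Longrightarrow> \<psi> T (gen R (lres I T x)) \<in> carrier (Edual T)"
  by (rule lin_maps_closed[OF cochain_lin gen_restrictions_closed(1)], assumption, rule finite_decomp)
    (rule lin_maps_closed[OF cochain_lin gen_restrictions_closed(2)], assumption, rule finite_decomp)

lemma cup_term_closed:
  "\<lbrakk>\<phi> \<in> carrier (K p); \<psi> \<in> carrier (K q)\<rbrakk> \<Longrightarrow> cup_term \<phi> \<psi> I x (S, T) \<in> carrier R"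
  using koszul_coef_closed[OF cochain_restrictions_closed(1)]
    koszul_coef_closed[OF cochain_restrictions_closed(2)] by (simp add: cup_term_def)

lemma cup_term_degree:
  assumes \<phi>: "\<phi> \<in> carrier (K p)" and \<psi>: "\<psi> \<in> carrier (K q)" and "card S \<noteq> p \<or> card T \<noteq> q"
  shows "cup_term \<phi> \<psi> I x (S, T) = \<zero>"
  using assms(3)
proof
  assume "card S \<noteq> p"
  then have "\<phi> S (gen R (rres I S x)) = \<zero>\<^bsub>Edual S\<^esub>"
    using cochain_degree[OF species \<phi> finite_decomp(1)] gen_restrictions_closed(1) by simp
  then show ?thesis
    using koszul_coef_closed[OF cochain_restrictions_closed(2)[OF \<psi>]]
    by (simp add: cup_term_def koszul_coef_zero)
next
  assume "card T \<noteq> q"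
  then have "\<psi> T (gen R (lres I T x)) = \<zero>\<^bsub>Edual T\<^esub>"
    using cochain_degree[OF species \<psi> finite_decomp(2)] gen_restrictions_closed(2) by simp
  then show ?thesis
    using koszul_coef_closed[OF cochain_restrictions_closed(1)[OF \<phi>]]
    by (simp add: cup_term_def koszul_coef_zero)
qed

text \<open>Naturality of the restrictions and of the two cochains contributes the signs of \<open>\<sigma>\<close> on the two
  blocks; together with the shuffle signs they combine to the sign of \<open>\<sigma>\<close> on \<open>I\<close>.\<close>

lemma cup_term_natural:
  assumes \<phi>: "\<phi> \<in> carrier (K p)" and \<psi>: "\<psi> \<in> carrier (K q)" and \<sigma>: "inj_on \<sigma> I"
  shows "cup_term \<phi> \<psi> (\<sigma> ` I) (relabel P I \<sigma> x) (\<sigma> ` S, \<sigma> ` T)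
    = sgn_pow (inversions (map \<sigma> (sorted_list_of_set I))) \<otimes> cup_term \<phi> \<psi> I x (S, T)"
proof -
  let ?inv = "\<lambda>I. sgn_pow (inversions (map \<sigma> (sorted_list_of_set I)))"
  let ?a = "koszul_coef R S (\<phi> S (gen R (rres I S x)))"
  let ?b = "koszul_coef R T (\<psi> T (gen R (lres I T x)))"
  note fin = finite_decomp
  have inj: "inj_on \<sigma> S" "inj_on \<sigma> T" using \<sigma> d by (auto simp: decomps_def inj_on_def)
  have "gen R (rres (\<sigma> ` I) (\<sigma> ` S) (relabel P I \<sigma> x))
      = act (lin_species R P) S \<sigma> (gen R (rres I S x))"
    using rres_natural[OF I \<sigma> d x] lin_species_act(2)[OF set_species fin(1) inj(1) rres_closed[OF I d x]]
    by simp
  then have a: "koszul_coef R (\<sigma> ` S) (\<phi> (\<sigma> ` S) (gen R (rres (\<sigma> ` I) (\<sigma> ` S) (relabel P I \<sigma> x))))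
      = ?inv S \<otimes> ?a"
    using cochain_natural[OF species \<phi> fin(1) inj(1), of "gen R (rres I S x)"] gen_restrictions_closed(1)
      koszul_coef_act[OF fin(1) inj(1) cochain_restrictions_closed(1)[OF \<phi>]] by simp
  have "gen R (lres (\<sigma> ` I) (\<sigma> ` T) (relabel P I \<sigma> x))
      = act (lin_species R P) T \<sigma> (gen R (lres I T x))"
    using lres_natural[OF I \<sigma> d x] lin_species_act(2)[OF set_species fin(2) inj(2) lres_closed[OF I d x]]
    by simp
  then have b: "koszul_coef R (\<sigma> ` T) (\<psi> (\<sigma> ` T) (gen R (lres (\<sigma> ` I) (\<sigma> ` T) (relabel P I \<sigma> x))))
      = ?inv T \<otimes> ?b"
    using cochain_natural[OF species \<psi> fin(2) inj(2), of "gen R (lres I T x)"] gen_restrictions_closed(2)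
      koszul_coef_act[OF fin(2) inj(2) cochain_restrictions_closed(2)[OF \<psi>]] by simp
  have cl: "?a \<in> carrier R" "?b \<in> carrier R"
    by (rule koszul_coef_closed[OF cochain_restrictions_closed(1)[OF \<phi>]],
        rule koszul_coef_closed[OF cochain_restrictions_closed(2)[OF \<psi>]])
  have "cup_term \<phi> \<psi> (\<sigma> ` I) (relabel P I \<sigma> x) (\<sigma> ` S, \<sigma> ` T)
      = (sgn_pow (sch (\<sigma> ` S) (\<sigma> ` T)) \<otimes> (?inv S \<otimes> ?inv T)) \<otimes> (?a \<otimes> ?b)"
    using cl by (simp add: cup_term_def a b m_ac)
  also have "\<dots> = ?inv I \<otimes> cup_term \<phi> \<psi> I x (S, T)"
    using cl by (simp add: sgn_pow_relabel_shuffle[OF I \<sigma> d, symmetric] cup_term_def m_assoc)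
  finally show ?thesis .
qed

end

lemma cup_term_Pi:
  assumes "\<phi> \<in> carrier (K p)" "\<psi> \<in> carrier (K q)" "finite I" "x \<in> elts P I"
  shows "cup_term \<phi> \<psi> I x \<in> decomps I \<rightarrow> carrier R"
proof
  fix d assume "d \<in> decomps I"
  then show "cup_term \<phi> \<psi> I x d \<in> carrier R"
    using cup_term_closed[OF assms(3) _ assms(4,1,2), of "fst d" "snd d"] by simp
qed

lemma cup_sum_relabel:
  assumes \<phi>: "\<phi> \<in> carrier (K p)" and \<psi>: "\<psi> \<in> carrier (K q)"
    and I: "finite I" and \<sigma>: "inj_on \<sigma> I" and x: "x \<in> elts P I"
  shows "(\<Oplus>d\<in>decomps (\<sigma> ` I). cup_term \<phi> \<psi> (\<sigma> ` I) (relabel P I \<sigma> x) d)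
    = sgn_pow (inversions (map \<sigma> (sorted_list_of_set I))) \<otimes> (\<Oplus>d\<in>decomps I. cup_term \<phi> \<psi> I x d)"
proof -
  let ?im = "\<lambda>(S, T). (\<sigma> ` S, \<sigma> ` T)"
  let ?s = "sgn_pow (inversions (map \<sigma> (sorted_list_of_set I)))"
  let ?x = "relabel P I \<sigma> x"
  have x': "?x \<in> elts P (\<sigma> ` I)" using set_species I \<sigma> x by (auto simp: is_set_species_def)
  have inj: "inj_on ?im (decomps I)"
  proof (rule inj_onI)
    fix d e assume "d \<in> decomps I" "e \<in> decomps I" "?im d = ?im e"
    moreover from this have "fst d \<subseteq> I" "fst e \<subseteq> I" "snd d \<subseteq> I" "snd e \<subseteq> I"
      by (auto simp: decomps_def)
    ultimately show "d = e"
      by (simp add: prod_eq_iff case_prod_unfold inj_on_image_eq_iff[OF \<sigma>])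
  qed
  have cl: "cup_term \<phi> \<psi> (\<sigma> ` I) ?x \<in> ?im ` decomps I \<rightarrow> carrier R"
    using cup_term_Pi[OF \<phi> \<psi> _ x'] I by (simp add: decomps_image_eq[OF \<sigma>])
  have "(\<Oplus>d\<in>decomps (\<sigma> ` I). cup_term \<phi> \<psi> (\<sigma> ` I) ?x d)
      = (\<Oplus>d\<in>decomps I. cup_term \<phi> \<psi> (\<sigma> ` I) ?x (?im d))"
    unfolding decomps_image_eq[OF \<sigma>] by (rule finsum_reindex[OF cl inj])
  also have "\<dots> = (\<Oplus>d\<in>decomps I. ?s \<otimes> cup_term \<phi> \<psi> I x d)"
  proof (rule finsum_cong'[OF refl])
    show "(\<lambda>d. ?s \<otimes> cup_term \<phi> \<psi> I x d) \<in> decomps I \<rightarrow> carrier R"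
      using cup_term_Pi[OF \<phi> \<psi> I x] by auto
    show "cup_term \<phi> \<psi> (\<sigma> ` I) ?x (?im d) = ?s \<otimes> cup_term \<phi> \<psi> I x d" if "d \<in> decomps I" for d
      using cup_term_natural[OF I _ x \<phi> \<psi> \<sigma>] that by (cases d) simp
  qed
  also have "\<dots> = ?s \<otimes> (\<Oplus>d\<in>decomps I. cup_term \<phi> \<psi> I x d)"
    by (rule finsum_rdistr[OF finite_decomps[OF I] _ cup_term_Pi[OF \<phi> \<psi> I x], symmetric]) simp
  finally show ?thesis .
qed

lemma koszul_cup_closed:
  assumes \<phi>: "\<phi> \<in> carrier (K p)" and \<psi>: "\<psi> \<in> carrier (K q)"
  shows "koszul_cup R P lres rres \<phi> \<psi> \<in> carrier (K (p + q))"
  unfolding koszul_cup_eq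
proof (rule koszul_cochains_restrictI[OF species])
  let ?F = "\<lambda>I. free_module R (elts P I)"
  have lin: "cup_map \<phi> \<psi> I \<in> lin_maps R (?F I) (Edual I)" if "finite I" for I
    by (rule cup_map_linear[OF cochain_lin[OF \<phi>] cochain_lin[OF \<psi>] that])
  fix I :: "nat set" assume I: "finite I"
  interpret E: module R "Edual I" by (rule Edual_module)
  show "cup_map \<phi> \<psi> I \<in> lin_maps R (obj (lin_species R P) I) (Edual I)"
    using lin[OF I] by simp
  show "cup_map \<phi> \<psi> I z = \<zero>\<^bsub>Edual I\<^esub>"
    if card: "card I \<noteq> p + q" and z: "z \<in> carrier (obj (lin_species R P) I)" for z
  proof (rule free_module_linear_eqI[OF Edual_module lin[OF I], where k = "\<lambda>_. \<zero>\<^bsub>Edual I\<^esub>"])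
    show "(\<lambda>_. \<zero>\<^bsub>Edual I\<^esub>) \<in> lin_maps R (?F I) (Edual I)" by (rule lin_mapsI) auto
    fix x assume x: "x \<in> elts P I"
    have "cup_term \<phi> \<psi> I x d = \<zero>" if "d \<in> decomps I" for d
    proof -
      obtain S T where d: "d = (S, T)" "(S, T) \<in> decomps I" using \<open>d \<in> decomps I\<close> by (cases d) auto
      then have "card S + card T = card I"
        using I by (auto simp: decomps_def card_Un_disjoint)
      then have "card S \<noteq> p \<or> card T \<noteq> q" using card by auto
      then show ?thesis using cup_term_degree[OF I d(2) x \<phi> \<psi>] d(1) by simp
    qed
    then have "koszul_coef R I (cup_map \<phi> \<psi> I (gen R x)) = \<zero>"
      unfolding koszul_coef_cup_gen[OF \<phi> \<psi> I x] by (rule add.finprod_one_eqI)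
    then show "cup_map \<phi> \<psi> I (gen R x) = \<zero>\<^bsub>Edual I\<^esub>"
      using lin_maps_closed[OF lin[OF I] gen_closed[OF x]]
      by (intro Edual_eqI[OF I]) (simp_all add: koszul_coef_zero)
  qed (use z in simp)
  show "cup_map \<phi> \<psi> (\<sigma> ` I) (act (lin_species R P) I \<sigma> z) = act (koszul_dual R) I \<sigma> (cup_map \<phi> \<psi> I z)"
    if \<sigma>: "inj_on \<sigma> I" and z: "z \<in> carrier (obj (lin_species R P) I)" for \<sigma> z
  proof (rule free_module_linear_eqI[where A = "elts P I" and x = z and N = "Edual (\<sigma> ` I)"
        and h = "\<lambda>z. cup_map \<phi> \<psi> (\<sigma> ` I) (act (lin_species R P) I \<sigma> z)"
        and k = "\<lambda>z. act (koszul_dual R) I \<sigma> (cup_map \<phi> \<psi> I z)"])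
    have J: "finite (\<sigma> ` I)" using I by simp
    show h: "(\<lambda>z. cup_map \<phi> \<psi> (\<sigma> ` I) (act (lin_species R P) I \<sigma> z)) \<in> lin_maps R (?F I) (Edual (\<sigma> ` I))"
      by (rule lin_maps_comp[OF lin_species_act(1)[OF set_species I \<sigma>] lin[OF J]])
    show k: "(\<lambda>z. act (koszul_dual R) I \<sigma> (cup_map \<phi> \<psi> I z)) \<in> lin_maps R (?F I) (Edual (\<sigma> ` I))"
      by (rule lin_maps_comp[OF lin[OF I] Edual_act_linear[OF \<sigma>]])
    fix x assume x: "x \<in> elts P I"
    have x': "relabel P I \<sigma> x \<in> elts P (\<sigma> ` I)" using set_species I \<sigma> x by (auto simp: is_set_species_def)
    have "koszul_coef R (\<sigma> ` I) (cup_map \<phi> \<psi> (\<sigma> ` I) (act (lin_species R P) I \<sigma> (gen R x)))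
        = koszul_coef R (\<sigma> ` I) (act (koszul_dual R) I \<sigma> (cup_map \<phi> \<psi> I (gen R x)))"
      using koszul_coef_act[OF I \<sigma> lin_maps_closed[OF lin[OF I] gen_closed[OF x]]]
      by (simp add: lin_species_act(2)[OF set_species I \<sigma> x] koszul_coef_cup_gen[OF \<phi> \<psi> J x']
          koszul_coef_cup_gen[OF \<phi> \<psi> I x] cup_sum_relabel[OF \<phi> \<psi> I \<sigma> x])
    then show "cup_map \<phi> \<psi> (\<sigma> ` I) (act (lin_species R P) I \<sigma> (gen R x))
        = act (koszul_dual R) I \<sigma> (cup_map \<phi> \<psi> I (gen R x))"
      by (rule Edual_eqI[OF J lin_maps_closed[OF h gen_closed[OF x]]
            lin_maps_closed[OF k gen_closed[OF x]]])
  qed (use z Edual_module in simp_all)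
qed

text \<open>Identities between cochains are reduced to identities in the ground ring: by linearity to basis
  elements, and by the rank one description of \<open>E!\<close> to coordinates.\<close>

lemma koszul_cochains_eqI_gen:
  assumes \<phi>: "\<phi> \<in> carrier (K p)" and \<psi>: "\<psi> \<in> carrier (K p)"
    and eq: "\<And>I x. \<lbrakk>finite I; x \<in> elts P I\<rbrakk> \<Longrightarrow>
      koszul_coef R I (\<phi> I (gen R x)) = koszul_coef R I (\<psi> I (gen R x))"
  shows "\<phi> = \<psi>"
proof (rule koszul_cochains_eqI[OF species \<phi> \<psi>])
  fix I z assume I: "finite I" and z: "z \<in> carrier (obj (lin_species R P) I)"
  show "\<phi> I z = \<psi> I z"
  proof (rule free_module_linear_eqI[OF Edual_module cochain_lin[OF \<phi> I] cochain_lin[OF \<psi> I]])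
    show "\<phi> I (gen R x) = \<psi> I (gen R x)" if "x \<in> elts P I" for x
      by (rule Edual_eqI[OF I lin_maps_closed[OF cochain_lin[OF \<phi> I] gen_closed[OF that]]
            lin_maps_closed[OF cochain_lin[OF \<psi> I] gen_closed[OF that]] eq[OF I that]])
  qed (use z in simp)
qed

lemma koszul_coef_koszul_cup_gen:
  assumes "\<phi> \<in> carrier (K p)" "\<psi> \<in> carrier (K q)" "finite I" "x \<in> elts P I"
  shows "koszul_coef R I (koszul_cup R P lres rres \<phi> \<psi> I (gen R x)) = (\<Oplus>d\<in>decomps I. cup_term \<phi> \<psi> I x d)"
  using koszul_coef_cup_gen[OF assms] koszul_cup_apply[OF assms(3) gen_closed[OF assms(4)]] by simp

lemma koszul_cup_bilinear: "koszul_cup R P lres rres \<in> bilin_maps R (K p) (K q) (K (p + q))"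
proof -
  interpret Kp: module R "K p" by (rule koszul_cochains_module[OF species])
  interpret Kq: module R "K q" by (rule koszul_cochains_module[OF species])
  interpret Kpq: module R "K (p + q)" by (rule koszul_cochains_module[OF species])
  note app = koszul_cochains_apply[OF species, unfolded obj_lin_species]
  note coef = koszul_coef_add koszul_coef_smult koszul_coef_closed
  note closed = koszul_cup_closed Kp.a_closed Kq.a_closed Kp.smult_closed Kq.smult_closed
    Kpq.a_closed Kpq.smult_closed
  have expand: "koszul_coef R I ((koszul_cup R P lres rres \<phi> \<psi>
            \<oplus>\<^bsub>K (p + q)\<^esub> koszul_cup R P lres rres \<phi>' \<psi>') I (gen R x))
      = (\<Oplus>d\<in>decomps I. cup_term \<phi> \<psi> I x d \<oplus> cup_term \<phi>' \<psi>' I x d)"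
    if c: "\<phi> \<in> carrier (K p)" "\<psi> \<in> carrier (K q)" "\<phi>' \<in> carrier (K p)" "\<psi>' \<in> carrier (K q)"
      and I: "finite I" and x: "x \<in> elts P I" for \<phi> \<psi> \<phi>' \<psi>' I x
    using lin_maps_closed[OF cochain_lin[OF koszul_cup_closed[OF c(1,2)] I] gen_closed[OF x]]
      lin_maps_closed[OF cochain_lin[OF koszul_cup_closed[OF c(3,4)] I] gen_closed[OF x]]
    by (simp add: app[OF I gen_closed[OF x]] koszul_coef_add koszul_coef_koszul_cup_gen[OF c(1,2) I x]
        koszul_coef_koszul_cup_gen[OF c(3,4) I x]
        finsum_addf[OF cup_term_Pi[OF c(1,2) I x] cup_term_Pi[OF c(3,4) I x]])
  have expand_smult: "koszul_coef R I ((r \<odot>\<^bsub>K (p + q)\<^esub> koszul_cup R P lres rres \<phi> \<psi>) I (gen R x))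
      = (\<Oplus>d\<in>decomps I. r \<otimes> cup_term \<phi> \<psi> I x d)"
    if c: "\<phi> \<in> carrier (K p)" "\<psi> \<in> carrier (K q)" and r: "r \<in> carrier R"
      and I: "finite I" and x: "x \<in> elts P I" for \<phi> \<psi> r I x
    using lin_maps_closed[OF cochain_lin[OF koszul_cup_closed[OF c] I] gen_closed[OF x]] r
    by (simp add: app[OF I gen_closed[OF x]] koszul_coef_smult koszul_coef_koszul_cup_gen[OF c I x]
        finsum_rdistr[OF finite_decomps[OF I] r cup_term_Pi[OF c I x]])
  have sum_cong: "(\<Oplus>d\<in>decomps I. f d) = (\<Oplus>d\<in>decomps I. g d)"
    if "g \<in> decomps I \<rightarrow> carrier R" "\<And>S T. (S, T) \<in> decomps I \<Longrightarrow> f (S, T) = g (S, T)" for f g I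
    using that by (intro finsum_cong'[OF refl]) auto
  show ?thesis
  proof (rule bilin_mapsI)
    fix \<phi> \<psi> assume "\<phi> \<in> carrier (K p)" "\<psi> \<in> carrier (K q)"
    then show "koszul_cup R P lres rres \<phi> \<psi> \<in> carrier (K (p + q))" by (rule koszul_cup_closed)
  next
    fix \<phi> \<phi>' \<psi> assume c: "\<phi> \<in> carrier (K p)" "\<phi>' \<in> carrier (K p)" "\<psi> \<in> carrier (K q)"
    show "koszul_cup R P lres rres (\<phi> \<oplus>\<^bsub>K p\<^esub> \<phi>') \<psi>
        = koszul_cup R P lres rres \<phi> \<psi>
            \<oplus>\<^bsub>K (p + q)\<^esub> koszul_cup R P lres rres \<phi>' \<psi>"
    proof (rule koszul_cochains_eqI_gen)
      fix I x assume I: "finite I" and x: "x \<in> elts P I"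
      show "koszul_coef R I (koszul_cup R P lres rres (\<phi> \<oplus>\<^bsub>K p\<^esub> \<phi>') \<psi> I (gen R x))
          = koszul_coef R I ((koszul_cup R P lres rres \<phi> \<psi>
            \<oplus>\<^bsub>K (p + q)\<^esub> koszul_cup R P lres rres \<phi>' \<psi>) I (gen R x))"
        unfolding koszul_coef_koszul_cup_gen[OF Kp.a_closed[OF c(1,2)] c(3) I x] expand[OF c(1,3) c(2,3) I x]
      proof (rule sum_cong)
        show "(\<lambda>d. cup_term \<phi> \<psi> I x d \<oplus> cup_term \<phi>' \<psi> I x d) \<in> decomps I \<rightarrow> carrier R"
          using cup_term_Pi[OF c(1,3) I x] cup_term_Pi[OF c(2,3) I x] by auto
        fix S T assume d: "(S, T) \<in> decomps I"
        note r = cochain_restrictions_closed[OF I d x]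
        show "cup_term (\<phi> \<oplus>\<^bsub>K p\<^esub> \<phi>') \<psi> I x (S, T) = cup_term \<phi> \<psi> I x (S, T) \<oplus> cup_term \<phi>' \<psi> I x (S, T)"
          using r(1)[OF c(1)] r(1)[OF c(2)] r(2)[OF c(3)]
          by (simp add: cup_term_def app[OF finite_decomp(1)[OF I d x] gen_restrictions_closed(1)[OF I d x]]
              coef l_distr r_distr)
      qed
    qed (use c closed in auto)
  next
    fix \<phi> \<psi> \<psi>' assume c: "\<phi> \<in> carrier (K p)" "\<psi> \<in> carrier (K q)" "\<psi>' \<in> carrier (K q)"
    show "koszul_cup R P lres rres \<phi> (\<psi> \<oplus>\<^bsub>K q\<^esub> \<psi>')
        = koszul_cup R P lres rres \<phi> \<psi> \<oplus>\<^bsub>K (p + q)\<^esub> koszul_cup R P lres rres \<phi> \<psi>'"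
    proof (rule koszul_cochains_eqI_gen)
      fix I x assume I: "finite I" and x: "x \<in> elts P I"
      show "koszul_coef R I (koszul_cup R P lres rres \<phi> (\<psi> \<oplus>\<^bsub>K q\<^esub> \<psi>') I (gen R x))
          = koszul_coef R I ((koszul_cup R P lres rres \<phi> \<psi>
            \<oplus>\<^bsub>K (p + q)\<^esub> koszul_cup R P lres rres \<phi> \<psi>') I (gen R x))"
        unfolding koszul_coef_koszul_cup_gen[OF c(1) Kq.a_closed[OF c(2,3)] I x] expand[OF c(1,2) c(1,3) I x]
      proof (rule sum_cong)
        show "(\<lambda>d. cup_term \<phi> \<psi> I x d \<oplus> cup_term \<phi> \<psi>' I x d) \<in> decomps I \<rightarrow> carrier R"
          using cup_term_Pi[OF c(1,2) I x] cup_term_Pi[OF c(1,3) I x] by auto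
        fix S T assume d: "(S, T) \<in> decomps I"
        note r = cochain_restrictions_closed[OF I d x]
        show "cup_term \<phi> (\<psi> \<oplus>\<^bsub>K q\<^esub> \<psi>') I x (S, T) = cup_term \<phi> \<psi> I x (S, T) \<oplus> cup_term \<phi> \<psi>' I x (S, T)"
          using r(1)[OF c(1)] r(2)[OF c(2)] r(2)[OF c(3)]
          by (simp add: cup_term_def app[OF finite_decomp(2)[OF I d x] gen_restrictions_closed(2)[OF I d x]]
              coef r_distr)
      qed
    qed (use c closed in auto)
  next
    fix r \<phi> \<psi> assume c: "r \<in> carrier R" "\<phi> \<in> carrier (K p)" "\<psi> \<in> carrier (K q)"
    show "koszul_cup R P lres rres (r \<odot>\<^bsub>K p\<^esub> \<phi>) \<psi> = r \<odot>\<^bsub>K (p + q)\<^esub> koszul_cup R P lres rres \<phi> \<psi>"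
    proof (rule koszul_cochains_eqI_gen)
      fix I x assume I: "finite I" and x: "x \<in> elts P I"
      show "koszul_coef R I (koszul_cup R P lres rres (r \<odot>\<^bsub>K p\<^esub> \<phi>) \<psi> I (gen R x))
          = koszul_coef R I ((r \<odot>\<^bsub>K (p + q)\<^esub> koszul_cup R P lres rres \<phi> \<psi>) I (gen R x))"
        unfolding koszul_coef_koszul_cup_gen[OF Kp.smult_closed[OF c(1,2)] c(3) I x] expand_smult[OF c(2,3,1) I x]
      proof (rule sum_cong)
        show "(\<lambda>d. r \<otimes> cup_term \<phi> \<psi> I x d) \<in> decomps I \<rightarrow> carrier R"
          using cup_term_Pi[OF c(2,3) I x] c(1) by auto
        fix S T assume d: "(S, T) \<in> decomps I"
        note res = cochain_restrictions_closed[OF I d x]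
        show "cup_term (r \<odot>\<^bsub>K p\<^esub> \<phi>) \<psi> I x (S, T) = r \<otimes> cup_term \<phi> \<psi> I x (S, T)"
          using res(1)[OF c(2)] res(2)[OF c(3)] c(1)
          by (simp add: cup_term_def app[OF finite_decomp(1)[OF I d x] gen_restrictions_closed(1)[OF I d x]]
              coef m_ac)
      qed
    qed (use c closed in auto)
    show "koszul_cup R P lres rres \<phi> (r \<odot>\<^bsub>K q\<^esub> \<psi>) = r \<odot>\<^bsub>K (p + q)\<^esub> koszul_cup R P lres rres \<phi> \<psi>"
    proof (rule koszul_cochains_eqI_gen)
      fix I x assume I: "finite I" and x: "x \<in> elts P I"
      show "koszul_coef R I (koszul_cup R P lres rres \<phi> (r \<odot>\<^bsub>K q\<^esub> \<psi>) I (gen R x))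
          = koszul_coef R I ((r \<odot>\<^bsub>K (p + q)\<^esub> koszul_cup R P lres rres \<phi> \<psi>) I (gen R x))"
        unfolding koszul_coef_koszul_cup_gen[OF c(2) Kq.smult_closed[OF c(1,3)] I x] expand_smult[OF c(2,3,1) I x]
      proof (rule sum_cong)
        show "(\<lambda>d. r \<otimes> cup_term \<phi> \<psi> I x d) \<in> decomps I \<rightarrow> carrier R"
          using cup_term_Pi[OF c(2,3) I x] c(1) by auto
        fix S T assume d: "(S, T) \<in> decomps I"
        note res = cochain_restrictions_closed[OF I d x]
        show "cup_term \<phi> (r \<odot>\<^bsub>K q\<^esub> \<psi>) I x (S, T) = r \<otimes> cup_term \<phi> \<psi> I x (S, T)"
          using res(1)[OF c(2)] res(2)[OF c(3)] c(1)
          by (simp add: cup_term_def app[OF finite_decomp(2)[OF I d x] gen_restrictions_closed(2)[OF I d x]]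
              coef m_ac)
      qed
    qed (use c closed in auto)
  qed
qed

text \<open>On a basis element, the degree \<open>p + q\<close> cochain of \<open>hom_cup\<close> has coordinate \<open>(-1)^(p + q)\<close> times
  its value, and the cup product has the sum of the cup terms as coordinate. The sum is first
  restricted to blocks of sizes \<open>p\<close> and \<open>q\<close>, where the cochains of \<open>f\<close> and \<open>g\<close> are values of \<open>f\<close> and
  \<open>g\<close> at standardized restrictions; the rest is linearity.\<close>

lemma hom_cup_formula:
  assumes f: "f \<in> sgn_homs R (lin_species R P) p" and g: "g \<in> sgn_homs R (lin_species R P) q"
    and z: "z \<in> carrier (obj (lin_species R P) {1..p + q})"
  shows "hom_cup R P lres rres p q f g z = lin_ext R (self_module R)
    (\<lambda>x. finsum R (\<lambda>(S, T). sgn_pow (sch S T)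
        \<otimes> f (act (lin_species R P) S (std S) (gen R (rres {1..p + q} S x)))
        \<otimes> g (act (lin_species R P) T (std T) (gen R (lres {1..p + q} T x))))
      {(S, T) \<in> decomps {1..p + q}. card S = p \<and> card T = q}) z"
proof -
  let ?X = "lin_species R P" and ?I = "{1..p + q}"
  let ?\<phi> = "koszul_of_hom R ?X p f" and ?\<psi> = "koszul_of_hom R ?X q g"
  let ?D = "{(S, T) \<in> decomps ?I. card S = p \<and> card T = q}"
  define t where "t x = (\<lambda>(S, T). sgn_pow (sch S T) \<otimes> f (act ?X S (std S) (gen R (rres ?I S x)))
      \<otimes> g (act ?X T (std T) (gen R (lres ?I T x))))" for x
  define h where "h = hom_cup R P lres rres p q f g"
  have \<phi>: "?\<phi> \<in> carrier (K p)" and \<psi>: "?\<psi> \<in> carrier (K q)"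
    using koszul_of_hom_closed[OF species] f g by auto
  note bij = koszul_of_hom_bij[OF species, of "p + q"]
  have mem: "koszul_cup R P lres rres ?\<phi> ?\<psi>
      \<in> koszul_of_hom R ?X (p + q) ` sgn_homs R ?X (p + q)"
    using koszul_cup_closed[OF \<phi> \<psi>] bij_betw_imp_surj_on[OF bij] by simp
  have h: "h \<in> sgn_homs R ?X (p + q)"
    unfolding h_def hom_cup_def by (rule inv_into_into[OF mem])
  have Kh: "koszul_of_hom R ?X (p + q) h = koszul_cup R P lres rres ?\<phi> ?\<psi>"
    unfolding h_def hom_cup_def by (rule f_inv_into_f[OF mem])
  have I: "finite ?I" by simp
  have val: "h (gen R x) = (\<Oplus>d\<in>?D. t x d)" if x: "x \<in> elts P ?I" for x
  proof -
    have gx: "gen R x \<in> carrier (obj ?X ?I)" using gen_closed[OF x] by simp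
    have fin: "finite ?D" using finite_decomps[OF I] by (rule rev_finite_subset) auto
    have tc: "t x d \<in> carrier R" "cup_term ?\<phi> ?\<psi> ?I x d = sgn_pow (p + q) \<otimes> t x d"
      if dD: "d \<in> ?D" for d
    proof -
      obtain S T where dST: "d = (S, T)" and d: "(S, T) \<in> decomps ?I" and card: "card S = p" "card T = q"
        using dD by auto
      note fd = finite_decomp[OF I d x]
      have r: "gen R (rres ?I S x) \<in> carrier (obj ?X S)" "gen R (lres ?I T x) \<in> carrier (obj ?X T)"
        using gen_restrictions_closed[OF I d x] by simp_all
      let ?a = "f (act ?X S (std S) (gen R (rres ?I S x)))"
      let ?b = "g (act ?X T (std T) (gen R (lres ?I T x)))"
      have cl: "?a \<in> carrier R" "?b \<in> carrier R"
        using sgn_homsD(3)[OF species f] sgn_homsD(3)[OF species g]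
          species_act_std[OF species fd(1) r(1)] species_act_std[OF species fd(2) r(2)] card by simp_all
      then show "t x d \<in> carrier R" by (simp add: dST t_def)
      show "cup_term ?\<phi> ?\<psi> ?I x d = sgn_pow (p + q) \<otimes> t x d"
        using cl koszul_coef_koszul_of_hom[OF species f fd(1) card(1) r(1)]
          koszul_coef_koszul_of_hom[OF species g fd(2) card(2) r(2)]
        by (simp add: dST t_def cup_term_def sgn_pow_add m_ac)
    qed
    have "sgn_pow (p + q) \<otimes> h (gen R x) = koszul_coef R ?I (koszul_cup R P lres rres ?\<phi> ?\<psi> ?I (gen R x))"
      using koszul_coef_koszul_of_hom_standard[OF species h gx] Kh by simp
    also have "\<dots> = (\<Oplus>d\<in>decomps ?I. cup_term ?\<phi> ?\<psi> ?I x d)"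
      by (rule koszul_coef_koszul_cup_gen[OF \<phi> \<psi> I x])
    also have "\<dots> = (\<Oplus>d\<in>?D. sgn_pow (p + q) \<otimes> t x d)"
    proof (rule add.finprod_mono_neutral_cong_right[OF finite_decomps[OF I]])
      show "cup_term ?\<phi> ?\<psi> ?I x d = \<zero>" if "d \<in> decomps ?I - ?D" for d
        using that cup_term_degree[OF I _ x \<phi> \<psi>] by (cases d) auto
    qed (use tc cup_term_Pi[OF \<phi> \<psi> I x] in auto)
    also have "\<dots> = sgn_pow (p + q) \<otimes> (\<Oplus>d\<in>?D. t x d)"
      using tc(1) by (intro finsum_rdistr[OF fin, symmetric]) auto
    (* Multiplying by the sign once more cancels it on both sides. *)
    finally have "sgn_pow (p + q) \<otimes> (sgn_pow (p + q) \<otimes> h (gen R x))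
        = sgn_pow (p + q) \<otimes> (sgn_pow (p + q) \<otimes> (\<Oplus>d\<in>?D. t x d))" by simp
    moreover have "(\<Oplus>d\<in>?D. t x d) \<in> carrier R" using tc(1) by (intro finsum_closed) auto
    ultimately show ?thesis using sgn_homsD(3)[OF species h gx] by simp
  qed
  have lin: "h \<in> lin_maps R (free_module R (elts P ?I)) (self_module R)"
    using sgn_homsD(1)[OF species h] by simp
  have "h z = lin_ext R (self_module R) (\<lambda>x. \<Oplus>d\<in>?D. t x d) z"
    by (rule free_module_linear_eq_lin_ext[OF self_module lin _ val]) (use z in simp_all)
  then show ?thesis by (simp add: h_def t_def)
qed

end

theorem theorem3p5:
  fixes R :: "('r, 'm) ring_scheme"
    and P :: "'a set_species"
    and lam :: "nat set \<Rightarrow> ('a \<Rightarrow> 'r) \<Rightarrow> (nat set \<times> nat set)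
      \<Rightarrow> (((nat set \<Rightarrow> 'r) \<times> ('a \<Rightarrow> 'r)) \<Rightarrow> 'r) set"
    and rho :: "nat set \<Rightarrow> ('a \<Rightarrow> 'r) \<Rightarrow> (nat set \<times> nat set)
      \<Rightarrow> ((('a \<Rightarrow> 'r) \<times> (nat set \<Rightarrow> 'r)) \<Rightarrow> 'r) set"
    and lres rres :: "nat set \<Rightarrow> nat set \<Rightarrow> 'a \<Rightarrow> 'a"
    and p q :: nat
  assumes "cring R"
    and "linearized_exp_bicomodule R P lam rho lres rres"
  shows
    "(\<forall>n. bij_betw (koszul_of_hom R (lin_species R P) n)
        (sgn_homs R (lin_species R P) n) (carrier (koszul_cochains R (lin_species R P) n))) \<and>
     (\<exists>cup \<in> lin_maps R
          (tensor R (koszul_cochains R (lin_species R P) p) (koszul_cochains R (lin_species R P) q))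
          (koszul_cochains R (lin_species R P) (p + q)).
        \<forall>\<phi>\<in>carrier (koszul_cochains R (lin_species R P) p).
        \<forall>\<psi>\<in>carrier (koszul_cochains R (lin_species R P) q).
          cup (pure_tensor R (koszul_cochains R (lin_species R P) p)
                 (koszul_cochains R (lin_species R P) q) \<phi> \<psi>)
          = koszul_cup R P lres rres \<phi> \<psi>) \<and>
     (\<forall>f\<in>sgn_homs R (lin_species R P) p. \<forall>g\<in>sgn_homs R (lin_species R P) q.
      \<forall>z\<in>carrier (obj (lin_species R P) {1..p + q}).
        hom_cup R P lres rres p q f g z =
        lin_ext R (self_module R)
          (\<lambda>x. finsum R
             (\<lambda>(S, T). (\<ominus>\<^bsub>R\<^esub> \<one>\<^bsub>R\<^esub>) [^]\<^bsub>R\<^esub> sch S T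
                \<otimes>\<^bsub>R\<^esub> f (act (lin_species R P) S (std S) (gen R (rres {1..p + q} S x)))
                \<otimes>\<^bsub>R\<^esub> g (act (lin_species R P) T (std T) (gen R (lres {1..p + q} T x))))
             {(S, T) \<in> decomps {1..p + q}. card S = p \<and> card T = q})
          z)"
proof -
  interpret L: linearized_exp_bicomodule R P lam rho lres rres by fact
  note modules = L.koszul_cochains_module[OF L.species]
  note lift = L.tensor_lift[OF modules modules modules L.koszul_cup_bilinear]
  show ?thesis
    using L.koszul_of_hom_bij[OF L.species] L.hom_cup_formula lift
    by (intro conjI allI ballI bexI[OF _ lift(1)]) auto
qed

end
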